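(* Let $A=(A_{ij})_{1\le i,j\le n}$ be an upper triangular operator-valued matrix in $M_n(L^\infty(\mu))$ whose main diagonal entries are all equal to one function $f\in L^\infty(\mu)$ (that is, $A_{ii}=f$ for all $i$, $A_{ij}=f_{ij}\in L^\infty(\mu)$ for $i<j$, and $A_{ij}=0$ for $i>j$), such that $f_{i,i+1}$ is supported on $\Lambda$ for $i=1,2,\dots,n-1$. Then $$K_0(\{A\}'\cap M_n(L^\infty(\mu)))\cong\{\phi:\Lambda\to\mathbb Z \mid \phi\text{ is bounded Borel}\}.$$
   Context: $\mu$ is (the completion of) a finite positive regular Borel measure supported on a compact subset $\Lambda$ of $\mathbb C$. Elements of $L^\infty(\mu)$ are regarded as multiplication operators on $L^2(\mu)$, and $M_n(L^\infty(\mu))$ acts on $(L^2(\mu))^{(n)}$. The relative commutant is $\{A\}'\cap M_n(L^\infty(\mu))=\{B\in M_n(L^\infty(\mu)):AB=BA\}$, a unital Banach algebra, and $K_0$ is its $K_0$-group in the sense of $K$-theory for Banach algebras (Grothendieck group of the semigroup of similarity classes of idempotents in matrix algebras over it). "$f$ is supported on $\Lambda$" means $f(\lambda)\ne0$ for $\mu$-almost every $\lambda\in\Lambda$. Borel functions are treated as representatives of classes modulo $\mu$-almost everywhere equality (functions agreeing $\mu$-a.e. are identified), with pointwise addition. *)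

theory Defs
  imports "HOL-Analysis.Analysis" "HOL-Algebra.QuotRing" "Jordan_Normal_Form.Matrix"
begin

section \<open>The algebra of essentially bounded functions\<close>

definition ess_bounded_ring :: "'a measure \<Rightarrow> ('a \<Rightarrow> complex) ring" where
  "ess_bounded_ring M =
    \<lparr>carrier = {f \<in> borel_measurable M. \<exists>c. AE x in M. norm (f x) \<le> c},
     mult = (\<lambda>f g x. f x * g x), one = (\<lambda>x. 1), zero = (\<lambda>x. 0), add = (\<lambda>f g x. f x + g x)\<rparr>"

definition null_functions :: "'a measure \<Rightarrow> ('a \<Rightarrow> complex) set" where
  "null_functions M = {f \<in> borel_measurable M. AE x in M. f x = 0}"

text \<open>The cosets are the classes of essentially bounded functions modulo equality almost
  everywhere.\<close>

definition L_infty :: "'a measure \<Rightarrow> ('a \<Rightarrow> complex) set ring" where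
  "L_infty M = ess_bounded_ring M Quot null_functions M"

text \<open>For a class \<open>F\<close> in \<^term>\<open>L_infty M\<close> the condition does not depend on the representative,
  so quantifying over all representatives is the same as choosing one.\<close>

definition supported_on :: "'a measure \<Rightarrow> 'a set \<Rightarrow> ('a \<Rightarrow> complex) set \<Rightarrow> bool" where
  "supported_on M \<Lambda> F \<longleftrightarrow> (\<forall>f\<in>F. AE x in M. x \<in> \<Lambda> \<longrightarrow> f x \<noteq> 0)"

lemma cring_ess_bounded_ring: "cring (ess_bounded_ring M)"
proof (rule cringI)
  show "abelian_group (ess_bounded_ring M)"
  proof (rule abelian_groupI, goal_cases)
    case (1 f g)
    then obtain c d where "AE x in M. norm (f x) \<le> c" "AE x in M. norm (g x) \<le> d"
      by (auto simp: ess_bounded_ring_def)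
    then have "AE x in M. norm (f x + g x) \<le> c + d"
      by eventually_elim (use norm_triangle_le add_mono in blast)
    with 1 show ?case by (auto simp: ess_bounded_ring_def)
  next
    case 2 show ?case by (auto simp: ess_bounded_ring_def intro!: exI[of _ 0])
  next
    case (6 f)
    then show ?case
      by (intro bexI[of _ "\<lambda>x. - f x"]) (auto simp: ess_bounded_ring_def)
  qed (auto simp: ess_bounded_ring_def algebra_simps)
  show "Group.comm_monoid (ess_bounded_ring M)"
  proof (rule comm_monoidI, goal_cases)
    case (1 f g)
    then obtain c d where "AE x in M. norm (f x) \<le> c" "AE x in M. norm (g x) \<le> d"
      by (auto simp: ess_bounded_ring_def)
    then have "AE x in M. norm (f x * g x) \<le> c * d"
    proof eventually_elim
      case (elim x)
      have "0 \<le> c" using elim(1) norm_ge_zero[of "f x"] by linarith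
      then show ?case unfolding norm_mult by (intro mult_mono elim) auto
    qed
    with 1 show ?case by (auto simp: ess_bounded_ring_def)
  next
    case 2 show ?case by (auto simp: ess_bounded_ring_def intro!: exI[of _ 1])
  qed (auto simp: ess_bounded_ring_def algebra_simps)
qed (auto simp: ess_bounded_ring_def algebra_simps)

lemma ideal_null_functions: "ideal (null_functions M) (ess_bounded_ring M)"
proof -
  interpret cring "ess_bounded_ring M" by (rule cring_ess_bounded_ring)
  have sub: "null_functions M \<subseteq> carrier (ess_bounded_ring M)"
    by (auto simp: null_functions_def ess_bounded_ring_def elim!: eventually_mono intro!: exI[of _ 0])
  show ?thesis
  proof (rule idealI)
    show "ring (ess_bounded_ring M)" by unfold_locales
    show "subgroup (null_functions M) (add_monoid (ess_bounded_ring M))"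
    proof (rule add.subgroupI[OF sub], goal_cases)
      case 1 show ?case by (auto simp: null_functions_def intro!: exI[of _ "\<lambda>x. 0"])
    next
      case (2 f)
      have m: "(\<lambda>x. - f x) \<in> carrier (ess_bounded_ring M)"
        using 2 sub by (auto simp: ess_bounded_ring_def)
      have "\<ominus>\<^bsub>ess_bounded_ring M\<^esub> f = (\<lambda>x. - f x)"
        using 2 sub m by (intro minus_equality) (auto simp: ess_bounded_ring_def)
      then show ?case using 2 by (auto simp: null_functions_def)
    next
      case (3 f g)
      then have "AE x in M. f x = 0" "AE x in M. g x = 0" by (auto simp: null_functions_def)
      then have "AE x in M. f x + g x = 0" by eventually_elim simp
      then show ?case using 3 by (auto simp: null_functions_def ess_bounded_ring_def)
    qed
  qed (auto simp: null_functions_def ess_bounded_ring_def elim!: eventually_mono)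
qed

lemma cring_L_infty: "cring (L_infty M)"
  unfolding L_infty_def
  by (rule ideal.quotient_is_cring[OF ideal_null_functions cring_ess_bounded_ring])

section \<open>Matrices over a ring and relative commutants\<close>

definition matrix_ring :: "('a, 'b) ring_scheme \<Rightarrow> nat \<Rightarrow> 'a mat ring" where
  "matrix_ring R n =
    \<lparr>carrier = {A \<in> carrier_mat n n. elements_mat A \<subseteq> carrier R},
     mult = (\<lambda>A B. mat n n (\<lambda>(i, j). \<Oplus>\<^bsub>R\<^esub>k\<in>{..<n}. A $$ (i, k) \<otimes>\<^bsub>R\<^esub> B $$ (k, j))),
     one = mat n n (\<lambda>(i, j). if i = j then \<one>\<^bsub>R\<^esub> else \<zero>\<^bsub>R\<^esub>),
     zero = mat n n (\<lambda>_. \<zero>\<^bsub>R\<^esub>),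
     add = (\<lambda>A B. mat n n (\<lambda>(i, j). A $$ (i, j) \<oplus>\<^bsub>R\<^esub> B $$ (i, j)))\<rparr>"

definition commutant :: "('a, 'b) ring_scheme \<Rightarrow> 'a \<Rightarrow> ('a, 'b) ring_scheme" where
  "commutant R a = R\<lparr>carrier := {b \<in> carrier R. a \<otimes>\<^bsub>R\<^esub> b = b \<otimes>\<^bsub>R\<^esub> a}\<rparr>"

section \<open>The group \<open>K\<^sub>0\<close>\<close>

definition idempotent_matrices :: "('a, 'b) ring_scheme \<Rightarrow> 'a mat set" where
  "idempotent_matrices R =
    (\<Union>k. {p \<in> carrier (matrix_ring R k). p \<otimes>\<^bsub>matrix_ring R k\<^esub> p = p})"

definition direct_sum_mat :: "('a, 'b) ring_scheme \<Rightarrow> 'a mat \<Rightarrow> 'a mat \<Rightarrow> 'a mat" where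
  "direct_sum_mat R p q = four_block_mat
     p (mat (dim_row p) (dim_col q) (\<lambda>_. \<zero>\<^bsub>R\<^esub>))
     (mat (dim_row q) (dim_col p) (\<lambda>_. \<zero>\<^bsub>R\<^esub>)) q"

definition similar_over :: "('a, 'b) ring_scheme \<Rightarrow> nat \<Rightarrow> 'a mat \<Rightarrow> 'a mat \<Rightarrow> bool" where
  "similar_over R k p q \<longleftrightarrow> (\<exists>s \<in> Units (matrix_ring R k).
     q = s \<otimes>\<^bsub>matrix_ring R k\<^esub> p \<otimes>\<^bsub>matrix_ring R k\<^esub> inv\<^bsub>matrix_ring R k\<^esub> s)"

text \<open>Idempotents of possibly different sizes are identified when they become similar after
  padding with zero blocks to a common size, that is, when they are similar in the union of the
  matrix algebras along the embeddings sending \<open>p\<close> to the block sum of \<open>p\<close> and \<open>0\<close>.\<close>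

definition idempotent_similarity :: "('a, 'b) ring_scheme \<Rightarrow> ('a mat \<times> 'a mat) set" where
  "idempotent_similarity R =
    {(p, q) \<in> idempotent_matrices R \<times> idempotent_matrices R.
      \<exists>k l. dim_row p + k = dim_row q + l \<and>
        similar_over R (dim_row p + k)
          (direct_sum_mat R p \<zero>\<^bsub>matrix_ring R k\<^esub>) (direct_sum_mat R q \<zero>\<^bsub>matrix_ring R l\<^esub>)}"

text \<open>The neutral element is the class of the empty matrix, which is the class of every zero
  matrix.\<close>

definition idempotent_semigroup :: "('a, 'b) ring_scheme \<Rightarrow> 'a mat set monoid" where
  "idempotent_semigroup R =
    \<lparr>carrier = idempotent_matrices R // idempotent_similarity R,
     mult = (\<lambda>X Y. \<Union>p\<in>X. \<Union>q\<in>Y. idempotent_similarity R `` {direct_sum_mat R p q}),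
     one = idempotent_similarity R `` {\<zero>\<^bsub>matrix_ring R 0\<^esub>}\<rparr>"

text \<open>The pair \<open>(a, b)\<close> represents the formal difference of \<open>a\<close> and \<open>b\<close>.\<close>

definition grothendieck_rel :: "('a, 'b) monoid_scheme \<Rightarrow> (('a \<times> 'a) \<times> ('a \<times> 'a)) set" where
  "grothendieck_rel G =
    {((a, b), (c, d)). a \<in> carrier G \<and> b \<in> carrier G \<and> c \<in> carrier G \<and> d \<in> carrier G \<and>
      (\<exists>e \<in> carrier G. a \<otimes>\<^bsub>G\<^esub> d \<otimes>\<^bsub>G\<^esub> e = c \<otimes>\<^bsub>G\<^esub> b \<otimes>\<^bsub>G\<^esub> e)}"

definition grothendieck_group :: "('a, 'b) monoid_scheme \<Rightarrow> ('a \<times> 'a) set monoid" where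
  "grothendieck_group G =
    \<lparr>carrier = (carrier G \<times> carrier G) // grothendieck_rel G,
     mult = (\<lambda>X Y. \<Union>(a, b)\<in>X. \<Union>(c, d)\<in>Y.
       grothendieck_rel G `` {(a \<otimes>\<^bsub>G\<^esub> c, b \<otimes>\<^bsub>G\<^esub> d)}),
     one = grothendieck_rel G `` {(\<one>\<^bsub>G\<^esub>, \<one>\<^bsub>G\<^esub>)}\<rparr>"

definition K0 :: "('a, 'b) ring_scheme \<Rightarrow> ('a mat set \<times> 'a mat set) set monoid" where
  "K0 R = grothendieck_group (idempotent_semigroup R)"

section \<open>Bounded integer-valued Borel functions\<close>

definition bounded_borel_int_funs :: "'a::topological_space set \<Rightarrow> ('a \<Rightarrow> int) monoid" where
  "bounded_borel_int_funs \<Lambda> =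
    \<lparr>carrier = {\<phi> \<in> extensional \<Lambda>.
       \<phi> \<in> restrict_space borel \<Lambda> \<rightarrow>\<^sub>M count_space UNIV \<and> (\<exists>c. \<forall>x\<in>\<Lambda>. \<bar>\<phi> x\<bar> \<le> c)},
     mult = (\<lambda>\<phi> \<psi>. \<lambda>x\<in>\<Lambda>. \<phi> x + \<psi> x),
     one = (\<lambda>x\<in>\<Lambda>. 0)\<rparr>"

definition null_int_funs :: "'a::topological_space measure \<Rightarrow> 'a set \<Rightarrow> ('a \<Rightarrow> int) set" where
  "null_int_funs M \<Lambda> =
    {\<phi> \<in> carrier (bounded_borel_int_funs \<Lambda>). AE x in M. x \<in> \<Lambda> \<longrightarrow> \<phi> x = 0}"

definition bounded_borel_int :: "'a::topological_space measure \<Rightarrow> 'a set \<Rightarrow> ('a \<Rightarrow> int) set monoid"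
  where "bounded_borel_int M \<Lambda> = bounded_borel_int_funs \<Lambda> Mod null_int_funs M \<Lambda>"

lemma comm_group_bounded_borel_int_funs: "comm_group (bounded_borel_int_funs \<Lambda>)"
proof (rule comm_groupI, goal_cases)
  case (1 \<phi> \<psi>)
  then obtain c d where "\<forall>x\<in>\<Lambda>. \<bar>\<phi> x\<bar> \<le> c" "\<forall>x\<in>\<Lambda>. \<bar>\<psi> x\<bar> \<le> d"
    by (auto simp: bounded_borel_int_funs_def)
  then have "\<forall>x\<in>\<Lambda>. \<bar>\<phi> x + \<psi> x\<bar> \<le> c + d" by force
  moreover have "(\<lambda>x. \<phi> x + \<psi> x) \<in> restrict_space borel \<Lambda> \<rightarrow>\<^sub>M count_space UNIV"
    using 1 by (auto simp: bounded_borel_int_funs_def)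
  then have "(\<lambda>x\<in>\<Lambda>. \<phi> x + \<psi> x) \<in> restrict_space borel \<Lambda> \<rightarrow>\<^sub>M count_space UNIV"
    by (subst measurable_cong[where g = "\<lambda>x. \<phi> x + \<psi> x"]) (auto simp: space_restrict_space)
  ultimately show ?case by (auto simp: bounded_borel_int_funs_def)
next
  case 2
  have "(\<lambda>x\<in>\<Lambda>. 0::int) \<in> restrict_space borel \<Lambda> \<rightarrow>\<^sub>M count_space UNIV"
    by (subst measurable_cong[where g = "\<lambda>x. 0"]) (auto simp: space_restrict_space)
  then show ?case by (auto simp: bounded_borel_int_funs_def)
next
  case (6 \<phi>)
  have "(\<lambda>x. - \<phi> x) \<in> restrict_space borel \<Lambda> \<rightarrow>\<^sub>M count_space UNIV"
    using 6 by (auto simp: bounded_borel_int_funs_def)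
  then have "(\<lambda>x\<in>\<Lambda>. - \<phi> x) \<in> restrict_space borel \<Lambda> \<rightarrow>\<^sub>M count_space UNIV"
    by (subst measurable_cong[where g = "\<lambda>x. - \<phi> x"]) (auto simp: space_restrict_space)
  with 6 show ?case
    by (intro bexI[of _ "\<lambda>x\<in>\<Lambda>. - \<phi> x"]) (auto simp: bounded_borel_int_funs_def fun_eq_iff)
qed (auto simp: bounded_borel_int_funs_def fun_eq_iff extensional_def)

lemma subgroup_null_int_funs: "subgroup (null_int_funs M \<Lambda>) (bounded_borel_int_funs \<Lambda>)"
proof -
  interpret comm_group "bounded_borel_int_funs \<Lambda>" by (rule comm_group_bounded_borel_int_funs)
  show ?thesis
  proof (rule subgroupI, goal_cases)
    case 1 show ?case by (auto simp: null_int_funs_def)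
  next
    case 2
    have "\<one>\<^bsub>bounded_borel_int_funs \<Lambda>\<^esub> \<in> null_int_funs M \<Lambda>"
      unfolding null_int_funs_def using one_closed by (auto simp: bounded_borel_int_funs_def)
    then show ?case by blast
  next
    case (3 \<phi>)
    then have c: "\<phi> \<in> carrier (bounded_borel_int_funs \<Lambda>)" and z: "AE x in M. x \<in> \<Lambda> \<longrightarrow> \<phi> x = 0"
      by (auto simp: null_int_funs_def)
    let ?i = "inv\<^bsub>bounded_borel_int_funs \<Lambda>\<^esub> \<phi>"
    have "?i \<otimes>\<^bsub>bounded_borel_int_funs \<Lambda>\<^esub> \<phi> = \<one>\<^bsub>bounded_borel_int_funs \<Lambda>\<^esub>" using c by simp
    then have "\<forall>x\<in>\<Lambda>. ?i x + \<phi> x = 0"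
      by (auto simp: bounded_borel_int_funs_def fun_eq_iff split: if_splits)
    then have "AE x in M. x \<in> \<Lambda> \<longrightarrow> ?i x = 0" using z by (auto elim!: eventually_mono)
    then show ?case using c by (auto simp: null_int_funs_def)
  next
    case (4 \<phi> \<psi>)
    then have "AE x in M. x \<in> \<Lambda> \<longrightarrow> \<phi> x = 0" "AE x in M. x \<in> \<Lambda> \<longrightarrow> \<psi> x = 0"
      by (auto simp: null_int_funs_def)
    then have "AE x in M. x \<in> \<Lambda> \<longrightarrow> (\<phi> \<otimes>\<^bsub>bounded_borel_int_funs \<Lambda>\<^esub> \<psi>) x = 0"
      by eventually_elim (auto simp: bounded_borel_int_funs_def)
    with 4 show ?case by (auto simp: null_int_funs_def)
  qed
qed

end

(*
  Let R be L_infty and C the commutant of A. Subtracting the diagonal from A leaves a strictly upper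
  triangular matrix N whose superdiagonal consists of non-zero-divisors, so the first basis row
  vector is cyclic for N up to denominators. Hence every matrix commuting with N is, up to a
  non-zero-divisor scalar, a combination of powers of N; C is therefore commutative, and each of its
  elements is a scalar matrix plus a nilpotent one.

  R is an exchange ring: for every x there is an idempotent e, the indicator of |x| >= 1/2, such that
  x divides e and 1 - x divides 1 - e. This property lifts along nilpotents, so C is an exchange ring
  too, and its idempotents are the scalar matrices of indicator functions. Over a commutative
  exchange ring the entry in the corner of an idempotent matrix allows one to split off a rank one
  idempotent on one part of the spectrum and to delete a row on the other, so every idempotent
  matrix is equivalent to a diagonal one. The rule [e] + [g] = [e g] + [e + g - e g] sorts the
  diagonal into a chain, and in a torsion-free ring a chain of given length is determined by its sum.
  Consequently the trace is a complete invariant, and K_0(C) is the additive subgroup of C generated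
  by the idempotents, that is, the bounded integer-valued functions.
*)

theory Submission
  imports Defs "HOL-Algebra.Generated_Groups" "HOL-Algebra.Subrings" "HOL-Decision_Procs.Commutative_Ring"
begin

section \<open>Finite sums and rectangular matrices\<close>

text \<open>The superdiagonal entries vanish almost nowhere but need not be bounded away from zero.
  They may have no inverse in L_infty, so the matrix cannot in general be conjugated to a Jordan
  block, and its commutant can exceed the algebra generated by the scalars and \<open>N\<close>: for
  n = 2 the corner entry of a commuting matrix is arbitrary, whereas a polynomial in
  \<open>N\<close> only reaches multiples of the superdiagonal entry. Hence no normal form of the
  commutant is used. Properties that survive cancellation of a non-zero-divisor are proved for
  combinations of powers of \<open>N\<close> and then transferred.

  The diagonalization keeps changing the size of an idempotent, which similarity handles badly. The
  classification is therefore done with factorizations p = u v, q = v u through rectangular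
  matrices, which need no padding; similarity enters only after it.

  The trace is taken in the commutative ring C itself, so its values lie in C, not in L_infty; only
  afterwards are the idempotents of C identified with scalar matrices of indicators.\<close>

context abelian_monoid
begin

lemma finsum_lessThan_closed:
  fixes n :: nat shows
  "(\<And>i. i < n \<Longrightarrow> f i \<in> carrier G) \<Longrightarrow> finsum G f {..<n} \<in> carrier G"
  by (auto intro: finsum_closed)

lemma finsum_lessThan_cong:
  fixes n :: nat shows
  "\<lbrakk>\<And>i. i < n \<Longrightarrow> f i = g i; \<And>i. i < n \<Longrightarrow> g i \<in> carrier G\<rbrakk> \<Longrightarrow> finsum G f {..<n} = finsum G g {..<n}"
  by (rule finsum_cong') auto

lemma finsum_lessThan_Suc:
  fixes n :: nat shows
  "(\<And>i. i < Suc n \<Longrightarrow> f i \<in> carrier G) \<Longrightarrow> finsum G f {..<Suc n} = finsum G f {..<n} \<oplus> f n"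
  unfolding lessThan_Suc by (subst finsum_insert) (auto intro!: a_comm finsum_closed)

lemma finsum_lessThan_zero:
  fixes n :: nat shows
  "(\<And>i. i < n \<Longrightarrow> f i = \<zero>) \<Longrightarrow> finsum G f {..<n} = \<zero>"
  by (rule add.finprod_one_eqI) auto

lemma finsum_lessThan_add:
  fixes a b :: nat shows
  "(\<And>i. i < a + b \<Longrightarrow> f i \<in> carrier G) \<Longrightarrow>
    finsum G f {..<a + b} = finsum G f {..<a} \<oplus> finsum G (\<lambda>i. f (a + i)) {..<b}"
proof (induction b)
  case 0
  then show ?case by (simp add: finsum_lessThan_closed)
next
  case (Suc b)
  then show ?case by (simp add: finsum_lessThan_Suc finsum_lessThan_closed a_assoc)
qed

lemma finsum_lessThan_addf:
  fixes n :: nat shows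
  "\<lbrakk>\<And>i. i < n \<Longrightarrow> f i \<in> carrier G; \<And>i. i < n \<Longrightarrow> g i \<in> carrier G\<rbrakk> \<Longrightarrow>
    finsum G (\<lambda>i. f i \<oplus> g i) {..<n} = finsum G f {..<n} \<oplus> finsum G g {..<n}"
  by (rule finsum_addf) auto

lemma finsum_lessThan_swap:
  fixes n m :: nat shows
  "(\<And>i j. i < n \<Longrightarrow> j < m \<Longrightarrow> f i j \<in> carrier G) \<Longrightarrow>
    finsum G (\<lambda>i. finsum G (\<lambda>j. f i j) {..<m}) {..<n} =
    finsum G (\<lambda>j. finsum G (\<lambda>i. f i j) {..<n}) {..<m}"
proof (induction n)
  case 0
  then show ?case by (simp add: finsum_lessThan_zero)
next
  case (Suc n)
  have "finsum G (\<lambda>j. finsum G (\<lambda>i. f i j) {..<Suc n}) {..<m} =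
      finsum G (\<lambda>j. finsum G (\<lambda>i. f i j) {..<n} \<oplus> f n j) {..<m}"
    by (rule finsum_lessThan_cong) (auto simp: finsum_lessThan_Suc Suc.prems finsum_lessThan_closed)
  also have "\<dots> = finsum G (\<lambda>j. finsum G (\<lambda>i. f i j) {..<n}) {..<m} \<oplus> finsum G (\<lambda>j. f n j) {..<m}"
    by (rule finsum_lessThan_addf) (auto simp: Suc.prems finsum_lessThan_closed)
  finally show ?case
    using Suc by (simp add: finsum_lessThan_Suc finsum_lessThan_closed)
qed

lemma finsum_lessThan_single:
  fixes n :: nat
  assumes "k < n" "f k \<in> carrier G" "\<And>i. i < n \<Longrightarrow> i \<noteq> k \<Longrightarrow> f i = \<zero>"
  shows "finsum G f {..<n} = f k"
proof -
  have "finsum G f {..<n} = finsum G (\<lambda>j. if k = j then f k else \<zero>) {..<n}"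
    using assms by (intro finsum_lessThan_cong) auto
  also have "\<dots> = f k"
    using assms finsum_singleton[of k "{..<n}" "\<lambda>_. f k"] by auto
  finally show ?thesis .
qed

end

lemma (in semiring) finsum_lessThan_ldistr:
  "\<lbrakk>a \<in> carrier R; \<And>i. i < n \<Longrightarrow> f i \<in> carrier R\<rbrakk> \<Longrightarrow>
    finsum R f {..<n} \<otimes> a = finsum R (\<lambda>i. f i \<otimes> a) {..<n::nat}"
  by (rule finsum_ldistr) auto

lemma (in semiring) finsum_lessThan_rdistr:
  "\<lbrakk>a \<in> carrier R; \<And>i. i < n \<Longrightarrow> f i \<in> carrier R\<rbrakk> \<Longrightarrow>
    a \<otimes> finsum R f {..<n} = finsum R (\<lambda>i. a \<otimes> f i) {..<n::nat}"
  by (rule finsum_rdistr) auto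

definition mat_over :: "('a, 'b) ring_scheme \<Rightarrow> 'a mat \<Rightarrow> bool" where
  "mat_over R A \<longleftrightarrow> (\<forall>i<dim_row A. \<forall>j<dim_col A. A $$ (i, j) \<in> carrier R)"

text \<open>\<open>matrix_ring\<close> knows only square matrices of one size. Equivalences between
  idempotents of different sizes need rectangular factors, so this product works on all shapes and
  reads the dimensions off its arguments.\<close>

definition rmul :: "('a, 'b) ring_scheme \<Rightarrow> 'a mat \<Rightarrow> 'a mat \<Rightarrow> 'a mat" where
  "rmul R A B = mat (dim_row A) (dim_col B)
    (\<lambda>(i, j). \<Oplus>\<^bsub>R\<^esub>k\<in>{..<dim_col A}. A $$ (i, k) \<otimes>\<^bsub>R\<^esub> B $$ (k, j))"

definition radd :: "('a, 'b) ring_scheme \<Rightarrow> 'a mat \<Rightarrow> 'a mat \<Rightarrow> 'a mat" where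
  "radd R A B = mat (dim_row A) (dim_col A) (\<lambda>(i, j). A $$ (i, j) \<oplus>\<^bsub>R\<^esub> B $$ (i, j))"

definition rzero :: "('a, 'b) ring_scheme \<Rightarrow> nat \<Rightarrow> nat \<Rightarrow> 'a mat" where
  "rzero R k l = mat k l (\<lambda>_. \<zero>\<^bsub>R\<^esub>)"

definition rdiag :: "('a, 'b) ring_scheme \<Rightarrow> nat \<Rightarrow> 'a \<Rightarrow> 'a mat" where
  "rdiag R k c = mat k k (\<lambda>(i, j). if i = j then c else \<zero>\<^bsub>R\<^esub>)"

lemma dim_rmul [simp]: "dim_row (rmul R A B) = dim_row A" "dim_col (rmul R A B) = dim_col B"
  by (auto simp: rmul_def)

lemma dim_radd [simp]: "dim_row (radd R A B) = dim_row A" "dim_col (radd R A B) = dim_col A"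
  by (auto simp: radd_def)

lemma dim_rzero [simp]: "dim_row (rzero R k l) = k" "dim_col (rzero R k l) = l"
  by (auto simp: rzero_def)

lemma dim_rdiag [simp]: "dim_row (rdiag R k c) = k" "dim_col (rdiag R k c) = k"
  by (auto simp: rdiag_def)

lemma rmul_index:
  "i < dim_row A \<Longrightarrow> j < dim_col B \<Longrightarrow>
    rmul R A B $$ (i, j) = (\<Oplus>\<^bsub>R\<^esub>k\<in>{..<dim_col A}. A $$ (i, k) \<otimes>\<^bsub>R\<^esub> B $$ (k, j))"
  by (simp add: rmul_def)

lemma radd_index [simp]:
  "i < dim_row A \<Longrightarrow> j < dim_col A \<Longrightarrow> radd R A B $$ (i, j) = A $$ (i, j) \<oplus>\<^bsub>R\<^esub> B $$ (i, j)"
  by (simp add: radd_def)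

lemma rzero_index [simp]: "i < k \<Longrightarrow> j < l \<Longrightarrow> rzero R k l $$ (i, j) = \<zero>\<^bsub>R\<^esub>"
  by (simp add: rzero_def)

lemma rdiag_index [simp]: "i < k \<Longrightarrow> j < k \<Longrightarrow> rdiag R k c $$ (i, j) = (if i = j then c else \<zero>\<^bsub>R\<^esub>)"
  by (simp add: rdiag_def)

lemma mat_overD: "mat_over R A \<Longrightarrow> i < dim_row A \<Longrightarrow> j < dim_col A \<Longrightarrow> A $$ (i, j) \<in> carrier R"
  by (simp add: mat_over_def)

lemma mat_over_iff_elements: "mat_over R A \<longleftrightarrow> elements_mat A \<subseteq> carrier R"
  by (force simp: mat_over_def elements_mat_def)

lemma mat_over_four_block:
  assumes "mat_over R A" "mat_over R B" "mat_over R C" "mat_over R D"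
    and "dim_row B = dim_row A" "dim_col C = dim_col A"
    and "dim_row C = dim_row D" "dim_col B = dim_col D"
  shows "mat_over R (four_block_mat A B C D)"
  using assms by (auto simp: mat_over_def)

context ring
begin

lemma mat_over_rzero [simp]: "mat_over R (rzero R k l)"
  by (simp add: mat_over_def)

lemma mat_over_rdiag [simp]: "c \<in> carrier R \<Longrightarrow> mat_over R (rdiag R k c)"
  by (simp add: mat_over_def)

lemma mat_over_rmul [simp]:
  "\<lbrakk>mat_over R A; mat_over R B; dim_col A = dim_row B\<rbrakk> \<Longrightarrow> mat_over R (rmul R A B)"
  unfolding mat_over_def by (auto simp: rmul_index intro!: finsum_lessThan_closed)

lemma mat_over_radd [simp]:
  "\<lbrakk>mat_over R A; mat_over R B; dim_row A = dim_row B; dim_col A = dim_col B\<rbrakk> \<Longrightarrow> mat_over R (radd R A B)"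
  unfolding mat_over_def by auto

lemma rmul_assoc:
  assumes "mat_over R A" "mat_over R B" "mat_over R C"
    and d: "dim_col A = dim_row B" "dim_col B = dim_row C"
  shows "rmul R (rmul R A B) C = rmul R A (rmul R B C)"
proof (rule eq_matI)
  fix i j assume "i < dim_row (rmul R A (rmul R B C))" "j < dim_col (rmul R A (rmul R B C))"
  then have i: "i < dim_row A" and j: "j < dim_col C" by auto
  note [simp] = assms(1-3)[THEN mat_overD] finsum_lessThan_closed
  let ?f = "\<lambda>k l. A $$ (i, l) \<otimes> B $$ (l, k) \<otimes> C $$ (k, j)"
  have "rmul R (rmul R A B) C $$ (i, j) = (\<Oplus>k\<in>{..<dim_col B}. (\<Oplus>l\<in>{..<dim_col A}. A $$ (i, l) \<otimes> B $$ (l, k)) \<otimes> C $$ (k, j))"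
    using i j d by (subst rmul_index) (auto simp: rmul_index intro!: finsum_lessThan_cong)
  also have "\<dots> = (\<Oplus>k\<in>{..<dim_col B}. (\<Oplus>l\<in>{..<dim_col A}. ?f k l))"
    using i j d by (intro finsum_lessThan_cong finsum_lessThan_ldistr) auto
  also have "\<dots> = (\<Oplus>l\<in>{..<dim_col A}. (\<Oplus>k\<in>{..<dim_col B}. ?f k l))"
    using i j d by (intro finsum_lessThan_swap) auto
  also have "\<dots> = (\<Oplus>l\<in>{..<dim_col A}. (\<Oplus>k\<in>{..<dim_col B}. A $$ (i, l) \<otimes> (B $$ (l, k) \<otimes> C $$ (k, j))))"
    using i j d by (intro finsum_lessThan_cong) (auto simp: m_assoc)
  also have "\<dots> = (\<Oplus>l\<in>{..<dim_col A}. A $$ (i, l) \<otimes> (\<Oplus>k\<in>{..<dim_col B}. B $$ (l, k) \<otimes> C $$ (k, j)))"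
    using i j d by (intro finsum_lessThan_cong finsum_lessThan_rdistr[symmetric]) auto
  also have "\<dots> = rmul R A (rmul R B C) $$ (i, j)"
    using i j d by (subst rmul_index) (auto simp: rmul_index intro!: finsum_lessThan_cong)
  finally show "rmul R (rmul R A B) C $$ (i, j) = rmul R A (rmul R B C) $$ (i, j)" .
qed auto

lemma rmul_rdiag_left:
  assumes "mat_over R A" "c \<in> carrier R" "dim_row A = k"
  shows "rmul R (rdiag R k c) A = mat (dim_row A) (dim_col A) (\<lambda>(i, j). c \<otimes> A $$ (i, j))"
proof (rule eq_matI)
  fix i j
  assume "i < dim_row (mat (dim_row A) (dim_col A) (\<lambda>(i, j). c \<otimes> A $$ (i, j)))"
    "j < dim_col (mat (dim_row A) (dim_col A) (\<lambda>(i, j). c \<otimes> A $$ (i, j)))"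
  then have ij: "i < dim_row A" "j < dim_col A" by auto
  have "(\<Oplus>t\<in>{..<dim_row A}. rdiag R k c $$ (i, t) \<otimes> A $$ (t, j)) = rdiag R k c $$ (i, i) \<otimes> A $$ (i, j)"
    using ij assms by (intro finsum_lessThan_single) (auto simp: mat_overD)
  then show "rmul R (rdiag R k c) A $$ (i, j) = mat (dim_row A) (dim_col A) (\<lambda>(i, j). c \<otimes> A $$ (i, j)) $$ (i, j)"
    using ij assms by (simp add: rmul_index)
qed (use assms in auto)

lemma rmul_rdiag_right:
  assumes "mat_over R A" "c \<in> carrier R" "dim_col A = k"
  shows "rmul R A (rdiag R k c) = mat (dim_row A) (dim_col A) (\<lambda>(i, j). A $$ (i, j) \<otimes> c)"
proof (rule eq_matI)
  fix i j
  assume "i < dim_row (mat (dim_row A) (dim_col A) (\<lambda>(i, j). A $$ (i, j) \<otimes> c))"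
    "j < dim_col (mat (dim_row A) (dim_col A) (\<lambda>(i, j). A $$ (i, j) \<otimes> c))"
  then have ij: "i < dim_row A" "j < dim_col A" by auto
  have "(\<Oplus>t\<in>{..<dim_col A}. A $$ (i, t) \<otimes> rdiag R k c $$ (t, j)) = A $$ (i, j) \<otimes> rdiag R k c $$ (j, j)"
    using ij assms by (intro finsum_lessThan_single) (auto simp: mat_overD)
  then show "rmul R A (rdiag R k c) $$ (i, j) = mat (dim_row A) (dim_col A) (\<lambda>(i, j). A $$ (i, j) \<otimes> c) $$ (i, j)"
    using ij assms by (simp add: rmul_index)
qed (use assms in auto)

lemma rmul_rdiag_one [simp]:
  "mat_over R A \<Longrightarrow> dim_row A = k \<Longrightarrow> rmul R (rdiag R k \<one>) A = A"
  "mat_over R A \<Longrightarrow> dim_col A = k \<Longrightarrow> rmul R A (rdiag R k \<one>) = A"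
  by (auto simp: rmul_rdiag_left rmul_rdiag_right mat_overD intro!: eq_matI)

lemma rmul_rzero [simp]:
  "mat_over R A \<Longrightarrow> dim_row A = l \<Longrightarrow> rmul R (rzero R k l) A = rzero R k (dim_col A)"
  "mat_over R A \<Longrightarrow> dim_col A = k \<Longrightarrow> rmul R A (rzero R k l) = rzero R (dim_row A) l"
  by (auto simp: rmul_index mat_overD intro!: eq_matI finsum_lessThan_zero)

lemma radd_rzero [simp]:
  "mat_over R A \<Longrightarrow> dim_row A = k \<Longrightarrow> dim_col A = l \<Longrightarrow> radd R (rzero R k l) A = A"
  "mat_over R A \<Longrightarrow> dim_row A = k \<Longrightarrow> dim_col A = l \<Longrightarrow> radd R A (rzero R k l) = A"
  by (auto simp: mat_overD intro!: eq_matI)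

lemma rmul_radd:
  "\<lbrakk>mat_over R A; mat_over R B; mat_over R C; dim_col A = dim_row B; dim_row B = dim_row C; dim_col B = dim_col C\<rbrakk> \<Longrightarrow>
    rmul R A (radd R B C) = radd R (rmul R A B) (rmul R A C)"
  apply (rule eq_matI)
    apply (simp_all add: rmul_index del: add.finprod_multf)
  apply (rule trans[OF finsum_lessThan_cong finsum_lessThan_addf])
     apply (auto simp: mat_overD r_distr)
  done

lemma radd_rmul:
  "\<lbrakk>mat_over R A; mat_over R B; mat_over R C; dim_col A = dim_row C; dim_row B = dim_row A; dim_col B = dim_col A\<rbrakk> \<Longrightarrow>
    rmul R (radd R A B) C = radd R (rmul R A C) (rmul R B C)"
  apply (rule eq_matI)
    apply (simp_all add: rmul_index del: add.finprod_multf)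
  apply (rule trans[OF finsum_lessThan_cong finsum_lessThan_addf])
     apply (auto simp: mat_overD l_distr)
  done

text \<open>The inner sum is cut at \<open>m1\<close>. Blocks may have no rows or no columns, so
  block rows and block columns are covered as well.\<close>

lemma rmul_four_block:
  assumes over: "mat_over R A1" "mat_over R B1" "mat_over R C1" "mat_over R D1"
      "mat_over R A2" "mat_over R B2" "mat_over R C2" "mat_over R D2"
    and d: "A1 \<in> carrier_mat r1 m1" "B1 \<in> carrier_mat r1 m2" "C1 \<in> carrier_mat r2 m1" "D1 \<in> carrier_mat r2 m2"
      "A2 \<in> carrier_mat m1 c1" "B2 \<in> carrier_mat m1 c2" "C2 \<in> carrier_mat m2 c1" "D2 \<in> carrier_mat m2 c2"
  shows "rmul R (four_block_mat A1 B1 C1 D1) (four_block_mat A2 B2 C2 D2) =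
    four_block_mat (radd R (rmul R A1 A2) (rmul R B1 C2)) (radd R (rmul R A1 B2) (rmul R B1 D2))
      (radd R (rmul R C1 A2) (rmul R D1 C2)) (radd R (rmul R C1 B2) (rmul R D1 D2))"
    (is "rmul R ?X ?Y = ?Z")
proof (rule eq_matI)
  fix i j assume "i < dim_row ?Z" "j < dim_col ?Z"
  then have i: "i < r1 + r2" and j: "j < c1 + c2" using d by auto
  have X: "mat_over R ?X" "?X \<in> carrier_mat (r1 + r2) (m1 + m2)"
    and Y: "mat_over R ?Y" "?Y \<in> carrier_mat (m1 + m2) (c1 + c2)"
    using over d by (auto intro!: mat_over_four_block)
  have "rmul R ?X ?Y $$ (i, j) = (\<Oplus>t\<in>{..<m1 + m2}. ?X $$ (i, t) \<otimes> ?Y $$ (t, j))"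
    using i j carrier_matD[OF X(2)] carrier_matD[OF Y(2)] by (simp only: rmul_index)
  also have "\<dots> = (\<Oplus>t\<in>{..<m1}. ?X $$ (i, t) \<otimes> ?Y $$ (t, j)) \<oplus> (\<Oplus>t\<in>{..<m2}. ?X $$ (i, m1 + t) \<otimes> ?Y $$ (m1 + t, j))"
    using i j X(1) Y(1) carrier_matD[OF X(2)] carrier_matD[OF Y(2)]
    by (intro finsum_lessThan_add m_closed mat_overD) simp_all
  also have "\<dots> = ?Z $$ (i, j)"
    using i j over carrier_matD[OF d(1)] carrier_matD[OF d(2)] carrier_matD[OF d(3)] carrier_matD[OF d(4)]
      carrier_matD[OF d(5)] carrier_matD[OF d(6)] carrier_matD[OF d(7)] carrier_matD[OF d(8)]
    by (auto simp: rmul_index mat_overD intro!: arg_cong2[where f = "(\<oplus>)"] finsum_lessThan_cong)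
  finally show "rmul R ?X ?Y $$ (i, j) = ?Z $$ (i, j)" .
qed (use d in auto)

section \<open>Square matrices as a ring\<close>

lemma mem_carrier_matrix_ring:
  "A \<in> carrier (matrix_ring R n) \<longleftrightarrow> mat_over R A \<and> dim_row A = n \<and> dim_col A = n"
  by (auto simp: matrix_ring_def mat_over_iff_elements)

lemma matrix_ring_mult:
  "A \<in> carrier (matrix_ring R n) \<Longrightarrow> B \<in> carrier (matrix_ring R n) \<Longrightarrow> A \<otimes>\<^bsub>matrix_ring R n\<^esub> B = rmul R A B"
  by (auto simp: matrix_ring_def rmul_def)

lemma matrix_ring_add:
  "A \<in> carrier (matrix_ring R n) \<Longrightarrow> A \<oplus>\<^bsub>matrix_ring R n\<^esub> B = radd R A B"
  by (auto simp: matrix_ring_def radd_def)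

lemma matrix_ring_one: "\<one>\<^bsub>matrix_ring R n\<^esub> = rdiag R n \<one>"
  by (auto simp: matrix_ring_def rdiag_def)

lemma matrix_ring_zero: "\<zero>\<^bsub>matrix_ring R n\<^esub> = rzero R n n"
  by (auto simp: matrix_ring_def rzero_def)

lemma ring_matrix_ring: "ring (matrix_ring R n)"
proof (rule ringI)
  show "abelian_group (matrix_ring R n)"
  proof (rule abelian_groupI, goal_cases)
    case (6 A)
    have "mat n n (\<lambda>ij. \<ominus> (A $$ ij)) \<in> carrier (matrix_ring R n)"
      using 6 by (auto simp: mem_carrier_matrix_ring mat_over_def)
    then show ?case
      using 6 by (intro bexI[of _ "mat n n (\<lambda>ij. \<ominus> (A $$ ij))"])
        (auto simp: mem_carrier_matrix_ring matrix_ring_add matrix_ring_zero l_neg mat_overD intro!: eq_matI)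
  qed (auto simp: mem_carrier_matrix_ring matrix_ring_add matrix_ring_zero a_ac mat_overD intro!: eq_matI)
  have *: "rmul R A B \<in> carrier (matrix_ring R n)" if "A \<in> carrier (matrix_ring R n)" "B \<in> carrier (matrix_ring R n)" for A B
    using that by (auto simp: mem_carrier_matrix_ring)
  show "monoid (matrix_ring R n)"
    by (rule monoidI) (use * in \<open>auto simp: matrix_ring_mult matrix_ring_one mem_carrier_matrix_ring rmul_assoc\<close>)
  have **: "radd R A B \<in> carrier (matrix_ring R n)" if "A \<in> carrier (matrix_ring R n)" "B \<in> carrier (matrix_ring R n)" for A B
    using that by (auto simp: mem_carrier_matrix_ring)
  show "(x \<oplus>\<^bsub>matrix_ring R n\<^esub> y) \<otimes>\<^bsub>matrix_ring R n\<^esub> z = x \<otimes>\<^bsub>matrix_ring R n\<^esub> z \<oplus>\<^bsub>matrix_ring R n\<^esub> y \<otimes>\<^bsub>matrix_ring R n\<^esub> z"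
    if "x \<in> carrier (matrix_ring R n)" "y \<in> carrier (matrix_ring R n)" "z \<in> carrier (matrix_ring R n)" for x y z
    using that * **
    by (simp add: matrix_ring_add matrix_ring_mult) (simp add: mem_carrier_matrix_ring radd_rmul)
  show "z \<otimes>\<^bsub>matrix_ring R n\<^esub> (x \<oplus>\<^bsub>matrix_ring R n\<^esub> y) = z \<otimes>\<^bsub>matrix_ring R n\<^esub> x \<oplus>\<^bsub>matrix_ring R n\<^esub> z \<otimes>\<^bsub>matrix_ring R n\<^esub> y"
    if "x \<in> carrier (matrix_ring R n)" "y \<in> carrier (matrix_ring R n)" "z \<in> carrier (matrix_ring R n)" for x y z
    using that * **
    by (simp add: matrix_ring_add matrix_ring_mult) (simp add: mem_carrier_matrix_ring rmul_radd)
qed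

end

section \<open>Equivalence of idempotent matrices\<close>

text \<open>Murray--von Neumann equivalence; the factors may be rectangular.\<close>

definition mvn :: "('a, 'b) ring_scheme \<Rightarrow> 'a mat \<Rightarrow> 'a mat \<Rightarrow> bool" where
  "mvn R p q \<longleftrightarrow> (\<exists>u v. mat_over R u \<and> mat_over R v \<and> dim_col u = dim_row v \<and> dim_row u = dim_col v \<and>
    p = rmul R u v \<and> q = rmul R v u)"

definition rdiag_list :: "('a, 'b) ring_scheme \<Rightarrow> 'a list \<Rightarrow> 'a mat" where
  "rdiag_list R es = mat (length es) (length es) (\<lambda>(i, j). if i = j then es ! i else \<zero>\<^bsub>R\<^esub>)"

definition idempotents :: "('a, 'b) ring_scheme \<Rightarrow> 'a set" where
  "idempotents R = {e \<in> carrier R. e \<otimes>\<^bsub>R\<^esub> e = e}"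

text \<open>The exchange property in the form of Goodearl and Nicholson. It stands in for a cut of
  the spectrum into a part where \<open>a\<close> is invertible and a part where
  \<open>1 - a\<close> is.\<close>

definition exchange_ring :: "('a, 'b) ring_scheme \<Rightarrow> bool" where
  "exchange_ring R \<longleftrightarrow> (\<forall>a\<in>carrier R. \<exists>e\<in>idempotents R. \<exists>b\<in>carrier R. \<exists>c\<in>carrier R.
    a \<otimes>\<^bsub>R\<^esub> b = e \<and> (\<one>\<^bsub>R\<^esub> \<ominus>\<^bsub>R\<^esub> a) \<otimes>\<^bsub>R\<^esub> c = \<one>\<^bsub>R\<^esub> \<ominus>\<^bsub>R\<^esub> e)"

lemma mvnI:
  "\<lbrakk>p = rmul R u v; q = rmul R v u; mat_over R u; mat_over R v; dim_col u = dim_row v; dim_row u = dim_col v\<rbrakk> \<Longrightarrow> mvn R p q"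
  unfolding mvn_def by blast

lemma dim_rdiag_list [simp]:
  "dim_row (rdiag_list R es) = length es" "dim_col (rdiag_list R es) = length es"
  by (auto simp: rdiag_list_def)

lemma rdiag_list_index [simp]:
  "i < length es \<Longrightarrow> j < length es \<Longrightarrow> rdiag_list R es $$ (i, j) = (if i = j then es ! i else \<zero>\<^bsub>R\<^esub>)"
  by (simp add: rdiag_list_def)

lemma dim_direct_sum_mat [simp]:
  "dim_row (direct_sum_mat R p q) = dim_row p + dim_row q"
  "dim_col (direct_sum_mat R p q) = dim_col p + dim_col q"
  by (auto simp: direct_sum_mat_def)

lemma direct_sum_mat_four_block:
  "direct_sum_mat R p q = four_block_mat p (rzero R (dim_row p) (dim_col q)) (rzero R (dim_row q) (dim_col p)) q"
  by (simp add: direct_sum_mat_def rzero_def)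

lemma (in abelian_monoid) finsum_lessThan_1 [simp]:
  "f 0 \<in> carrier G \<Longrightarrow> finsum G f {..<Suc 0} = f 0"
  by (rule finsum_lessThan_single) auto

context ring
begin

lemma mem_idempotent_matrices:
  "p \<in> idempotent_matrices R \<longleftrightarrow> mat_over R p \<and> dim_col p = dim_row p \<and> rmul R p p = p"
  by (auto simp: idempotent_matrices_def mem_carrier_matrix_ring matrix_ring_mult)

lemma mvn_refl: "p \<in> idempotent_matrices R \<Longrightarrow> mvn R p p"
  by (rule mvnI[of _ _ p p]) (auto simp: mem_idempotent_matrices)

lemma mvn_sym: "mvn R p q \<Longrightarrow> mvn R q p"
  unfolding mvn_def by metis

text \<open>Idempotency makes room for the exchange: in \<open>p = p p = u (v u) v\<close> the
  middle product can be rewritten as \<open>s t\<close>, which leaves the factors \<open>u s\<close>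
  and \<open>t v\<close>. The same is done with \<open>r\<close>.\<close>

lemma mvn_trans:
  assumes idem: "p \<in> idempotent_matrices R" "r \<in> idempotent_matrices R" and "mvn R p q" "mvn R q r"
  shows "mvn R p r"
proof -
  obtain u v where uv: "mat_over R u" "mat_over R v" "dim_col u = dim_row v" "dim_row u = dim_col v"
    and p: "p = rmul R u v" and q: "q = rmul R v u"
    using \<open>mvn R p q\<close> unfolding mvn_def by blast
  obtain s t where st: "mat_over R s" "mat_over R t" "dim_col s = dim_row t" "dim_row s = dim_col t"
    and q': "q = rmul R s t" and r: "r = rmul R t s"
    using \<open>mvn R q r\<close> unfolding mvn_def by blast
  have d: "dim_row v = dim_row s"
    using arg_cong[where f = dim_row, OF q] arg_cong[where f = dim_row, OF q'] by simp
  have "p = rmul R p p" using idem(1) by (simp add: mem_idempotent_matrices)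
  also have "\<dots> = rmul R u (rmul R q v)" using uv by (simp add: p q rmul_assoc)
  also have "\<dots> = rmul R (rmul R u s) (rmul R t v)" using uv st d by (simp add: q' rmul_assoc)
  finally have 1: "p = rmul R (rmul R u s) (rmul R t v)" .
  have "r = rmul R r r" using idem(2) by (simp add: mem_idempotent_matrices)
  also have "\<dots> = rmul R t (rmul R q s)" using st by (simp add: r q' rmul_assoc)
  also have "\<dots> = rmul R (rmul R t v) (rmul R u s)" using uv st d by (simp add: q rmul_assoc)
  finally have 2: "r = rmul R (rmul R t v) (rmul R u s)" .
  show ?thesis by (rule mvnI[OF 1 2]) (use uv st d in auto)
qed

text \<open>This is how sizes drop: a factorization through fewer dimensions gives an equivalent
  idempotent of that size. The product \<open>v u\<close> itself may fail to be idempotent when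
  \<open>u\<close> and \<open>v\<close> have foreign parts; \<open>v p u\<close> removes
  them.\<close>

lemma mvn_factor:
  assumes idem: "p \<in> idempotent_matrices R" and p: "p = rmul R u v"
    and uv: "mat_over R u" "mat_over R v" "dim_col u = dim_row v"
  obtains q where "q \<in> idempotent_matrices R" "dim_row q = dim_row v" "mvn R p q"
proof
  have d: "dim_row u = dim_row p" "dim_col v = dim_row p" and op: "mat_over R p" and dp: "dim_col p = dim_row p"
    using idem arg_cong[where f = dim_row, OF p] arg_cong[where f = dim_col, OF p]
    by (auto simp: mem_idempotent_matrices)
  have pp: "rmul R p (rmul R p x) = rmul R p x" if "mat_over R x" "dim_row x = dim_row p" for x
    using that op idem dp by (simp add: mem_idempotent_matrices flip: rmul_assoc)
  have uvx: "rmul R u (rmul R v x) = rmul R p x" if "mat_over R x" "dim_row x = dim_row p" for x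
    using that d uv by (simp add: p[symmetric] flip: rmul_assoc)
  let ?q = "rmul R v (rmul R p u)"
  note s = op d dp uv
  show "?q \<in> idempotent_matrices R"
    using s by (simp add: mem_idempotent_matrices rmul_assoc uvx pp)
  show "dim_row ?q = dim_row v" by simp
  show "mvn R p ?q"
  proof (rule mvnI[of _ _ "rmul R p u" "rmul R v p"])
    show "p = rmul R (rmul R p u) (rmul R v p)"
      using s idem by (simp add: rmul_assoc uvx pp mem_idempotent_matrices)
    show "?q = rmul R (rmul R v p) (rmul R p u)"
      using s by (simp add: rmul_assoc pp)
  qed (use s in auto)
qed

section \<open>Block sums and splittings of idempotents\<close>

lemma mat_over_direct_sum [simp]:
  "mat_over R p \<Longrightarrow> mat_over R q \<Longrightarrow> mat_over R (direct_sum_mat R p q)"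
  unfolding direct_sum_mat_four_block by (rule mat_over_four_block) auto

lemma direct_sum_rmul:
  assumes "mat_over R A" "mat_over R B" "mat_over R C" "mat_over R D" "dim_col A = dim_row C" "dim_col B = dim_row D"
  shows "rmul R (direct_sum_mat R A B) (direct_sum_mat R C D) = direct_sum_mat R (rmul R A C) (rmul R B D)"
  unfolding direct_sum_mat_four_block using assms
  by (subst rmul_four_block[where ?r1.0 = "dim_row A" and ?r2.0 = "dim_row B" and ?m1.0 = "dim_row C"
      and ?m2.0 = "dim_row D" and ?c1.0 = "dim_col C" and ?c2.0 = "dim_col D"]) (auto intro!: carrier_matI)

lemma direct_sum_idempotent:
  "p \<in> idempotent_matrices R \<Longrightarrow> q \<in> idempotent_matrices R \<Longrightarrow> direct_sum_mat R p q \<in> idempotent_matrices R"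
  by (simp add: mem_idempotent_matrices direct_sum_rmul)

lemma mvn_direct_sum:
  assumes "mvn R p p'" "mvn R q q'"
  shows "mvn R (direct_sum_mat R p q) (direct_sum_mat R p' q')"
proof -
  obtain u v where uv: "mat_over R u" "mat_over R v" "dim_col u = dim_row v" "dim_row u = dim_col v"
    "p = rmul R u v" "p' = rmul R v u"
    using assms(1) unfolding mvn_def by blast
  obtain s t where st: "mat_over R s" "mat_over R t" "dim_col s = dim_row t" "dim_row s = dim_col t"
    "q = rmul R s t" "q' = rmul R t s"
    using assms(2) unfolding mvn_def by blast
  show ?thesis
    using uv st
    by (intro mvnI[of _ _ "direct_sum_mat R u s" "direct_sum_mat R v t"]) (auto simp: direct_sum_rmul)
qed

text \<open>The block row with entries \<open>p\<close>, \<open>q\<close> times the block column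
  with the same entries is \<open>p + q\<close>; in the other order the cross products vanish and
  the block sum remains. Both factors are written as four blocks, two of them empty, to make
  \<open>rmul_four_block\<close> applicable.\<close>

lemma mvn_orthogonal:
  assumes p: "p \<in> idempotent_matrices R" "dim_row p = n" and q: "q \<in> idempotent_matrices R" "dim_row q = n"
    and pq: "rmul R p q = rzero R n n" "rmul R q p = rzero R n n"
  shows "mvn R (radd R p q) (direct_sum_mat R p q)"
proof (rule mvnI)
  let ?u = "four_block_mat p q (rzero R 0 n) (rzero R 0 n)"
  let ?v = "four_block_mat p (rzero R n 0) q (rzero R n 0)"
  note s = p q pq
  have "rmul R ?u ?v = four_block_mat (radd R p q) (rzero R n 0) (rzero R 0 n) (rzero R 0 0)"
    using s
    by (subst rmul_four_block[where ?r1.0 = n and ?r2.0 = 0 and ?m1.0 = n and ?m2.0 = n and ?c1.0 = n and ?c2.0 = 0])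
      (auto simp: mem_idempotent_matrices intro!: carrier_matI)
  also have "\<dots> = radd R p q" using s by (auto simp: mem_idempotent_matrices intro!: eq_matI)
  finally show "radd R p q = rmul R ?u ?v" by simp
  show "direct_sum_mat R p q = rmul R ?v ?u"
    unfolding direct_sum_mat_four_block
    using s
    by (subst rmul_four_block[where ?r1.0 = n and ?r2.0 = n and ?m1.0 = n and ?m2.0 = 0 and ?c1.0 = n and ?c2.0 = n])
      (auto simp: mem_idempotent_matrices intro!: carrier_matI)
  show "mat_over R ?u" "mat_over R ?v"
    using s by (auto simp: mem_idempotent_matrices intro!: mat_over_four_block)
qed (use p q in \<open>auto simp: mem_idempotent_matrices\<close>)

lemma radd_left_cancel:
  assumes "radd R A B = radd R A C" "mat_over R A" "mat_over R B" "mat_over R C"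
    "dim_row B = dim_row A" "dim_col B = dim_col A" "dim_row C = dim_row A" "dim_col C = dim_col A"
  shows "B = C"
proof (rule eq_matI)
  fix i j assume ij: "i < dim_row C" "j < dim_col C"
  have "radd R A B $$ (i, j) = radd R A C $$ (i, j)" using assms(1) by simp
  then show "B $$ (i, j) = C $$ (i, j)" using ij assms(2-) by (simp add: mat_overD)
qed (use assms in auto)

lemma radd_comm:
  "\<lbrakk>mat_over R A; mat_over R B; dim_row A = dim_row B; dim_col A = dim_col B\<rbrakk> \<Longrightarrow> radd R A B = radd R B A"
  by (auto simp: mat_overD a_comm intro!: eq_matI)

lemma idempotent_complement:
  assumes p: "p \<in> idempotent_matrices R" "dim_row p = n" and f: "f \<in> idempotent_matrices R" "dim_row f = n"
    and pf: "rmul R p f = f" "rmul R f p = f"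
  defines "q \<equiv> mat n n (\<lambda>ij. p $$ ij \<ominus> f $$ ij)"
  shows "q \<in> idempotent_matrices R" "radd R f q = p" "rmul R f q = rzero R n n" "rmul R q f = rzero R n n"
proof -
  note s = p f pf
  have oq: "mat_over R q" "dim_row q = n" "dim_col q = n"
    using s by (auto simp: q_def mem_idempotent_matrices mat_over_def)
  have of': "mat_over R f" "dim_col f = n" "rmul R f f = f" and op: "mat_over R p" "dim_col p = n" "rmul R p p = p"
    using s by (auto simp: mem_idempotent_matrices)
  have "x \<oplus> (y \<ominus> x) = y" if "x \<in> carrier R" "y \<in> carrier R" for x y
    using that by (simp add: minus_eq a_comm[of y] r_neg2)
  then show fq: "radd R f q = p"
    using s of' op by (auto simp: q_def mat_overD intro!: eq_matI)
  have "radd R f (rmul R f q) = rmul R f p"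
    using oq of' op s by (simp add: rmul_radd flip: fq)
  also have "\<dots> = radd R f (rzero R n n)" using s of' by simp
  finally show 1: "rmul R f q = rzero R n n"
    by (rule radd_left_cancel) (use oq of' s in auto)
  have "radd R f (rmul R q f) = rmul R p f"
    using oq of' op s by (simp add: radd_rmul flip: fq)
  also have "\<dots> = radd R f (rzero R n n)" using s of' by simp
  finally show 2: "rmul R q f = rzero R n n"
    by (rule radd_left_cancel) (use oq of' s in auto)
  have "radd R f (rmul R q q) = rmul R (radd R f q) (radd R f q)"
    using oq of' s 1 2 by (simp add: radd_rmul rmul_radd)
  also have "\<dots> = radd R f q" using fq op by simp
  finally have "rmul R q q = q"
    by (rule radd_left_cancel) (use oq of' s in auto)
  then show "q \<in> idempotent_matrices R" using oq by (simp add: mem_idempotent_matrices)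
qed

lemma mvn_split:
  assumes "p \<in> idempotent_matrices R" "dim_row p = n" "f \<in> idempotent_matrices R" "dim_row f = n"
    and "rmul R p f = f" "rmul R f p = f"
  shows "mvn R p (direct_sum_mat R f (mat n n (\<lambda>ij. p $$ ij \<ominus> f $$ ij)))"
  using mvn_orthogonal[OF assms(3,4) idempotent_complement(1)[OF assms] _ idempotent_complement(3,4)[OF assms]]
  by (simp add: idempotent_complement(2)[OF assms])

text \<open>If the first row depends on the others, then \<open>q\<close> factors through its lower
  \<open>k\<close> rows: the left factor is the identity with the coefficients \<open>L\<close> as
  an extra row on top. \<open>mvn_factor\<close> does the rest.\<close>

lemma mvn_reduce:
  assumes q: "q \<in> idempotent_matrices R" "dim_row q = Suc k" and L: "\<And>t. t < k \<Longrightarrow> L t \<in> carrier R"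
    and row: "\<And>j. j < Suc k \<Longrightarrow> q $$ (0, j) = (\<Oplus>t\<in>{..<k}. L t \<otimes> q $$ (Suc t, j))"
  obtains q' where "q' \<in> idempotent_matrices R" "dim_row q' = k" "mvn R q q'"
proof -
  let ?u = "mat (Suc k) k (\<lambda>(i, t). if i = 0 then L t else if i = Suc t then \<one> else \<zero>)"
  let ?v = "mat k (Suc k) (\<lambda>(t, j). q $$ (Suc t, j))"
  have oq: "mat_over R q" "dim_col q = Suc k" using q by (auto simp: mem_idempotent_matrices)
  have "q = rmul R ?u ?v"
  proof (rule eq_matI)
    fix i j assume "i < dim_row (rmul R ?u ?v)" "j < dim_col (rmul R ?u ?v)"
    then have ij: "i < Suc k" "j < Suc k" by auto
    have "rmul R ?u ?v $$ (i, j) = (\<Oplus>t\<in>{..<k}. (if i = 0 then L t else if i = Suc t then \<one> else \<zero>) \<otimes> q $$ (Suc t, j))"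
      using ij oq q L by (subst rmul_index) (auto simp: mat_overD intro!: finsum_lessThan_cong)
    also have "\<dots> = q $$ (i, j)"
    proof (cases i)
      case 0
      then show ?thesis using row ij by simp
    next
      case (Suc i')
      have "(\<Oplus>t\<in>{..<k}. (if i = 0 then L t else if i = Suc t then \<one> else \<zero>) \<otimes> q $$ (Suc t, j)) =
          (if i = 0 then L i' else if i = Suc i' then \<one> else \<zero>) \<otimes> q $$ (Suc i', j)"
        using Suc ij oq q by (intro finsum_lessThan_single) (auto simp: mat_overD)
      then show ?thesis using Suc ij oq q by (simp add: mat_overD)
    qed
    finally show "q $$ (i, j) = rmul R ?u ?v $$ (i, j)" by simp
  qed (use q oq in auto)
  then show ?thesis
    by (rule mvn_factor[OF q(1)]) (use q oq L that in \<open>auto simp: mat_over_def\<close>)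
qed

section \<open>Diagonal idempotent matrices\<close>

lemma rdiag_list_append:
  "rdiag_list R (es @ fs) = direct_sum_mat R (rdiag_list R es) (rdiag_list R fs)"
  unfolding direct_sum_mat_four_block by (rule eq_matI) (auto simp: nth_append)

lemma mat_over_rdiag_list [simp]: "set es \<subseteq> carrier R \<Longrightarrow> mat_over R (rdiag_list R es)"
  by (auto simp: mat_over_def)

lemma rdiag_list_Cons: "rdiag_list R (e # es) = direct_sum_mat R (rdiag_list R [e]) (rdiag_list R es)"
  using rdiag_list_append[of "[e]" es] by simp

lemma idempotents_carrier: "idempotents R \<subseteq> carrier R"
  by (auto simp: idempotents_def)

lemma rdiag_list_idempotent: "set es \<subseteq> idempotents R \<Longrightarrow> rdiag_list R es \<in> idempotent_matrices R"
proof (induction es)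
  case Nil
  show ?case by (auto simp: mem_idempotent_matrices intro: eq_matI)
next
  case (Cons e es)
  then have "rdiag_list R [e] \<in> idempotent_matrices R"
    by (auto simp: mem_idempotent_matrices idempotents_def rmul_index finsum_lessThan_1 intro!: eq_matI)
  then show ?case using Cons by (subst rdiag_list_Cons) (simp add: direct_sum_idempotent)
qed

lemma mvn_rdiag_list_append:
  "mvn R (rdiag_list R es) (rdiag_list R es') \<Longrightarrow> mvn R (rdiag_list R fs) (rdiag_list R fs') \<Longrightarrow>
    mvn R (rdiag_list R (es @ fs)) (rdiag_list R (es' @ fs'))"
  by (simp add: rdiag_list_append mvn_direct_sum)

lemma mvn_rdiag_list_zeros:
  assumes "set es \<subseteq> idempotents R"
  shows "mvn R (rdiag_list R es) (rdiag_list R (replicate m \<zero> @ es))"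
proof (induction m)
  case 0
  show ?case using assms by (simp add: mvn_refl rdiag_list_idempotent)
next
  case (Suc m)
  have z: "\<zero> \<in> idempotents R" by (simp add: idempotents_def)
  \<comment> \<open>A product through an empty inner dimension consists of empty sums, so it is the
    1 by 1 zero matrix; in the other order the product is the empty matrix.\<close>
  have "mvn R (rdiag_list R []) (rdiag_list R [\<zero>])"
    by (rule mvnI[of _ _ "rzero R 0 1" "rzero R 1 0"]) (auto simp: rmul_index intro!: eq_matI)
  then have "mvn R (rdiag_list R ([] @ (replicate m \<zero> @ es))) (rdiag_list R ([\<zero>] @ (replicate m \<zero> @ es)))"
    by (rule mvn_rdiag_list_append) (use z assms in \<open>auto intro!: mvn_refl rdiag_list_idempotent\<close>)
  then have "mvn R (rdiag_list R es) (rdiag_list R ([\<zero>] @ (replicate m \<zero> @ es)))"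
    using Suc z assms by (intro mvn_trans[OF _ _ Suc]) (auto intro!: rdiag_list_idempotent)
  then show ?case by simp
qed

end

section \<open>Diagonalization over exchange rings\<close>

lemma (in ring) eq_if_minus_zero:
  "\<lbrakk>a \<ominus> b = \<zero>; a \<in> carrier R; b \<in> carrier R\<rbrakk> \<Longrightarrow> a = b"
  using minus_equality[of a "\<ominus> b"] by (simp add: minus_eq)

context cring
begin

text \<open>Over a local ring, \<open>a\<close> or \<open>1 - a\<close> is a unit for the corner
  entry \<open>a\<close>, and either case lowers the size. The exchange idempotent \<open>e\<close>
  lets both cases occur at once, on complementary parts of the ring.\<close>

lemma idempotent_matrix_diagonalizable:
  assumes exch: "exchange_ring R"
  shows "p \<in> idempotent_matrices R \<Longrightarrow> \<exists>es. set es \<subseteq> idempotents R \<and> mvn R p (rdiag_list R es)"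
proof (induction "dim_row p" arbitrary: p)
  case 0
  then have "p = rdiag_list R []" by (auto simp: mem_idempotent_matrices)
  then show ?case using mvn_refl[OF "0.prems"] by (intro exI[of _ "[]"]) auto
next
  case (Suc k)
  define n where "n = Suc k"
  define a where "a = p $$ (0, 0)"
  have op: "mat_over R p" and dp: "dim_row p = n" "dim_col p = n" and pp: "rmul R p p = p"
    using Suc.prems Suc.hyps(2) by (auto simp: mem_idempotent_matrices n_def)
  have pc: "p $$ (i, j) \<in> carrier R" if "i < n" "j < n" for i j
    using that op dp by (simp add: mat_overD)
  have n0: "0 < n" by (simp add: n_def)
  have pp_index: "(\<Oplus>t\<in>{..<n}. p $$ (i, t) \<otimes> p $$ (t, j)) = p $$ (i, j)" if "i < n" "j < n" for i j
    using that dp arg_cong[OF pp, of "\<lambda>m. m $$ (i, j)"] by (simp add: rmul_index)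
  have ac: "a \<in> carrier R" using pc n0 by (simp add: a_def)
  from exch ac obtain e b' c' where e: "e \<in> carrier R" "e \<otimes> e = e" and b': "b' \<in> carrier R" "a \<otimes> b' = e"
    and c': "c' \<in> carrier R" "(\<one> \<ominus> a) \<otimes> c' = \<one> \<ominus> e"
    unfolding exchange_ring_def idempotents_def by blast
  \<comment> \<open>Cutting \<open>b'\<close> down by \<open>e\<close> keeps \<open>a b = e\<close>
    and adds \<open>e b = b\<close>, which is what makes the rank one matrix \<open>f\<close> below
    idempotent and lets it vanish under \<open>1 - e\<close>.\<close>
  define b where "b = b' \<otimes> e"
  define c where "c = c' \<otimes> (\<one> \<ominus> e)"
  have b: "b \<in> carrier R" using b' e by (simp add: b_def)
  have c: "c \<in> carrier R" using c' e by (simp add: c_def)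
  have ab: "a \<otimes> b = e" using b' ac e unfolding b_def by (simp flip: m_assoc)
  have eb: "e \<otimes> b = b" unfolding b_def using b' e by (simp add: m_lcomm)
  have e1: "(\<one> \<ominus> e) \<otimes> (\<one> \<ominus> e) = \<one> \<ominus> e"
  proof -
    have "(\<one> \<ominus> e) \<otimes> (\<one> \<ominus> e) = \<one> \<ominus> e \<ominus> e \<oplus> e \<otimes> e"
      using e(1) by Ring.algebra
    also have "\<dots> = \<one> \<ominus> e \<ominus> e \<oplus> e" using e(2) by simp
    also have "\<dots> = \<one> \<ominus> e" using e(1) by Ring.algebra
    finally show ?thesis .
  qed
  have c1: "c \<otimes> (\<one> \<ominus> e) \<otimes> (\<one> \<ominus> a) = \<one> \<ominus> e"
  proof -
    have "c \<otimes> (\<one> \<ominus> e) \<otimes> (\<one> \<ominus> a) = ((\<one> \<ominus> a) \<otimes> c') \<otimes> ((\<one> \<ominus> e) \<otimes> (\<one> \<ominus> e))"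
      unfolding c_def using e(1) ac c'(1) by (simp add: m_ac)
    then show ?thesis using c'(2) e1 by simp
  qed
  \<comment> \<open>Split off the rank one idempotent \<open>f = v w\<close>. The first row of the remainder \<open>q\<close> vanishes after
    multiplication
      by \<open>e\<close>; after multiplication by \<open>1 - e\<close>, where \<open>1 - a\<close> is invertible, it is a
    combination of the other rows. So both parts of \<open>q\<close> shrink to size \<open>k\<close>.\<close>
  define v where "v = mat n 1 (\<lambda>(i, _). p $$ (i, 0))"
  define w where "w = mat 1 n (\<lambda>(_, j). b \<otimes> p $$ (0, j))"
  have v: "mat_over R v" "dim_row v = n" "dim_col v = 1" and w: "mat_over R w" "dim_row w = 1" "dim_col w = n"
    using pc n0 b by (auto simp: v_def w_def mat_over_def)
  \<comment> \<open>Row 0 of \<open>p\<close> times column 0 of \<open>p\<close> is the corner of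
    \<open>p p = p\<close>, that is \<open>a\<close>; the factor \<open>b\<close> turns it into
    \<open>e\<close>.\<close>
  have wv: "rmul R w v = rdiag_list R [e]"
  proof (rule eq_matI)
    fix i j assume "i < dim_row (rdiag_list R [e])" "j < dim_col (rdiag_list R [e])"
    then have ij: "i = 0" "j = 0" by auto
    have "rmul R w v $$ (0, 0) = (\<Oplus>t\<in>{..<n}. b \<otimes> (p $$ (0, t) \<otimes> p $$ (t, 0)))"
      using pc n0 b v w
      by (subst rmul_index) (auto simp: v_def w_def m_assoc intro!: finsum_lessThan_cong)
    also have "\<dots> = b \<otimes> a"
      using pc n0 b by (subst finsum_lessThan_rdistr[symmetric]) (auto simp: pp_index a_def)
    finally show "rmul R w v $$ (i, j) = rdiag_list R [e] $$ (i, j)"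
      using ij ab b ac by (simp add: m_comm)
  qed (use v w in auto)
  have pv: "rmul R p v = v"
  proof (rule eq_matI)
    fix i j assume "i < dim_row v" "j < dim_col v"
    then have ij: "i < n" "j = 0" using v by auto
    have "rmul R p v $$ (i, 0) = (\<Oplus>t\<in>{..<n}. p $$ (i, t) \<otimes> p $$ (t, 0))"
      using pc n0 dp v ij by (subst rmul_index) (auto simp: v_def intro!: finsum_lessThan_cong)
    then show "rmul R p v $$ (i, j) = v $$ (i, j)"
      using ij n0 by (simp add: pp_index v_def)
  qed (use v dp in auto)
  have wp: "rmul R w p = w"
  proof (rule eq_matI)
    fix i j assume "i < dim_row w" "j < dim_col w"
    then have ij: "i = 0" "j < n" using w by auto
    have "rmul R w p $$ (0, j) = (\<Oplus>t\<in>{..<n}. b \<otimes> (p $$ (0, t) \<otimes> p $$ (t, j)))"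
      using pc n0 b dp w ij by (subst rmul_index) (auto simp: w_def m_assoc intro!: finsum_lessThan_cong)
    also have "\<dots> = b \<otimes> p $$ (0, j)"
      using pc n0 b ij by (subst finsum_lessThan_rdistr[symmetric]) (auto simp: pp_index)
    finally show "rmul R w p $$ (i, j) = w $$ (i, j)"
      using ij by (simp add: w_def)
  qed (use w dp in auto)
  have ew: "rmul R (rdiag_list R [e]) w = w"
    using w e b pc n0 by (intro eq_matI) (auto simp: rmul_index w_def eb simp flip: m_assoc)
  have eo: "mat_over R (rdiag_list R [e])" using e by simp
  define f where "f = rmul R v w"
  have f_index: "f $$ (i, j) = p $$ (i, 0) \<otimes> (b \<otimes> p $$ (0, j))" if "i < n" "j < n" for i j
    using that v w pc n0 b by (simp add: f_def rmul_index) (simp add: v_def w_def)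
  have f: "f \<in> idempotent_matrices R" "dim_row f = n"
  proof -
    have "rmul R f f = rmul R v (rmul R (rmul R w v) w)"
      unfolding f_def using v w by (simp add: rmul_assoc)
    then have "rmul R f f = f" using wv ew by (simp add: f_def)
    then show "f \<in> idempotent_matrices R" "dim_row f = n"
      using v w by (auto simp: mem_idempotent_matrices f_def)
  qed
  have pf: "rmul R p f = f" unfolding f_def using v w op dp pv by (simp flip: rmul_assoc)
  have fp: "rmul R f p = f" unfolding f_def using v w op dp wp by (simp add: rmul_assoc)
  have mf: "mvn R f (rdiag_list R [e])"
    by (rule mvnI[OF f_def wv[symmetric]]) (use v w in auto)
  define q where "q = mat n n (\<lambda>ij. p $$ ij \<ominus> f $$ ij)"
  note comp = Suc.prems dp(1) f pf fp
  have q: "q \<in> idempotent_matrices R" unfolding q_def by (rule idempotent_complement(1)[OF comp])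
  have mp: "mvn R p (direct_sum_mat R f q)" unfolding q_def by (rule mvn_split[OF comp])
  have dq: "dim_row q = n" "dim_col q = n" by (auto simp: q_def)
  have oq: "mat_over R q" and qq: "rmul R q q = q" using q by (auto simp: mem_idempotent_matrices)
  have qc: "q $$ (i, j) \<in> carrier R" if "i < n" "j < n" for i j
    using that oq dq by (simp add: mat_overD)
  \<comment> \<open>The scalar idempotent \<open>e\<close> is central, so it splits \<open>q\<close>
    into the orthogonal pieces \<open>g = e q\<close> and \<open>h = (1 - e) q\<close>.\<close>
  define g where "g = rmul R (rdiag R n e) q"
  have g_mat: "g = mat n n (\<lambda>(i, j). e \<otimes> q $$ (i, j))"
    using oq dq e by (simp add: g_def rmul_rdiag_left)
  have g_comm: "g = rmul R q (rdiag R n e)"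
    using oq dq e qc unfolding g_mat by (subst rmul_rdiag_right) (auto simp: m_comm intro!: eq_matI)
  have de: "mat_over R (rdiag R n e)" using e by simp
  have dee: "rmul R (rdiag R n e) (rdiag R n e) = rdiag R n e"
    using e by (subst rmul_rdiag_left) (auto intro!: eq_matI)
  have qg: "rmul R q g = g"
    unfolding g_comm using oq dq de qq by (simp flip: rmul_assoc)
  have gq: "rmul R g q = g"
    unfolding g_def using oq dq de qq by (simp add: rmul_assoc)
  have g: "g \<in> idempotent_matrices R" "dim_row g = n"
  proof -
    have "rmul R g g = rmul R (rdiag R n e) (rmul R q g)"
      using oq dq de by (subst g_def) (simp add: rmul_assoc g_mat mat_over_def qc e)
    also have "\<dots> = rmul R (rmul R (rdiag R n e) (rdiag R n e)) q"
      using oq dq de unfolding qg by (simp add: rmul_assoc) (simp add: g_def)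
    finally have "rmul R g g = g" by (simp add: dee g_def)
    then show "g \<in> idempotent_matrices R" "dim_row g = n"
      using oq dq de by (auto simp: mem_idempotent_matrices g_def)
  qed
  define h where "h = mat n n (\<lambda>ij. q $$ ij \<ominus> g $$ ij)"
  note comp' = q dq(1) g qg gq
  have h: "h \<in> idempotent_matrices R" unfolding h_def by (rule idempotent_complement(1)[OF comp'])
  have mq: "mvn R q (direct_sum_mat R g h)" unfolding h_def by (rule mvn_split[OF comp'])
  \<comment> \<open>In row 0 the entry of \<open>f\<close> is \<open>a b = e\<close> times that of
    \<open>p\<close>, so row 0 of \<open>q\<close> is a multiple of \<open>1 - e\<close> and dies
    under \<open>e\<close>. The zero row is a combination with zero coefficients.\<close>
  have g_row: "g $$ (0, j) = (\<Oplus>t\<in>{..<k}. \<zero> \<otimes> g $$ (Suc t, j))" if "j < Suc k" for j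
  proof -
    have x: "p $$ (0, j) \<in> carrier R" using that pc by (simp add: n_def)
    have *: "e \<otimes> (x \<ominus> a \<otimes> (b \<otimes> x)) = \<zero>" if "x \<in> carrier R" for x
    proof -
      have "e \<otimes> (x \<ominus> a \<otimes> (b \<otimes> x)) = e \<otimes> x \<ominus> e \<otimes> (a \<otimes> b) \<otimes> x"
        using e(1) ac b that by Ring.algebra
      also have "\<dots> = \<zero>" using e ab that by (simp add: r_neg minus_eq)
      finally show ?thesis .
    qed
    have "g $$ (0, j) = \<zero>"
      using that *[OF x] by (simp add: g_mat q_def n_def[symmetric] f_index n0 a_def)
    moreover have "(\<Oplus>t\<in>{..<k}. \<zero> \<otimes> g $$ (Suc t, j)) = \<zero>"
      using that g by (intro finsum_lessThan_zero) (auto simp: g_mat n_def qc e)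
    ultimately show ?thesis by simp
  qed
  \<comment> \<open>All entries of \<open>f\<close> contain the factor \<open>b = e b\<close>, so
    \<open>f\<close> is invisible after multiplication by \<open>1 - e\<close>.\<close>
  have h_index: "h $$ (i, j) = (\<one> \<ominus> e) \<otimes> p $$ (i, j)" if "i < n" "j < n" for i j
  proof -
    have "(x \<ominus> y \<otimes> (b \<otimes> z)) \<ominus> e \<otimes> (x \<ominus> y \<otimes> (b \<otimes> z)) = (\<one> \<ominus> e) \<otimes> x"
      if "x \<in> carrier R" "y \<in> carrier R" "z \<in> carrier R" for x y z
    proof -
      have "(x \<ominus> y \<otimes> (b \<otimes> z)) \<ominus> e \<otimes> (x \<ominus> y \<otimes> (b \<otimes> z)) = (\<one> \<ominus> e) \<otimes> x \<ominus> y \<otimes> b \<otimes> z \<oplus> y \<otimes> (e \<otimes> b) \<otimes> z"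
        using that e(1) b by Ring.algebra
      also have "\<dots> = (\<one> \<ominus> e) \<otimes> x"
        unfolding eb using that e(1) b by Ring.algebra
      finally show ?thesis .
    qed
    from this[of "p $$ (i, j)" "p $$ (i, 0)" "p $$ (0, j)"] show ?thesis
      using that pc n0 by (simp add: h_def g_mat q_def f_index)
  qed
  \<comment> \<open>Row 0 of \<open>p p = p\<close> expresses \<open>(1 - a)\<close> times row 0
    through the remaining rows, and \<open>c\<close> inverts \<open>1 - a\<close> on the part cut
    out by \<open>1 - e\<close>.\<close>
  have h_row: "h $$ (0, j) = (\<Oplus>t\<in>{..<k}. (c \<otimes> p $$ (0, Suc t)) \<otimes> h $$ (Suc t, j))" if "j < Suc k" for j
  proof -
    let ?s = "\<Oplus>t\<in>{..<k}. p $$ (0, Suc t) \<otimes> p $$ (Suc t, j)"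
    have j: "j < n" using that by (simp add: n_def)
    have cl: "p $$ (0, Suc t) \<in> carrier R" "p $$ (Suc t, j) \<in> carrier R" if "t < k" for t
      using that pc j n0 by (auto simp: n_def)
    have sc: "?s \<in> carrier R" using cl by (intro finsum_lessThan_closed) auto
    have xc: "p $$ (0, j) \<in> carrier R" using pc j n0 by simp
    have "p $$ (0, j) = (\<Oplus>t\<in>{..<1 + k}. p $$ (0, t) \<otimes> p $$ (t, j))"
      using pp_index[OF n0 j] by (simp add: n_def)
    also have "\<dots> = (\<Oplus>t\<in>{..<1::nat}. p $$ (0, t) \<otimes> p $$ (t, j)) \<oplus> (\<Oplus>t\<in>{..<k}. p $$ (0, 1 + t) \<otimes> p $$ (1 + t, j))"
      by (rule finsum_lessThan_add) (use pc j n0 in \<open>auto simp: n_def\<close>)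
    also have "\<dots> = a \<otimes> p $$ (0, j) \<oplus> ?s"
      using ac xc by (simp add: a_def)
    finally have s: "p $$ (0, j) = a \<otimes> p $$ (0, j) \<oplus> ?s" .
    have s': "?s = (\<one> \<ominus> a) \<otimes> p $$ (0, j)"
    proof -
      have "y = (\<one> \<ominus> a) \<otimes> x" if "x \<in> carrier R" "y \<in> carrier R" "x = a \<otimes> x \<oplus> y" for x y
      proof -
        have "(\<one> \<ominus> a) \<otimes> x = x \<ominus> a \<otimes> x"
          using that(1) ac by Ring.algebra
        also have "\<dots> = (a \<otimes> x \<oplus> y) \<ominus> a \<otimes> x" using that(3) by simp
        also have "\<dots> = y" using that(1,2) ac by Ring.algebra
        finally show ?thesis by simp
      qed
      from this[OF xc sc s] show ?thesis .
    qed
    have "(\<Oplus>t\<in>{..<k}. (c \<otimes> p $$ (0, Suc t)) \<otimes> h $$ (Suc t, j)) =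
        (\<Oplus>t\<in>{..<k}. (c \<otimes> (\<one> \<ominus> e)) \<otimes> (p $$ (0, Suc t) \<otimes> p $$ (Suc t, j)))"
    proof (rule finsum_lessThan_cong)
      fix t assume t: "t < k"
      have "(c \<otimes> x) \<otimes> ((\<one> \<ominus> e) \<otimes> y) = (c \<otimes> (\<one> \<ominus> e)) \<otimes> (x \<otimes> y)"
        if "x \<in> carrier R" "y \<in> carrier R" for x y
        using that c e(1) by Ring.algebra
      then show "(c \<otimes> p $$ (0, Suc t)) \<otimes> h $$ (Suc t, j) = (c \<otimes> (\<one> \<ominus> e)) \<otimes> (p $$ (0, Suc t) \<otimes> p $$ (Suc t, j))"
        using t j cl by (simp add: h_index n_def)
      show "(c \<otimes> (\<one> \<ominus> e)) \<otimes> (p $$ (0, Suc t) \<otimes> p $$ (Suc t, j)) \<in> carrier R"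
        using t cl c e by simp
    qed
    also have "\<dots> = (c \<otimes> (\<one> \<ominus> e)) \<otimes> ?s"
      using cl c e by (intro finsum_lessThan_rdistr[symmetric]) auto
    also have "\<dots> = (\<one> \<ominus> e) \<otimes> p $$ (0, j)"
      unfolding s' using c1 c e ac xc by (simp flip: m_assoc)
    also have "\<dots> = h $$ (0, j)" using j n0 by (simp add: h_index)
    finally show ?thesis by simp
  qed
  obtain g' where g': "g' \<in> idempotent_matrices R" "dim_row g' = k" "mvn R g g'"
    using mvn_reduce[of g k "\<lambda>_. \<zero>"] g g_row by (auto simp: n_def)
  obtain h' where h': "h' \<in> idempotent_matrices R" "dim_row h' = k" "mvn R h h'"
  proof (rule mvn_reduce[OF h _ _ h_row])
    show "dim_row h = Suc k" by (simp add: h_def n_def)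
    show "c \<otimes> p $$ (0, Suc t) \<in> carrier R" if "t < k" for t
      using that pc c n0 by (simp add: n_def)
  qed auto
  obtain gs where gs: "set gs \<subseteq> idempotents R" "mvn R g' (rdiag_list R gs)"
    using Suc.hyps(1)[of g'] g' by auto
  obtain hs where hs: "set hs \<subseteq> idempotents R" "mvn R h' (rdiag_list R hs)"
    using Suc.hyps(1)[of h'] h' by auto
  have ei: "set [e] \<subseteq> idempotents R" using e by (simp add: idempotents_def)
  have "mvn R q (direct_sum_mat R (rdiag_list R gs) (rdiag_list R hs))"
    using g g' h h' gs hs q mq
    by (intro mvn_trans[OF _ _ mq] mvn_direct_sum)
      (auto intro: mvn_trans[of _ "rdiag_list R _"] direct_sum_idempotent rdiag_list_idempotent)
  then have "mvn R p (direct_sum_mat R (rdiag_list R [e]) (direct_sum_mat R (rdiag_list R gs) (rdiag_list R hs)))"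
    using Suc.prems ei gs hs mf
    by (intro mvn_trans[OF _ _ mp] mvn_direct_sum direct_sum_idempotent rdiag_list_idempotent) auto
  then have "mvn R p (rdiag_list R ([e] @ gs @ hs))"
    by (simp only: rdiag_list_append)
  then show ?case using ei gs hs by (intro exI[of _ "[e] @ gs @ hs"]) auto
qed

end

section \<open>The trace classifies idempotent matrices\<close>

definition rtrace :: "('a, 'b) ring_scheme \<Rightarrow> 'a mat \<Rightarrow> 'a" where
  "rtrace R p = (\<Oplus>\<^bsub>R\<^esub>i\<in>{..<dim_row p}. p $$ (i, i))"

definition lsum :: "('a, 'b) ring_scheme \<Rightarrow> 'a list \<Rightarrow> 'a" where
  "lsum R xs = foldr (\<oplus>\<^bsub>R\<^esub>) xs \<zero>\<^bsub>R\<^esub>"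

lemma lsum_Nil [simp]: "lsum R [] = \<zero>\<^bsub>R\<^esub>"
  and lsum_Cons [simp]: "lsum R (x # xs) = x \<oplus>\<^bsub>R\<^esub> lsum R xs"
  by (simp_all add: lsum_def)

text \<open>For idempotents \<open>x y = x\<close> is the order given by inclusion of supports, so a
  chain grows from left to right.\<close>

abbreviation idem_chain :: "('a, 'b) ring_scheme \<Rightarrow> 'a list \<Rightarrow> bool" where
  "idem_chain R \<equiv> sorted_wrt (\<lambda>x y. x \<otimes>\<^bsub>R\<^esub> y = x)"

text \<open>Torsion would let a sum of idempotents forget how often each of them occurs.\<close>

definition add_torsion_free :: "('a, 'b) ring_scheme \<Rightarrow> bool" where
  "add_torsion_free R \<longleftrightarrow> (\<forall>x\<in>carrier R. \<forall>k::nat. 0 < k \<longrightarrow> [k] \<cdot>\<^bsub>R\<^esub> x = \<zero>\<^bsub>R\<^esub> \<longrightarrow> x = \<zero>\<^bsub>R\<^esub>)"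

context cring
begin

section \<open>Sums of lists and traces\<close>

lemma lsum_closed [simp]: "set xs \<subseteq> carrier R \<Longrightarrow> lsum R xs \<in> carrier R"
  by (induction xs) auto

lemma lsum_append: "set xs \<subseteq> carrier R \<Longrightarrow> set ys \<subseteq> carrier R \<Longrightarrow> lsum R (xs @ ys) = lsum R xs \<oplus> lsum R ys"
  by (induction xs) (auto simp: a_assoc)

lemma rtrace_closed [simp]: "mat_over R p \<Longrightarrow> dim_col p = dim_row p \<Longrightarrow> rtrace R p \<in> carrier R"
  unfolding rtrace_def by (intro finsum_lessThan_closed) (auto simp: mat_overD)

lemma rtrace_rmul_commute:
  assumes "mat_over R u" "mat_over R v" "dim_col u = dim_row v" "dim_row u = dim_col v"
  shows "rtrace R (rmul R u v) = rtrace R (rmul R v u)"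
proof -
  have "rtrace R (rmul R u v) = (\<Oplus>i\<in>{..<dim_row u}. \<Oplus>t\<in>{..<dim_row v}. u $$ (i, t) \<otimes> v $$ (t, i))"
    unfolding rtrace_def dim_rmul using assms
    by (intro finsum_lessThan_cong) (auto simp: rmul_index mat_overD intro!: finsum_lessThan_closed)
  also have "\<dots> = (\<Oplus>t\<in>{..<dim_row v}. \<Oplus>i\<in>{..<dim_row u}. u $$ (i, t) \<otimes> v $$ (t, i))"
    using assms by (intro finsum_lessThan_swap) (auto simp: mat_overD)
  also have "\<dots> = (\<Oplus>t\<in>{..<dim_row v}. \<Oplus>i\<in>{..<dim_row u}. v $$ (t, i) \<otimes> u $$ (i, t))"
    using assms by (intro finsum_lessThan_cong finsum_lessThan_closed m_comm) (auto simp: mat_overD)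
  also have "\<dots> = rtrace R (rmul R v u)"
    unfolding rtrace_def dim_rmul using assms
    by (intro finsum_lessThan_cong[symmetric]) (auto simp: rmul_index mat_overD intro!: finsum_lessThan_closed)
  finally show ?thesis .
qed

lemma rtrace_mvn: "mvn R p q \<Longrightarrow> rtrace R p = rtrace R q"
  unfolding mvn_def using rtrace_rmul_commute by metis

lemma rtrace_direct_sum:
  assumes "mat_over R p" "dim_col p = dim_row p" "mat_over R q" "dim_col q = dim_row q"
  shows "rtrace R (direct_sum_mat R p q) = rtrace R p \<oplus> rtrace R q"
proof -
  let ?d = "direct_sum_mat R p q"
  have o: "mat_over R ?d" using assms by simp
  have "rtrace R ?d = (\<Oplus>i\<in>{..<dim_row p}. ?d $$ (i, i)) \<oplus> (\<Oplus>i\<in>{..<dim_row q}. ?d $$ (dim_row p + i, dim_row p + i))"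
    unfolding rtrace_def dim_direct_sum_mat
    by (rule finsum_lessThan_add) (use o assms in \<open>auto simp: mat_overD\<close>)
  also have "\<dots> = rtrace R p \<oplus> rtrace R q"
    unfolding rtrace_def using assms
    by (intro arg_cong2[where f = "(\<oplus>)"] finsum_lessThan_cong) (auto simp: direct_sum_mat_four_block mat_overD)
  finally show ?thesis .
qed

lemma rtrace_rdiag_list: "set es \<subseteq> carrier R \<Longrightarrow> rtrace R (rdiag_list R es) = lsum R es"
proof (induction es)
  case Nil
  show ?case by (simp add: rtrace_def)
next
  case (Cons e es)
  then show ?case by (subst rdiag_list_Cons) (simp add: rtrace_direct_sum, simp add: rtrace_def)
qed

section \<open>Sorting a diagonal into a chain\<close>

lemma mvn_rdiag_list_trans:
  "\<lbrakk>set es \<subseteq> idempotents R; set gs \<subseteq> idempotents R; mvn R (rdiag_list R es) (rdiag_list R fs);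
    mvn R (rdiag_list R fs) (rdiag_list R gs)\<rbrakk> \<Longrightarrow> mvn R (rdiag_list R es) (rdiag_list R gs)"
  by (rule mvn_trans[OF rdiag_list_idempotent rdiag_list_idempotent])

text \<open>Write \<open>e = x + y\<close> with \<open>x = e g\<close> and \<open>y\<close>
  orthogonal to \<open>g\<close>. The piece \<open>y\<close> moves from the first slot to the
  second: the factors have rows \<open>(x, y)\<close>, \<open>(0, g)\<close> and
  \<open>(x, 0)\<close>, \<open>(y, g)\<close>, and all mixed products vanish.\<close>

lemma mvn_rdiag_list_pair:
  assumes e: "e \<in> idempotents R" and g: "g \<in> idempotents R"
  shows "mvn R (rdiag_list R [e, g]) (rdiag_list R [e \<otimes> g, e \<oplus> g \<ominus> e \<otimes> g])"
proof -
  define x where "x = e \<otimes> g"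
  define y where "y = e \<ominus> e \<otimes> g"
  have c: "e \<in> carrier R" "g \<in> carrier R" and ee: "e \<otimes> e = e" "g \<otimes> g = g"
    using e g by (auto simp: idempotents_def)
  have xy: "x \<in> carrier R" "y \<in> carrier R" using c by (auto simp: x_def y_def)
  have e': "e = x \<oplus> y" unfolding x_def y_def using c by Ring.algebra
  have "x \<otimes> x = (e \<otimes> e) \<otimes> (g \<otimes> g)"
    unfolding x_def using c by Ring.algebra
  then have xx: "x \<otimes> x = x" using ee x_def by simp
  have "y \<otimes> g = e \<otimes> g \<ominus> e \<otimes> (g \<otimes> g)"
    unfolding y_def using c by Ring.algebra
  then have yg: "y \<otimes> g = \<zero>" using ee c by (simp add: minus_eq r_neg)
  then have gy: "g \<otimes> y = \<zero>" using c xy by (simp add: m_comm)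
  have xy0: "x \<otimes> y = \<zero>" unfolding x_def using c xy gy by (simp add: m_assoc)
  then have yx0: "y \<otimes> x = \<zero>" using xy by (simp add: m_comm)
  have "y \<otimes> y = e \<otimes> e \<ominus> (e \<otimes> e) \<otimes> g \<ominus> (e \<otimes> e) \<otimes> g \<oplus> (e \<otimes> e) \<otimes> (g \<otimes> g)"
    unfolding y_def using c by Ring.algebra
  also have "\<dots> = e \<ominus> e \<otimes> g \<ominus> e \<otimes> g \<oplus> e \<otimes> g"
    unfolding ee ..
  also have "\<dots> = y" unfolding y_def using c by Ring.algebra
  finally have yy: "y \<otimes> y = y" .
  have j: "e \<oplus> g \<ominus> e \<otimes> g = y \<oplus> g" unfolding y_def using c by Ring.algebra
  let ?u = "mat 2 2 (\<lambda>(i, j). if i = 0 then if j = 0 then x else y else if j = 0 then \<zero> else g)"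
  let ?v = "mat 2 2 (\<lambda>(i, j). if i = 0 then if j = 0 then x else \<zero> else if j = 0 then y else g)"
  have two: "finsum R f {..<2} = f 0 \<oplus> f 1" if "f 0 \<in> carrier R" "f 1 \<in> carrier R" for f :: "nat \<Rightarrow> _"
    using that unfolding numeral_2_eq_2
    by (subst finsum_lessThan_Suc) (auto simp: less_Suc_eq)
  have "mvn R (rdiag_list R [e, g]) (rdiag_list R [x, y \<oplus> g])"
  proof (rule mvnI[of _ _ ?u ?v])
    show "rdiag_list R [e, g] = rmul R ?u ?v"
      using xy c xx yy ee yg gy
      by (intro eq_matI) (auto simp: rmul_index two less_2_cases_iff e')
    show "rdiag_list R [x, y \<oplus> g] = rmul R ?v ?u"
      using xy c xx yy ee xy0 yx0
      by (intro eq_matI) (auto simp: rmul_index two less_2_cases_iff)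
  qed (use xy c in \<open>auto simp: mat_over_def\<close>)
  then show ?thesis by (simp only: x_def j)
qed

lemma idempotents_join:
  assumes "e \<in> idempotents R" "g \<in> idempotents R"
  shows "e \<oplus> g \<ominus> e \<otimes> g \<in> idempotents R" "e \<otimes> g \<in> idempotents R"
proof -
  have c: "e \<in> carrier R" "g \<in> carrier R" and ee: "e \<otimes> e = e" "g \<otimes> g = g"
    using assms by (auto simp: idempotents_def)
  have compl: "\<one> \<ominus> x \<in> idempotents R" if "x \<in> idempotents R" for x
  proof -
    have x: "x \<in> carrier R" "x \<otimes> x = x" using that by (auto simp: idempotents_def)
    have "(\<one> \<ominus> x) \<otimes> (\<one> \<ominus> x) = \<one> \<ominus> x \<ominus> x \<oplus> x \<otimes> x"
      using x(1) by Ring.algebra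
    also have "\<dots> = \<one> \<ominus> x \<ominus> x \<oplus> x" using x(2) by simp
    also have "\<dots> = \<one> \<ominus> x" using x(1) by Ring.algebra
    finally show ?thesis using x by (simp add: idempotents_def)
  qed
  have meet: "x \<otimes> y \<in> idempotents R" if "x \<in> idempotents R" "y \<in> idempotents R" for x y
  proof -
    have xy: "x \<in> carrier R" "y \<in> carrier R" "x \<otimes> x = x" "y \<otimes> y = y"
      using that by (auto simp: idempotents_def)
    have "(x \<otimes> y) \<otimes> (x \<otimes> y) = (x \<otimes> x) \<otimes> (y \<otimes> y)"
      using xy(1,2) by (simp add: m_ac)
    then show ?thesis using xy by (simp add: idempotents_def)
  qed
  have "e \<oplus> g \<ominus> e \<otimes> g = \<one> \<ominus> (\<one> \<ominus> e) \<otimes> (\<one> \<ominus> g)"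
    using c by Ring.algebra
  then show "e \<oplus> g \<ominus> e \<otimes> g \<in> idempotents R" using compl meet assms by simp
  show "e \<otimes> g \<in> idempotents R" by (rule meet[OF assms])
qed

text \<open>The meet of \<open>e\<close> and the head stays in front, and the join is inserted into
  the tail. The last conjunct is the invariant that carries the induction: common lower bounds of
  the input remain lower bounds of the output, so the meet is below whatever the tail turns
  into.\<close>

lemma insert_idem_chain:
  "\<lbrakk>set gs \<subseteq> idempotents R; idem_chain R gs; e \<in> idempotents R\<rbrakk> \<Longrightarrow>
    \<exists>hs. set hs \<subseteq> idempotents R \<and> idem_chain R hs \<and> length hs = Suc (length gs) \<and>
      mvn R (rdiag_list R (e # gs)) (rdiag_list R hs) \<and>
      (\<forall>x\<in>carrier R. x \<otimes> e = x \<longrightarrow> (\<forall>g\<in>set gs. x \<otimes> g = x) \<longrightarrow> (\<forall>h\<in>set hs. x \<otimes> h = x))"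
proof (induction gs arbitrary: e)
  case Nil
  then show ?case by (intro exI[of _ "[e]"]) (auto intro!: mvn_refl rdiag_list_idempotent)
next
  case (Cons g gs)
  define m where "m = e \<otimes> g"
  define j where "j = e \<oplus> g \<ominus> e \<otimes> g"
  have mj: "m \<in> idempotents R" "j \<in> idempotents R"
    using Cons.prems idempotents_join[of e g] by (auto simp: m_def j_def)
  have c: "e \<in> carrier R" "g \<in> carrier R" and ee: "e \<otimes> e = e" "g \<otimes> g = g" and gsc: "set gs \<subseteq> carrier R"
    using Cons.prems by (auto simp: idempotents_def)
  obtain hs where hs: "set hs \<subseteq> idempotents R" "idem_chain R hs" "length hs = Suc (length gs)"
      "mvn R (rdiag_list R (j # gs)) (rdiag_list R hs)"
      "\<forall>x\<in>carrier R. x \<otimes> j = x \<longrightarrow> (\<forall>g\<in>set gs. x \<otimes> g = x) \<longrightarrow> (\<forall>h\<in>set hs. x \<otimes> h = x)"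
    using Cons.IH[of j] Cons.prems mj by auto
  \<comment> \<open>A common lower bound of \<open>e\<close> and \<open>g\<close> is below both
    their meet and their join; this is used for the bounds in the invariant and for the meet
    itself.\<close>
  have low: "x \<otimes> m = x \<and> x \<otimes> j = x" if "x \<in> carrier R" "x \<otimes> e = x" "x \<otimes> g = x" for x
  proof -
    have 1: "x \<otimes> m = x" using that c unfolding m_def by (simp flip: m_assoc)
    have "x \<otimes> j = x \<otimes> e \<oplus> x \<otimes> g \<ominus> x \<otimes> m"
      unfolding j_def m_def using that(1) c by Ring.algebra
    also have "\<dots> = x \<oplus> x \<ominus> x" using that 1 by simp
    also have "\<dots> = x" using that(1) by Ring.algebra
    finally show ?thesis using 1 by simp
  qed
  have m: "m \<in> carrier R" "m \<otimes> e = m" "m \<otimes> g = m"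
  proof -
    show "m \<in> carrier R" using c by (simp add: m_def)
    have "m \<otimes> e = (e \<otimes> e) \<otimes> g" "m \<otimes> g = e \<otimes> (g \<otimes> g)"
      unfolding m_def using c by (simp_all add: m_ac)
    then show "m \<otimes> e = m" "m \<otimes> g = m" using ee by (simp_all add: m_def)
  qed
  have mg: "m \<otimes> y = m" if "y \<in> set gs" for y
  proof -
    have "g \<otimes> y = g" using that Cons.prems by auto
    then show ?thesis using that gsc c by (auto simp: m_def m_assoc)
  qed
  have mvn1: "mvn R (rdiag_list R ([e, g] @ gs)) (rdiag_list R ([m, j] @ gs))"
    using Cons.prems unfolding m_def j_def
    by (intro mvn_rdiag_list_append mvn_rdiag_list_pair mvn_refl rdiag_list_idempotent) auto
  have mvn2: "mvn R (rdiag_list R ([m] @ (j # gs))) (rdiag_list R ([m] @ hs))"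
    using mj by (intro mvn_rdiag_list_append mvn_refl rdiag_list_idempotent hs) auto
  have mvn: "mvn R (rdiag_list R (e # g # gs)) (rdiag_list R (m # hs))"
    by (rule mvn_rdiag_list_trans[of _ _ "[m, j] @ gs"]) (use Cons.prems mj hs(1) mvn1 mvn2 in simp_all)
  have mh: "m \<otimes> h = m" if "h \<in> set hs" for h
    using hs(5) m low[OF m] mg that by blast
  show ?case
  proof (intro exI[of _ "m # hs"] conjI)
    show "idem_chain R (m # hs)"
      using hs(2) mh by simp
    show "\<forall>x\<in>carrier R. x \<otimes> e = x \<longrightarrow> (\<forall>g\<in>set (g # gs). x \<otimes> g = x) \<longrightarrow> (\<forall>h\<in>set (m # hs). x \<otimes> h = x)"
    proof (intro ballI impI)
      fix x h assume x: "x \<in> carrier R" "x \<otimes> e = x" and le: "\<forall>g\<in>set (g # gs). x \<otimes> g = x" and h: "h \<in> set (m # hs)"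
      have xg: "x \<otimes> g = x" and xgs: "\<forall>g\<in>set gs. x \<otimes> g = x"
        using le by simp_all
      have "\<forall>h\<in>set hs. x \<otimes> h = x" using hs(5) x(1) low[OF x xg] xgs by blast
      moreover have "h = m \<or> h \<in> set hs" using h by simp
      ultimately show "x \<otimes> h = x" using low[OF x xg] by blast
    qed
  qed (use hs(1,3) mj mvn in simp_all)
qed

lemma sort_idem_chain:
  "set es \<subseteq> idempotents R \<Longrightarrow>
    \<exists>hs. set hs \<subseteq> idempotents R \<and> idem_chain R hs \<and> length hs = length es \<and>
      mvn R (rdiag_list R es) (rdiag_list R hs)"
proof (induction es)
  case Nil
  then show ?case by (intro exI[of _ "[]"]) (auto intro!: mvn_refl rdiag_list_idempotent)
next
  case (Cons e es)
  then obtain gs where gs: "set gs \<subseteq> idempotents R" "idem_chain R gs" "length gs = length es"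
      "mvn R (rdiag_list R es) (rdiag_list R gs)" by auto
  obtain hs where hs: "set hs \<subseteq> idempotents R" "idem_chain R hs" "length hs = Suc (length gs)"
      "mvn R (rdiag_list R (e # gs)) (rdiag_list R hs)"
    using insert_idem_chain[OF gs(1,2), of e] Cons.prems by auto
  have "mvn R (rdiag_list R ([e] @ es)) (rdiag_list R ([e] @ gs))"
    using Cons.prems by (intro mvn_rdiag_list_append mvn_refl rdiag_list_idempotent gs) auto
  then have mvn: "mvn R (rdiag_list R (e # es)) (rdiag_list R (e # gs))" by simp
  have "mvn R (rdiag_list R (e # es)) (rdiag_list R hs)"
    by (rule mvn_rdiag_list_trans[OF Cons.prems hs(1) mvn hs(4)])
  then show ?case using hs gs by (intro exI[of _ hs]) auto
qed

section \<open>A chain is determined by its length and its sum\<close>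

lemma mult_lsum_min:
  "\<lbrakk>g \<in> carrier R; set xs \<subseteq> carrier R; \<And>x. x \<in> set xs \<Longrightarrow> g \<otimes> x = g\<rbrakk> \<Longrightarrow>
    g \<otimes> lsum R xs = [length xs] \<cdot> g"
  by (induction xs) (auto simp: r_distr a_comm)

text \<open>The least member \<open>g\<close> absorbs the whole sum: \<open>g\<close> times the sum
  is \<open>g\<close> taken as often as the chain is long. Multiplying the hypothesis by
  \<open>g\<close> shows that a positive multiple of \<open>u g\<close> vanishes, hence
  \<open>u g\<close> does, and the rest of the chain follows by induction.\<close>

lemma mult_idem_chain_zero:
  assumes tf: "add_torsion_free R" and u: "u \<in> carrier R"
  shows "\<lbrakk>set gs \<subseteq> idempotents R; idem_chain R gs; u \<otimes> lsum R gs = \<zero>\<rbrakk> \<Longrightarrow> \<forall>g\<in>set gs. u \<otimes> g = \<zero>"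
proof (induction gs)
  case (Cons g gs)
  have c: "g \<in> carrier R" "set (g # gs) \<subseteq> carrier R" and gg: "g \<otimes> g = g"
    using Cons.prems by (auto simp: idempotents_def)
  have s: "lsum R (g # gs) \<in> carrier R" using c by (intro lsum_closed) auto
  have "g \<otimes> lsum R (g # gs) = [length (g # gs)] \<cdot> g"
    by (rule mult_lsum_min) (use Cons.prems gg c in auto)
  then have "[length (g # gs)] \<cdot> (u \<otimes> g) = u \<otimes> (g \<otimes> lsum R (g # gs))"
    by (simp only: add_pow_rdistr[OF u c(1)])
  also have "\<dots> = g \<otimes> (u \<otimes> lsum R (g # gs))" using u c(1) s by (simp only: m_lcomm)
  also have "\<dots> = \<zero>" using Cons.prems c by simp
  finally have ug: "u \<otimes> g = \<zero>"
    using tf u c unfolding add_torsion_free_def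
    by (metis length_greater_0_conv list.distinct(1) m_closed)
  then have "u \<otimes> lsum R gs = \<zero>"
    using Cons.prems u c by (simp add: r_distr)
  then show ?case using Cons ug by auto
qed simp

text \<open>The largest members \<open>g\<close> and \<open>h\<close> are compared, hence the
  induction from the right end. Since \<open>1 - g\<close> kills every member of its own chain, it
  kills the common sum, and so by \<open>mult_idem_chain_zero\<close> every member of the other
  chain, in particular \<open>h\<close>. By symmetry \<open>g = h\<close>, and both are
  cancelled.\<close>

lemma idem_chain_unique:
  assumes tf: "add_torsion_free R"
  shows "\<lbrakk>length gs = length hs; set gs \<subseteq> idempotents R; idem_chain R gs; set hs \<subseteq> idempotents R; idem_chain R hs;
    lsum R gs = lsum R hs\<rbrakk> \<Longrightarrow> gs = hs"
proof (induction gs arbitrary: hs rule: rev_induct)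
  case (snoc g gs hs')
  then obtain h hs where hs': "hs' = hs @ [h]"
    by (metis length_0_conv snoc_eq_iff_butlast)
  have c: "g \<in> carrier R" "h \<in> carrier R" "set gs \<subseteq> carrier R" "set hs \<subseteq> carrier R" "g \<otimes> g = g" "h \<otimes> h = h"
    using snoc.prems by (auto simp: idempotents_def hs')
  have le: "(\<one> \<ominus> k) \<otimes> lsum R (ks @ [k]) = \<zero>"
    if "set (ks @ [k]) \<subseteq> idempotents R" "idem_chain R (ks @ [k])" for k ks
  proof -
    have k: "k \<in> carrier R" using that by (auto simp: idempotents_def)
    have "lsum R xs \<in> carrier R \<and> (\<one> \<ominus> k) \<otimes> lsum R xs = \<zero>"
      if "set xs \<subseteq> {x \<in> carrier R. x \<otimes> k = x}" for xs
      using that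
    proof (induction xs)
      case (Cons x xs)
      have "(\<one> \<ominus> k) \<otimes> x = x \<ominus> x \<otimes> k" if "x \<in> carrier R" for x
        using that k by Ring.algebra
      then show ?case using Cons k by (auto simp: r_distr minus_eq r_neg)
    qed (use k in auto)
    from this[of "ks @ [k]"] show ?thesis using that by (auto simp: sorted_wrt_append idempotents_def)
  qed
  have "(\<one> \<ominus> g) \<otimes> lsum R hs' = \<zero>" using le[of gs g] snoc.prems by simp
  then have "(\<one> \<ominus> g) \<otimes> h = \<zero>"
    using mult_idem_chain_zero[OF tf, of "\<one> \<ominus> g" hs'] snoc.prems c by (auto simp: hs')
  moreover have "(\<one> \<ominus> h) \<otimes> lsum R (gs @ [g]) = \<zero>"
    using le[of hs h] snoc.prems by (simp add: hs')
  then have "(\<one> \<ominus> h) \<otimes> g = \<zero>"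
    using mult_idem_chain_zero[OF tf, of "\<one> \<ominus> h" "gs @ [g]"] snoc.prems c by auto
  moreover have "(\<one> \<ominus> g) \<otimes> h = h \<ominus> g \<otimes> h" "(\<one> \<ominus> h) \<otimes> g = g \<ominus> g \<otimes> h"
    using c(1,2) by Ring.algebra+
  ultimately have "h \<ominus> g \<otimes> h = \<zero>" "g \<ominus> g \<otimes> h = \<zero>" by auto
  then have gh: "g = h" using c by (metis m_closed eq_if_minus_zero)
  have "lsum R gs \<oplus> g = lsum R hs \<oplus> g"
    using snoc.prems(6) c unfolding hs' gh by (simp add: lsum_append)
  then have "lsum R gs = lsum R hs" using c by simp
  then have "gs = hs"
    using snoc.prems by (intro snoc.IH) (auto simp: hs' sorted_wrt_append)
  then show ?case using gh hs' by simp
qed auto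

lemma mvn_iff_rtrace_eq:
  assumes exch: "exchange_ring R" and tf: "add_torsion_free R"
    and p: "p \<in> idempotent_matrices R" and q: "q \<in> idempotent_matrices R"
  shows "mvn R p q \<longleftrightarrow> rtrace R p = rtrace R q"
proof
  assume tr: "rtrace R p = rtrace R q"
  have z: "\<zero> \<in> idempotents R" by (simp add: idempotents_def)
  obtain es where es: "set es \<subseteq> idempotents R" "mvn R p (rdiag_list R es)"
    using idempotent_matrix_diagonalizable[OF exch p] by auto
  obtain fs where fs: "set fs \<subseteq> idempotents R" "mvn R q (rdiag_list R fs)"
    using idempotent_matrix_diagonalizable[OF exch q] by auto
  \<comment> \<open>Uniqueness requires chains of equal length, so each diagonal is padded with as
    many zeros as the other one has entries.\<close>
  have 1: "\<exists>hs. set hs \<subseteq> idempotents R \<and> idem_chain R hs \<and> length hs = m + length es \<and> mvn R p (rdiag_list R hs)"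
    if es: "set es \<subseteq> idempotents R" "mvn R p (rdiag_list R es)" and p: "p \<in> idempotent_matrices R" for es m p
  proof -
    have s: "set (replicate m \<zero> @ es) \<subseteq> idempotents R" using es z by auto
    obtain hs where hs: "set hs \<subseteq> idempotents R" "idem_chain R hs" "length hs = m + length es"
        "mvn R (rdiag_list R (replicate m \<zero> @ es)) (rdiag_list R hs)"
      using sort_idem_chain[OF s] by auto
    have mvn: "mvn R p (rdiag_list R (replicate m \<zero> @ es))"
      by (rule mvn_trans[OF p _ es(2) mvn_rdiag_list_zeros]) (use es s in \<open>auto intro!: rdiag_list_idempotent\<close>)
    have "mvn R p (rdiag_list R hs)"
      by (rule mvn_trans[OF p _ mvn hs(4)]) (use hs in \<open>auto intro!: rdiag_list_idempotent\<close>)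
    then show ?thesis using hs by auto
  qed
  obtain gs where gs: "set gs \<subseteq> idempotents R" "idem_chain R gs" "length gs = length fs + length es"
      "mvn R p (rdiag_list R gs)" using 1[OF es p] by blast
  obtain hs where hs: "set hs \<subseteq> idempotents R" "idem_chain R hs" "length hs = length es + length fs"
      "mvn R q (rdiag_list R hs)" using 1[OF fs q] by blast
  have "lsum R gs = lsum R hs"
    using rtrace_mvn[OF gs(4)] rtrace_mvn[OF hs(4)] tr gs(1) hs(1) idempotents_carrier
    by (simp add: rtrace_rdiag_list subset_trans)
  then have "gs = hs" using gs hs by (intro idem_chain_unique[OF tf]) auto
  then show "mvn R p q"
    using gs(4) hs(4) by (metis mvn_sym mvn_trans p q)
qed (rule rtrace_mvn)

end

section \<open>Equivalence and similarity of idempotents\<close>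

lemma (in ring) mvn_normalized:
  assumes p: "p \<in> idempotent_matrices R" and q: "q \<in> idempotent_matrices R" and "mvn R p q"
  obtains u v where "mat_over R u" "dim_row u = dim_row p" "dim_col u = dim_row q"
    "mat_over R v" "dim_row v = dim_row q" "dim_col v = dim_row p"
    "rmul R u v = p" "rmul R v u = q"
    "rmul R p u = u" "rmul R u q = u" "rmul R q v = v" "rmul R v p = v"
proof -
  obtain s t where st: "mat_over R s" "mat_over R t" "dim_col s = dim_row t" "dim_row s = dim_col t"
    and ps: "p = rmul R s t" and qt: "q = rmul R t s"
    using \<open>mvn R p q\<close> unfolding mvn_def by blast
  have d: "dim_row s = dim_row p" "dim_row t = dim_row q"
    using arg_cong[OF ps, of dim_row] arg_cong[OF qt, of dim_row] by auto
  have op: "mat_over R p" "dim_col p = dim_row p" "rmul R p p = p" and oq: "mat_over R q" "dim_col q = dim_row q" "rmul R q q = q"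
    using p q by (auto simp: mem_idempotent_matrices)
  have pp: "rmul R p (rmul R p x) = rmul R p x" if "mat_over R x" "dim_row x = dim_row p" for x
    using that op by (simp flip: rmul_assoc)
  have stx: "rmul R s (rmul R t x) = rmul R p x" if "mat_over R x" "dim_row x = dim_row p" for x
    using that d st by (simp add: ps[symmetric] flip: rmul_assoc)
  have tsx: "rmul R t (rmul R s x) = rmul R q x" if "mat_over R x" "dim_row x = dim_row q" for x
    using that d st by (simp add: qt[symmetric] flip: rmul_assoc)
  have tps: "rmul R t (rmul R p s) = q"
    using st d op oq by (subst ps) (simp add: rmul_assoc tsx qt[symmetric])
  \<comment> \<open>The idempotent \<open>p\<close> between the factors removes the parts of
    \<open>s\<close> and \<open>t\<close> outside the ranges of \<open>p\<close> and
    \<open>q\<close>. What remains is a pair of mutually inverse maps between these ranges.\<close>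
  show ?thesis
  proof (rule that[of "rmul R p s" "rmul R t p"])
    show "rmul R (rmul R p s) (rmul R t p) = p"
      using st d op by (simp add: rmul_assoc stx pp)
    show "rmul R (rmul R t p) (rmul R p s) = q"
      using st d op by (simp add: rmul_assoc pp tps)
    show "rmul R p (rmul R p s) = rmul R p s"
      using st d op by (simp add: pp)
    show "rmul R (rmul R p s) q = rmul R p s"
      using st d op oq by (subst qt) (simp add: rmul_assoc stx pp)
    show "rmul R q (rmul R t p) = rmul R t p"
      using st d op oq by (subst qt) (simp add: rmul_assoc stx pp)
    show "rmul R (rmul R t p) p = rmul R t p"
      using st d op by (simp add: rmul_assoc)
  qed (use st d op in auto)
qed

text \<open>\<open>u\<close> and \<open>v\<close> are inverse to each other only between the ranges.
  Padding to size \<open>k + l\<close> gives room for the complements \<open>p'\<close> and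
  \<open>q'\<close>, which complete them to invertible matrices.\<close>

lemma (in ring) mvn_imp_similar:
  assumes p: "p \<in> idempotent_matrices R" and q: "q \<in> idempotent_matrices R" and "mvn R p q"
  shows "(p, q) \<in> idempotent_similarity R"
proof -
  define k l where "k = dim_row p" and "l = dim_row q"
  have op: "mat_over R p" "dim_row p = k" "dim_col p = k" "rmul R p p = p" and oq: "mat_over R q" "dim_row q = l" "dim_col q = l" "rmul R q q = q"
    using p q by (auto simp: mem_idempotent_matrices k_def l_def)
  obtain u v where u: "mat_over R u" "dim_row u = k" "dim_col u = l"
    and v: "mat_over R v" "dim_row v = l" "dim_col v = k"
    and uv: "rmul R u v = p" "rmul R v u = q" "rmul R p u = u" "rmul R u q = u" "rmul R q v = v" "rmul R v p = v"
    using mvn_normalized[OF assms] unfolding k_def l_def by metis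
  have compl: "\<exists>p'. mat_over R p' \<and> dim_row p' = k \<and> dim_col p' = k \<and> rmul R p' p' = p' \<and> radd R p p' = rdiag R k \<one> \<and>
      rmul R p p' = rzero R k k \<and> rmul R p' p = rzero R k k"
    if "p \<in> idempotent_matrices R" "dim_row p = k" for p k
  proof -
    have o: "mat_over R p" "dim_row p = k" "dim_col p = k"
      using that by (auto simp: mem_idempotent_matrices)
    have "rdiag R k \<one> \<in> idempotent_matrices R" by (simp add: mem_idempotent_matrices)
    note c = idempotent_complement[OF this _ that] 
    show ?thesis
      using c o
      by (intro exI[of _ "mat k k (\<lambda>ij. rdiag R k \<one> $$ ij \<ominus> p $$ ij)"]) (auto simp: mem_idempotent_matrices)
  qed
  obtain p' where p': "mat_over R p'" "dim_row p' = k" "dim_col p' = k" "rmul R p' p' = p'" "radd R p p' = rdiag R k \<one>"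
      "rmul R p p' = rzero R k k" "rmul R p' p = rzero R k k"
    using compl[OF p op(2)] by blast
  obtain q' where q': "mat_over R q'" "dim_row q' = l" "dim_col q' = l" "rmul R q' q' = q'" "radd R q q' = rdiag R l \<one>"
      "rmul R q q' = rzero R l l" "rmul R q' q = rzero R l l"
    using compl[OF q oq(2)] by blast
  \<comment> \<open>Each normalized factor absorbs an idempotent on the side where its complement is
    applied, for instance \<open>v p' = v p p' = 0\<close>. These are the cross terms of the block
    products below.\<close>
  have z1: "rmul R v p' = rzero R l k"
    using rmul_assoc[of v p p'] v op p' by (simp add: uv)
  have z2: "rmul R p' u = rzero R k l"
    using rmul_assoc[of p' p u] u op p' by (simp add: uv)
  have z3: "rmul R u q' = rzero R k l"
    using rmul_assoc[of u q q'] u oq q' by (simp add: uv)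
  have z4: "rmul R q' v = rzero R l k"
    using rmul_assoc[of q' q v] v oq q' by (simp add: uv)
  \<comment> \<open>Conjugation by \<open>s\<close> carries one padded idempotent to the other; exchanging their roles
    gives its inverse.\<close>
  define s where "s = four_block_mat v q' p' u"
  define t where "t = four_block_mat u p' q' v"
  have so: "mat_over R s" "dim_row s = k + l" "dim_col s = k + l"
    using u v p' q' by (auto simp: s_def intro!: mat_over_four_block)
  have to: "mat_over R t" "dim_row t = k + l" "dim_col t = k + l"
    using u v p' q' by (auto simp: t_def intro!: mat_over_four_block)
  have c: "u \<in> carrier_mat k l" "v \<in> carrier_mat l k" "p \<in> carrier_mat k k" "q \<in> carrier_mat l l"
    "p' \<in> carrier_mat k k" "q' \<in> carrier_mat l l" "\<And>i j. rzero R i j \<in> carrier_mat i j"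
    using u v op oq p' q' by auto
  have one: "four_block_mat (rdiag R i \<one>) (rzero R i j) (rzero R j i) (rdiag R j \<one>) = rdiag R (i + j) \<one>" for i j
    by (rule eq_matI) auto
  have add1: "radd R p' p = rdiag R k \<one>" "radd R q' q = rdiag R l \<one>"
    using p' q' op oq radd_comm by metis+
  have st: "rmul R s t = rdiag R (l + k) \<one>"
    unfolding s_def t_def
    by (subst rmul_four_block[OF v(1) q'(1) p'(1) u(1) u(1) p'(1) q'(1) v(1) c(2) c(6) c(5) c(1) c(1) c(5) c(6) c(2)])
      (use u v p' q' op oq in \<open>simp add: uv z1 z2 z3 z4 add1 one\<close>)
  have ts: "rmul R t s = rdiag R (k + l) \<one>"
    unfolding s_def t_def
    by (subst rmul_four_block[OF u(1) p'(1) q'(1) v(1) v(1) q'(1) p'(1) u(1) c(1) c(5) c(6) c(2) c(2) c(6) c(5) c(1)])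
      (use u v p' q' op oq in \<open>simp add: uv z1 z2 z3 z4 add1 one\<close>)
  let ?P = "direct_sum_mat R p (rzero R l l)" and ?Q = "direct_sum_mat R q (rzero R k k)"
  have sP: "rmul R s ?P = four_block_mat v (rzero R l l) (rzero R k k) (rzero R k l)"
    unfolding s_def direct_sum_mat_four_block dim_rzero op
    by (subst rmul_four_block[OF v(1) q'(1) p'(1) u(1) op(1) _ _ _ c(2) c(6) c(5) c(1) c(3) c(7) c(7) c(7)])
      (use u v p' q' op oq in \<open>simp_all add: uv\<close>)
  have sPt: "rmul R (rmul R s ?P) t = ?Q"
    unfolding sP t_def
    by (subst rmul_four_block[OF v(1) _ _ _ u(1) p'(1) q'(1) v(1) c(2) c(7) c(7) c(7) c(1) c(5) c(6) c(2)])
      (use u v p' q' op oq in \<open>simp_all add: uv z1 direct_sum_mat_four_block\<close>)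
  let ?M = "matrix_ring R (k + l)"
  interpret M: ring ?M by (rule ring_matrix_ring)
  have sM: "s \<in> carrier ?M" and tM: "t \<in> carrier ?M" and PM: "?P \<in> carrier ?M" and sPM: "rmul R s ?P \<in> carrier ?M"
    using so to op by (auto simp: mem_carrier_matrix_ring)
  have st': "s \<otimes>\<^bsub>?M\<^esub> t = \<one>\<^bsub>?M\<^esub>" and ts': "t \<otimes>\<^bsub>?M\<^esub> s = \<one>\<^bsub>?M\<^esub>"
    using sM tM st ts by (simp_all add: matrix_ring_mult matrix_ring_one add.commute)
  have sU: "s \<in> Units ?M" using sM tM st' ts' by (auto simp: Units_def)
  have inv: "inv\<^bsub>?M\<^esub> s = t" using sM tM st' ts' by (intro M.inv_char) auto
  have "?Q = s \<otimes>\<^bsub>?M\<^esub> ?P \<otimes>\<^bsub>?M\<^esub> inv\<^bsub>?M\<^esub> s"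
    unfolding inv using sM tM PM sPM sPt by (simp add: matrix_ring_mult)
  then have sim: "similar_over R (k + l) ?P ?Q" using sU unfolding similar_over_def by blast
  have "\<exists>i j. dim_row p + i = dim_row q + j \<and>
      similar_over R (dim_row p + i) (direct_sum_mat R p (rzero R i i)) (direct_sum_mat R q (rzero R j j))"
    by (rule exI[of _ l], rule exI[of _ k]) (use sim op oq in simp)
  then show ?thesis using p q by (simp add: idempotent_similarity_def matrix_ring_zero)
qed

lemma (in cring) similar_imp_rtrace_eq:
  assumes "(p, q) \<in> idempotent_similarity R"
  shows "rtrace R p = rtrace R q"
proof -
  obtain k l where p: "p \<in> idempotent_matrices R" and q: "q \<in> idempotent_matrices R"
    and kl: "dim_row p + k = dim_row q + l"
    and sim: "similar_over R (dim_row p + k) (direct_sum_mat R p (rzero R k k)) (direct_sum_mat R q (rzero R l l))"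
      (is "similar_over R ?n ?P ?Q")
    using assms unfolding idempotent_similarity_def by (auto simp: matrix_ring_zero)
  let ?M = "matrix_ring R ?n"
  interpret M: ring ?M by (rule ring_matrix_ring)
  obtain s where s: "s \<in> Units ?M" and Q: "?Q = s \<otimes>\<^bsub>?M\<^esub> ?P \<otimes>\<^bsub>?M\<^esub> inv\<^bsub>?M\<^esub> s"
    using sim unfolding similar_over_def by blast
  have op: "mat_over R p" "dim_col p = dim_row p" and oq: "mat_over R q" "dim_col q = dim_row q"
    using p q by (auto simp: mem_idempotent_matrices)
  define t where "t = inv\<^bsub>?M\<^esub> s"
  have sM: "s \<in> carrier ?M" and tM: "t \<in> carrier ?M" and ts: "t \<otimes>\<^bsub>?M\<^esub> s = \<one>\<^bsub>?M\<^esub>"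
    using s by (auto simp: t_def)
  have PM: "?P \<in> carrier ?M" using op by (simp add: mem_carrier_matrix_ring)
  have sPM: "rmul R s ?P \<in> carrier ?M"
    using sM PM by (auto simp: mem_carrier_matrix_ring)
  have o: "mat_over R s" "dim_row s = ?n" "dim_col s = ?n" "mat_over R t" "dim_row t = ?n" "dim_col t = ?n"
      "mat_over R ?P" "dim_row ?P = ?n" "dim_col ?P = ?n"
    using sM tM PM by (simp_all only: mem_carrier_matrix_ring)
  have Q': "?Q = rmul R (rmul R s ?P) t"
    using Q sM tM PM sPM by (simp add: matrix_ring_mult t_def)
  have ts': "rmul R t s = rdiag R ?n \<one>"
    using ts sM tM by (simp add: matrix_ring_mult matrix_ring_one)
  have "rtrace R ?Q = rtrace R (rmul R t (rmul R s ?P))"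
    unfolding Q' using o by (intro rtrace_rmul_commute mat_over_rmul) (simp_all only: dim_rmul)
  also have "rmul R t (rmul R s ?P) = rmul R (rmul R t s) ?P"
    using o by (intro rmul_assoc[symmetric]) (simp_all only:)
  also have "\<dots> = ?P" unfolding ts' using o by (intro rmul_rdiag_one) (simp_all only:)
  finally have "rtrace R ?Q = rtrace R ?P" .
  moreover have "rtrace R (rzero R i i) = \<zero>" for i
    unfolding rtrace_def by (rule finsum_lessThan_zero) simp
  ultimately show ?thesis using op oq by (simp add: rtrace_direct_sum)
qed

text \<open>This closes a circle: similarity preserves the trace, equal traces give equivalence, and
  equivalence gives similarity after padding. That similarity with varying padding is transitive
  comes out as a by-product.\<close>

theorem (in cring) idempotent_similarity_iff:
  assumes "exchange_ring R" "add_torsion_free R"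
  shows "(p, q) \<in> idempotent_similarity R \<longleftrightarrow>
    p \<in> idempotent_matrices R \<and> q \<in> idempotent_matrices R \<and> rtrace R p = rtrace R q"
  using similar_imp_rtrace_eq[of p q] mvn_imp_similar[of p q] mvn_iff_rtrace_eq[OF assms, of p q]
  by (auto simp: idempotent_similarity_def)

section \<open>The Grothendieck group\<close>

text \<open>\<^term>\<open>G\<close> need not be known to be a monoid: the structure is transported along \<^term>\<open>\<nu>\<close>.\<close>

lemma grothendieck_group_iso:
  assumes H: "comm_group H" and hom: "\<nu> \<in> hom G H" and inj: "inj_on \<nu> (carrier G)"
    and one: "\<one>\<^bsub>G\<^esub> \<in> carrier G" "\<nu> \<one>\<^bsub>G\<^esub> = \<one>\<^bsub>H\<^esub>"
    and closed: "\<And>a b. a \<in> carrier G \<Longrightarrow> b \<in> carrier G \<Longrightarrow> a \<otimes>\<^bsub>G\<^esub> b \<in> carrier G"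
  shows "grothendieck_group G \<cong> subgroup_generated H (\<nu> ` carrier G)"
proof -
  interpret H: comm_group H by (rule H)
  \<comment> \<open>The formal difference of a pair becomes an actual difference in the group
    \<open>H\<close>.\<close>
  define \<delta> where "\<delta> = (\<lambda>(a, b). \<nu> a \<otimes>\<^bsub>H\<^esub> inv\<^bsub>H\<^esub> \<nu> b)"
  let ?P = "carrier G \<times> carrier G" and ?r = "grothendieck_rel G"
  have \<nu>: "\<nu> a \<in> carrier H" if "a \<in> carrier G" for a
    using hom that by (auto simp: hom_def)
  have \<nu>_mult: "\<nu> (a \<otimes>\<^bsub>G\<^esub> b) = \<nu> a \<otimes>\<^bsub>H\<^esub> \<nu> b" if "a \<in> carrier G" "b \<in> carrier G" for a b
    using hom that by (auto simp: hom_def)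
  have \<delta>_closed: "\<delta> x \<in> carrier H" if "x \<in> ?P" for x
    using that \<nu> by (auto simp: \<delta>_def)
  have frac: "x \<otimes>\<^bsub>H\<^esub> inv\<^bsub>H\<^esub> y = z \<otimes>\<^bsub>H\<^esub> inv\<^bsub>H\<^esub> w \<longleftrightarrow> x \<otimes>\<^bsub>H\<^esub> w = z \<otimes>\<^bsub>H\<^esub> y"
    if "x \<in> carrier H" "y \<in> carrier H" "z \<in> carrier H" "w \<in> carrier H" for x y z w
  proof
    assume *: "x \<otimes>\<^bsub>H\<^esub> inv\<^bsub>H\<^esub> y = z \<otimes>\<^bsub>H\<^esub> inv\<^bsub>H\<^esub> w"
    have "x \<otimes>\<^bsub>H\<^esub> w = (x \<otimes>\<^bsub>H\<^esub> inv\<^bsub>H\<^esub> y) \<otimes>\<^bsub>H\<^esub> (w \<otimes>\<^bsub>H\<^esub> y)"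
      using that by (simp add: H.m_ac)
    also have "\<dots> = z \<otimes>\<^bsub>H\<^esub> (inv\<^bsub>H\<^esub> w \<otimes>\<^bsub>H\<^esub> w) \<otimes>\<^bsub>H\<^esub> y"
      unfolding * using that by (simp only: H.m_assoc H.inv_closed H.m_closed)
    finally show "x \<otimes>\<^bsub>H\<^esub> w = z \<otimes>\<^bsub>H\<^esub> y" using that by simp
  next
    assume *: "x \<otimes>\<^bsub>H\<^esub> w = z \<otimes>\<^bsub>H\<^esub> y"
    have "x \<otimes>\<^bsub>H\<^esub> inv\<^bsub>H\<^esub> y = (x \<otimes>\<^bsub>H\<^esub> w) \<otimes>\<^bsub>H\<^esub> inv\<^bsub>H\<^esub> w \<otimes>\<^bsub>H\<^esub> inv\<^bsub>H\<^esub> y"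
      using that by (simp add: H.m_assoc)
    also have "\<dots> = z \<otimes>\<^bsub>H\<^esub> inv\<^bsub>H\<^esub> w \<otimes>\<^bsub>H\<^esub> (y \<otimes>\<^bsub>H\<^esub> inv\<^bsub>H\<^esub> y)"
      unfolding * using that by (simp only: H.m_ac H.inv_closed H.m_closed)
    finally show "x \<otimes>\<^bsub>H\<^esub> inv\<^bsub>H\<^esub> y = z \<otimes>\<^bsub>H\<^esub> inv\<^bsub>H\<^esub> w"
      using that by simp
  qed
  \<comment> \<open>The stabilizing summand \<open>e\<close> cancels in \<open>H\<close>, and
    injectivity of \<open>\<nu>\<close> brings equations back to \<open>G\<close>; so
    \<open>\<delta>\<close> separates exactly the classes.\<close>
  have rel: "(x, y) \<in> ?r \<longleftrightarrow> x \<in> ?P \<and> y \<in> ?P \<and> \<delta> x = \<delta> y" for x y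
  proof -
    obtain a b c d where xy: "x = (a, b)" "y = (c, d)" by fastforce
    have "(\<exists>e\<in>carrier G. a \<otimes>\<^bsub>G\<^esub> d \<otimes>\<^bsub>G\<^esub> e = c \<otimes>\<^bsub>G\<^esub> b \<otimes>\<^bsub>G\<^esub> e) \<longleftrightarrow> \<delta> x = \<delta> y"
      if G: "a \<in> carrier G" "b \<in> carrier G" "c \<in> carrier G" "d \<in> carrier G"
    proof -
      have "a \<otimes>\<^bsub>G\<^esub> d \<otimes>\<^bsub>G\<^esub> e = c \<otimes>\<^bsub>G\<^esub> b \<otimes>\<^bsub>G\<^esub> e \<longleftrightarrow> \<nu> a \<otimes>\<^bsub>H\<^esub> \<nu> d = \<nu> c \<otimes>\<^bsub>H\<^esub> \<nu> b" if "e \<in> carrier G" for e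
      proof -
        have "a \<otimes>\<^bsub>G\<^esub> d \<otimes>\<^bsub>G\<^esub> e = c \<otimes>\<^bsub>G\<^esub> b \<otimes>\<^bsub>G\<^esub> e \<longleftrightarrow> \<nu> (a \<otimes>\<^bsub>G\<^esub> d \<otimes>\<^bsub>G\<^esub> e) = \<nu> (c \<otimes>\<^bsub>G\<^esub> b \<otimes>\<^bsub>G\<^esub> e)"
          using G that closed inj_onD[OF inj] by metis
        then show ?thesis using G that closed \<nu> by (simp add: \<nu>_mult)
      qed
      then show ?thesis
        using one(1) frac[of "\<nu> a" "\<nu> b" "\<nu> c" "\<nu> d"] G \<nu>
        by (auto simp: xy \<delta>_def)
    qed
    then show ?thesis unfolding xy grothendieck_rel_def by auto
  qed
  have equiv: "equiv ?P ?r"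
    unfolding equiv_def refl_on_def sym_def trans_def by (auto simp: rel)
  have rel_sub: "?r \<subseteq> ?P \<times> ?P" by (auto simp: rel)
  have class_eq: "?r `` {x} = ?r `` {y} \<longleftrightarrow> \<delta> x = \<delta> y" if "x \<in> ?P" "y \<in> ?P" for x y
    using eq_equiv_class_iff[OF equiv that] rel that by blast
  define F where "F X = \<delta> (SOME x. x \<in> X)" for X
  have F: "F (?r `` {x}) = \<delta> x" if "x \<in> ?P" for x
  proof -
    have "x \<in> ?r `` {x}" using that by (simp add: rel)
    then have "(SOME y. y \<in> ?r `` {x}) \<in> ?r `` {x}" by (rule someI)
    moreover have "\<delta> y = \<delta> x" if "y \<in> ?r `` {x}" for y using that by (simp add: rel)
    ultimately show ?thesis unfolding F_def by blast
  qed
  have mult: "?r `` {(a, b)} \<otimes>\<^bsub>grothendieck_group G\<^esub> ?r `` {(c, d)} = ?r `` {(a \<otimes>\<^bsub>G\<^esub> c, b \<otimes>\<^bsub>G\<^esub> d)}"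
    if "(a, b) \<in> ?P" "(c, d) \<in> ?P" for a b c d
  proof -
    have \<delta>_mult: "\<delta> (a \<otimes>\<^bsub>G\<^esub> c, b \<otimes>\<^bsub>G\<^esub> d) = \<delta> (a, b) \<otimes>\<^bsub>H\<^esub> \<delta> (c, d)" if "(a, b) \<in> ?P" "(c, d) \<in> ?P" for a b c d
      using that \<nu> by (auto simp: \<delta>_def \<nu>_mult H.inv_mult H.m_ac)
    let ?X = "?r `` {(a, b)}" and ?Y = "?r `` {(c, d)}" and ?Z = "?r `` {(a \<otimes>\<^bsub>G\<^esub> c, b \<otimes>\<^bsub>G\<^esub> d)}"
    have const: "?r `` {(a' \<otimes>\<^bsub>G\<^esub> c', b' \<otimes>\<^bsub>G\<^esub> d')} = ?r `` {(a \<otimes>\<^bsub>G\<^esub> c, b \<otimes>\<^bsub>G\<^esub> d)}"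
      if "(a', b') \<in> ?r `` {(a, b)}" "(c', d') \<in> ?r `` {(c, d)}" for a' b' c' d'
      using that closed by (subst class_eq) (auto simp: rel \<delta>_mult)
    have mem: "(a, b) \<in> ?X" "(c, d) \<in> ?Y" using that by (auto simp: rel)
    have "(\<Union>(c', d')\<in>?Y. ?r `` {(a' \<otimes>\<^bsub>G\<^esub> c', b' \<otimes>\<^bsub>G\<^esub> d')}) = ?Z" if "(a', b') \<in> ?X" for a' b'
      by (rule UN_constant_eq[OF mem(2)]) (use const that in blast)
    then have "(\<Union>(a', b')\<in>?X. \<Union>(c', d')\<in>?Y. ?r `` {(a' \<otimes>\<^bsub>G\<^esub> c', b' \<otimes>\<^bsub>G\<^esub> d')}) = ?Z"
      by (intro UN_constant_eq[OF mem(1)]) blast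
    then show ?thesis by (simp add: grothendieck_group_def)
  qed
  \<comment> \<open>The image of \<open>\<nu>\<close> contains the unit and is closed under
    products, so in the commutative group \<open>H\<close> its differences already form the
    generated subgroup.\<close>
  have gen: "generate H (\<nu> ` carrier G) = \<delta> ` ?P"
  proof
    show "generate H (\<nu> ` carrier G) \<subseteq> \<delta> ` ?P"
    proof
      fix h assume "h \<in> generate H (\<nu> ` carrier G)"
      then show "h \<in> \<delta> ` ?P"
      proof (induction rule: generate.induct)
        case one
        show ?case
          using assms(4,5) by (intro image_eqI[of _ _ "(\<one>\<^bsub>G\<^esub>, \<one>\<^bsub>G\<^esub>)"]) (auto simp: \<delta>_def)
      next
        case (incl h)
        then obtain a where "a \<in> carrier G" "h = \<nu> a" by auto
        then show ?case
          using assms(4,5) \<nu> by (intro image_eqI[of _ _ "(a, \<one>\<^bsub>G\<^esub>)"]) (auto simp: \<delta>_def)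
      next
        case (inv h)
        then obtain a where "a \<in> carrier G" "h = \<nu> a" by auto
        then show ?case
          using assms(4,5) \<nu> by (intro image_eqI[of _ _ "(\<one>\<^bsub>G\<^esub>, a)"]) (auto simp: \<delta>_def)
      next
        case (eng h k)
        then obtain a b c d where "h = \<delta> (a, b)" "k = \<delta> (c, d)" "(a, b) \<in> ?P" "(c, d) \<in> ?P"
          by fastforce
        then show ?case
          using closed \<nu>
          by (intro image_eqI[of _ _ "(a \<otimes>\<^bsub>G\<^esub> c, b \<otimes>\<^bsub>G\<^esub> d)"])
            (auto simp: \<delta>_def \<nu>_mult H.inv_mult H.m_ac)
      qed
    qed
    show "\<delta> ` ?P \<subseteq> generate H (\<nu> ` carrier G)"
    proof clarify
      fix a b assume ab: "a \<in> carrier G" "b \<in> carrier G"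
      have "\<nu> a \<in> generate H (\<nu> ` carrier G)" "inv\<^bsub>H\<^esub> \<nu> b \<in> generate H (\<nu> ` carrier G)"
        using ab by (auto intro: generate.incl generate.inv)
      then show "\<delta> (a, b) \<in> generate H (\<nu> ` carrier G)"
        by (simp add: \<delta>_def generate.eng)
    qed
  qed
  have carr: "carrier (subgroup_generated H (\<nu> ` carrier G)) = \<delta> ` ?P"
  proof -
    have "carrier H \<inter> \<nu> ` carrier G = \<nu> ` carrier G" using \<nu> by auto
    then show ?thesis by (simp add: carrier_subgroup_generated gen)
  qed
  have carr_K: "carrier (grothendieck_group G) = ?P // ?r" by (simp add: grothendieck_group_def)
  have "F \<in> iso (grothendieck_group G) (subgroup_generated H (\<nu> ` carrier G))"
  proof (rule isoI)
    show "F \<in> hom (grothendieck_group G) (subgroup_generated H (\<nu> ` carrier G))"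
    proof (rule homI)
      fix X assume "X \<in> carrier (grothendieck_group G)"
      then obtain x where "x \<in> ?P" "X = ?r `` {x}" unfolding carr_K by (auto elim: quotientE)
      then show "F X \<in> carrier (subgroup_generated H (\<nu> ` carrier G))" using F carr by auto
    next
      fix X Y assume "X \<in> carrier (grothendieck_group G)" "Y \<in> carrier (grothendieck_group G)"
      then obtain a b c d where ab: "(a, b) \<in> ?P" "X = ?r `` {(a, b)}" and cd: "(c, d) \<in> ?P" "Y = ?r `` {(c, d)}"
        unfolding carr_K by (auto elim!: quotientE)
      have "F (X \<otimes>\<^bsub>grothendieck_group G\<^esub> Y) = \<delta> (a \<otimes>\<^bsub>G\<^esub> c, b \<otimes>\<^bsub>G\<^esub> d)"
        using ab cd closed by (simp add: mult F)
      also have "\<dots> = F X \<otimes>\<^bsub>H\<^esub> F Y"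
        using ab cd \<nu> by (auto simp: F \<delta>_def \<nu>_mult H.inv_mult H.m_ac)
      finally show "F (X \<otimes>\<^bsub>grothendieck_group G\<^esub> Y) = F X \<otimes>\<^bsub>subgroup_generated H (\<nu> ` carrier G)\<^esub> F Y"
        by simp
    qed
    have "inj_on F (?P // ?r)"
    proof (rule inj_onI)
      fix X Y assume "X \<in> ?P // ?r" "Y \<in> ?P // ?r" and FXY: "F X = F Y"
      then obtain x y where "x \<in> ?P" "X = ?r `` {x}" "y \<in> ?P" "Y = ?r `` {y}"
        by (auto elim!: quotientE)
      then show "X = Y" using FXY F class_eq by metis
    qed
    moreover have "F ` (?P // ?r) = (\<lambda>x. F (?r `` {x})) ` ?P"
      unfolding quotient_def by blast
    moreover have "\<dots> = \<delta> ` ?P" by (rule image_cong[OF refl F])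
    ultimately show "bij_betw F (carrier (grothendieck_group G)) (carrier (subgroup_generated H (\<nu> ` carrier G)))"
      unfolding bij_betw_def carr carr_K by simp
  qed
  then show ?thesis by (rule is_isoI)
qed

theorem (in cring) K0_iso_idempotents:
  assumes exch: "exchange_ring R" and tf: "add_torsion_free R"
  shows "K0 R \<cong> subgroup_generated (add_monoid R) (idempotents R)"
proof -
  let ?I = "idempotent_matrices R" and ?r = "idempotent_similarity R" and ?V = "idempotent_semigroup R"
  note sim = idempotent_similarity_iff[OF exch tf]
  have equiv: "equiv ?I ?r"
    unfolding equiv_def refl_on_def sym_def trans_def by (auto simp: sim)
  have class_eq: "?r `` {p} = ?r `` {q} \<longleftrightarrow> rtrace R p = rtrace R q" if "p \<in> ?I" "q \<in> ?I" for p q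
    using eq_equiv_class_iff[OF equiv that] sim that by blast
  define \<nu> where "\<nu> X = rtrace R (SOME p. p \<in> X)" for X
  have \<nu>: "\<nu> (?r `` {p}) = rtrace R p" if "p \<in> ?I" for p
  proof -
    have "p \<in> ?r `` {p}" using that by (simp add: sim)
    then have "(SOME q. q \<in> ?r `` {p}) \<in> ?r `` {p}" by (rule someI)
    then show ?thesis
      unfolding \<nu>_def by (intro similar_imp_rtrace_eq[symmetric] Image_singleton_iff[THEN iffD1])
  qed
  have tr_sum: "rtrace R (direct_sum_mat R p q) = rtrace R p \<oplus> rtrace R q" if "p \<in> ?I" "q \<in> ?I" for p q
    using that by (simp add: mem_idempotent_matrices rtrace_direct_sum)
  have carr: "carrier ?V = ?I // ?r" by (simp add: idempotent_semigroup_def)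
  have mult: "?r `` {p} \<otimes>\<^bsub>?V\<^esub> ?r `` {q} = ?r `` {direct_sum_mat R p q}" if "p \<in> ?I" "q \<in> ?I" for p q
  proof -
    have const: "?r `` {direct_sum_mat R p' q'} = ?r `` {direct_sum_mat R p q}"
      if "p' \<in> ?r `` {p}" "q' \<in> ?r `` {q}" for p' q'
      using that direct_sum_idempotent by (subst class_eq) (auto simp: sim tr_sum)
    have mem: "p \<in> ?r `` {p}" "q \<in> ?r `` {q}" using that by (auto simp: sim)
    have "(\<Union>q'\<in>?r `` {q}. ?r `` {direct_sum_mat R p' q'}) = ?r `` {direct_sum_mat R p q}" if "p' \<in> ?r `` {p}" for p'
      by (rule UN_constant_eq[OF mem(2)]) (use const that in blast)
    then have "(\<Union>p'\<in>?r `` {p}. \<Union>q'\<in>?r `` {q}. ?r `` {direct_sum_mat R p' q'}) = ?r `` {direct_sum_mat R p q}"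
      by (intro UN_constant_eq[OF mem(1)]) blast
    then show ?thesis by (simp add: idempotent_semigroup_def)
  qed
  have z: "rzero R 0 0 \<in> ?I" "rtrace R (rzero R 0 0) = \<zero>"
    by (auto simp: mem_idempotent_matrices rtrace_def)
  have one: "\<one>\<^bsub>?V\<^esub> = ?r `` {rzero R 0 0}"
    by (simp add: idempotent_semigroup_def matrix_ring_zero)
  have "K0 R \<cong> subgroup_generated (add_monoid R) (\<nu> ` carrier ?V)"
    unfolding K0_def
  proof (rule grothendieck_group_iso)
    show "comm_group (add_monoid R)" by (rule a_comm_group)
    show "\<nu> \<in> hom ?V (add_monoid R)"
    proof (rule homI)
      fix X assume "X \<in> carrier ?V"
      then obtain p where "p \<in> ?I" "X = ?r `` {p}" unfolding carr by (auto elim: quotientE)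
      then show "\<nu> X \<in> carrier (add_monoid R)" by (simp add: \<nu> mem_idempotent_matrices)
    next
      fix X Y assume "X \<in> carrier ?V" "Y \<in> carrier ?V"
      then obtain p q where "p \<in> ?I" "X = ?r `` {p}" "q \<in> ?I" "Y = ?r `` {q}"
        unfolding carr by (auto elim!: quotientE)
      then show "\<nu> (X \<otimes>\<^bsub>?V\<^esub> Y) = \<nu> X \<otimes>\<^bsub>add_monoid R\<^esub> \<nu> Y"
        by (simp add: mult \<nu> direct_sum_idempotent tr_sum)
    qed
    show "inj_on \<nu> (carrier ?V)"
    proof (rule inj_onI)
      fix X Y assume "X \<in> carrier ?V" "Y \<in> carrier ?V" and eq: "\<nu> X = \<nu> Y"
      then obtain p q where "p \<in> ?I" "X = ?r `` {p}" "q \<in> ?I" "Y = ?r `` {q}"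
        unfolding carr by (auto elim!: quotientE)
      then show "X = Y" using eq \<nu> class_eq by metis
    qed
    show "\<one>\<^bsub>?V\<^esub> \<in> carrier ?V"
      unfolding one carr using z by (auto intro: quotientI)
    show "\<nu> \<one>\<^bsub>?V\<^esub> = \<one>\<^bsub>add_monoid R\<^esub>"
      unfolding one using z by (simp add: \<nu>)
    show "X \<otimes>\<^bsub>?V\<^esub> Y \<in> carrier ?V" if "X \<in> carrier ?V" "Y \<in> carrier ?V" for X Y
      using that unfolding carr
      by (auto elim!: quotientE simp: mult direct_sum_idempotent intro!: quotientI)
  qed
  \<comment> \<open>Traces and idempotents generate the same subgroup: after diagonalization a trace
    is a sum of idempotents, and an idempotent is the trace of a 1 by 1 matrix.\<close>
  moreover have "generate (add_monoid R) (\<nu> ` carrier ?V) = generate (add_monoid R) (idempotents R)"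
  proof
    have gen: "lsum R es \<in> generate (add_monoid R) (idempotents R)" if "set es \<subseteq> idempotents R" for es
      using that
    proof (induction es)
      case Nil
      show ?case using generate.one[of "add_monoid R"] by simp
    next
      case (Cons e es)
      then show ?case
        using generate.eng[of e "add_monoid R" _ "lsum R es"] generate.incl[of e _ "add_monoid R"]
        by simp
    qed
    have "\<nu> X \<in> generate (add_monoid R) (idempotents R)" if X: "X \<in> carrier ?V" for X
    proof -
      obtain p where p: "p \<in> ?I" "X = ?r `` {p}" using X unfolding carr by (auto elim: quotientE)
      obtain es where es: "set es \<subseteq> idempotents R" "mvn R p (rdiag_list R es)"
        using idempotent_matrix_diagonalizable[OF exch p(1)] by auto
      have "\<nu> X = lsum R es"
        using p rtrace_mvn[OF es(2)] es(1) idempotents_carrier by (simp add: \<nu> rtrace_rdiag_list)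
      then show ?thesis using gen[OF es(1)] by simp
    qed
    then have "\<nu> ` carrier ?V \<subseteq> generate (add_monoid R) (idempotents R)"
      by (rule image_subsetI)
    then show "generate (add_monoid R) (\<nu> ` carrier ?V) \<subseteq> generate (add_monoid R) (idempotents R)"
      using idempotents_carrier by (intro add.generate_subgroup_incl add.generate_is_subgroup) auto
    have "e \<in> \<nu> ` carrier ?V" if "e \<in> idempotents R" for e
    proof -
      have "rdiag_list R [e] \<in> ?I" using that by (intro rdiag_list_idempotent) auto
      moreover from this have "\<nu> (?r `` {rdiag_list R [e]}) = e"
        using that idempotents_carrier by (subst \<nu>) (auto simp: rtrace_rdiag_list)
      ultimately show ?thesis unfolding carr by (metis imageI quotientI)
    qed
    then show "generate (add_monoid R) (idempotents R) \<subseteq> generate (add_monoid R) (\<nu> ` carrier ?V)"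
      by (intro add.mono_generate) auto
  qed
  moreover have "\<nu> ` carrier ?V \<subseteq> carrier R"
    unfolding carr by (auto elim!: quotientE simp: \<nu> mem_idempotent_matrices)
  ultimately show ?thesis
    using idempotents_carrier by (simp add: subgroup_generated_def Int_absorb1)
qed

section \<open>The centralizer of a cyclic nilpotent matrix\<close>

definition non_zero_divisor :: "('a, 'b) ring_scheme \<Rightarrow> 'a \<Rightarrow> bool" where
  "non_zero_divisor R a \<longleftrightarrow> a \<in> carrier R \<and> (\<forall>x\<in>carrier R. a \<otimes>\<^bsub>R\<^esub> x = \<zero>\<^bsub>R\<^esub> \<longrightarrow> x = \<zero>\<^bsub>R\<^esub>)"

lemma non_zero_divisorD:
  "non_zero_divisor R a \<Longrightarrow> a \<in> carrier R"
  "non_zero_divisor R a \<Longrightarrow> x \<in> carrier R \<Longrightarrow> a \<otimes>\<^bsub>R\<^esub> x = \<zero>\<^bsub>R\<^esub> \<Longrightarrow> x = \<zero>\<^bsub>R\<^esub>"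
  unfolding non_zero_divisor_def by blast+

context cring
begin

section \<open>Units, exchange and idempotents modulo nilpotents\<close>

lemma non_zero_divisor_mult:
  "non_zero_divisor R a \<Longrightarrow> non_zero_divisor R b \<Longrightarrow> non_zero_divisor R (a \<otimes> b)"
  unfolding non_zero_divisor_def by (metis m_assoc m_closed)

text \<open>The geometric series in \<open>z = - y\<close>; the induction on \<open>k\<close> builds
  its partial sums, and at \<open>k = m\<close> the error term is zero.\<close>

lemma one_plus_nilpotent_unit:
  assumes y: "y \<in> carrier R" and nil: "y [^] (m::nat) = \<zero>"
  obtains w where "w \<in> carrier R" "(\<one> \<oplus> y) \<otimes> w = \<one>"
proof -
  define z where "z = \<ominus> y"
  have z: "z \<in> carrier R" using y by (simp add: z_def)
  have "\<exists>w\<in>carrier R. (\<one> \<ominus> z) \<otimes> w = \<one> \<ominus> z [^] k" for k :: nat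
  proof (induction k)
    case 0
    show ?case by (rule bexI[of _ \<zero>]) (use z in \<open>simp_all add: minus_eq r_neg\<close>)
  next
    case (Suc k)
    then obtain w where w: "w \<in> carrier R" "(\<one> \<ominus> z) \<otimes> w = \<one> \<ominus> z [^] k"
      by blast
    have *: "(\<one> \<ominus> z) \<otimes> (w \<oplus> x) = \<one> \<ominus> x \<otimes> z" if "x \<in> carrier R" "(\<one> \<ominus> z) \<otimes> w = \<one> \<ominus> x" for x
    proof -
      have "(\<one> \<ominus> z) \<otimes> (w \<oplus> x) = (\<one> \<ominus> z) \<otimes> w \<oplus> (x \<ominus> x \<otimes> z)"
        using z w(1) that(1) by Ring.algebra
      also have "\<dots> = \<one> \<ominus> x \<oplus> (x \<ominus> x \<otimes> z)" unfolding that(2) ..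
      also have "\<dots> = \<one> \<ominus> x \<otimes> z" using z that(1) by Ring.algebra
      finally show ?thesis .
    qed
    show ?case using *[of "z [^] k"] w z by (intro bexI[of _ "w \<oplus> z [^] k"]) simp_all
  qed
  from this[of m] obtain w where w: "w \<in> carrier R" "(\<one> \<ominus> z) \<otimes> w = \<one> \<ominus> z [^] m"
    by blast
  have "z = \<ominus> \<one> \<otimes> y" using y by (simp add: z_def l_minus)
  then have "z [^] m = \<zero>" using y nil by (simp add: nat_pow_distrib)
  moreover have "\<one> \<ominus> z = \<one> \<oplus> y" using y by (simp add: z_def minus_eq)
  ultimately show ?thesis using w that by (simp add: minus_eq)
qed

text \<open>The idempotent \<open>e\<close> that works for \<open>d\<close> works unchanged for
  \<open>x\<close>. With \<open>y = (x - d) b\<close> one gets \<open>x b e = e (1 + y)\<close>, and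
  \<open>1 + y\<close> is a unit because \<open>y\<close> is nilpotent. The other half is the same
  argument for \<open>1 - x\<close>, which differs from \<open>1 - d\<close> by
  \<open>- (x - d)\<close>.\<close>

lemma exchange_ring_lift:
  assumes lift: "\<And>x. x \<in> carrier R \<Longrightarrow> \<exists>d\<in>carrier R. \<exists>e\<in>idempotents R. \<exists>b\<in>carrier R. \<exists>c\<in>carrier R.
      d \<otimes> b = e \<and> (\<one> \<ominus> d) \<otimes> c = \<one> \<ominus> e \<and> (\<exists>m::nat. (x \<ominus> d) [^] m = \<zero>)"
  shows "exchange_ring R"
proof -
  have key: "\<exists>b'\<in>carrier R. x \<otimes> b' = e"
    if "x \<in> carrier R" "d \<in> carrier R" "e \<in> carrier R" "e \<otimes> e = e" "b \<in> carrier R" "d \<otimes> b = e" "(x \<ominus> d) [^] m = \<zero>"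
    for x d e b and m :: nat
  proof -
    define y where "y = (x \<ominus> d) \<otimes> b"
    have y: "y \<in> carrier R" using that by (simp add: y_def)
    have "y [^] m = \<zero>" using that by (simp add: y_def nat_pow_distrib)
    then obtain w where w: "w \<in> carrier R" "(\<one> \<oplus> y) \<otimes> w = \<one>"
      using one_plus_nilpotent_unit[OF y] by blast
    have "x \<otimes> (b \<otimes> e \<otimes> w) = ((d \<otimes> b) \<otimes> e \<oplus> e \<otimes> y) \<otimes> w"
      unfolding y_def using that(1,2,3,5) w(1) by Ring.algebra
    also have "\<dots> = e \<otimes> ((\<one> \<oplus> y) \<otimes> w)"
      using that w(1) y by (simp add: l_distr r_distr m_assoc)
    also have "\<dots> = e" using w that by simp
    finally show ?thesis using that w by (intro bexI[of _ "b \<otimes> e \<otimes> w"]) simp_all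
  qed
  show ?thesis
    unfolding exchange_ring_def
  proof
    fix x assume x: "x \<in> carrier R"
    then obtain d e b c and m :: nat where d: "d \<in> carrier R" and e: "e \<in> idempotents R"
      and b: "b \<in> carrier R" "d \<otimes> b = e" and c: "c \<in> carrier R" "(\<one> \<ominus> d) \<otimes> c = \<one> \<ominus> e" and m: "(x \<ominus> d) [^] m = \<zero>"
      using lift by meson
    have e': "e \<in> carrier R" "e \<otimes> e = e" using e by (auto simp: idempotents_def)
    obtain b' where b': "b' \<in> carrier R" "x \<otimes> b' = e"
      using key[OF x d e' b m] by blast
    have "(\<one> \<ominus> e) \<otimes> (\<one> \<ominus> e) = \<one> \<ominus> e \<ominus> e \<oplus> e \<otimes> e"
      using e'(1) by Ring.algebra
    also have "\<dots> = \<one> \<ominus> e \<ominus> e \<oplus> e" using e'(2) by simp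
    also have "\<dots> = \<one> \<ominus> e" using e'(1) by Ring.algebra
    finally have e1: "(\<one> \<ominus> e) \<otimes> (\<one> \<ominus> e) = \<one> \<ominus> e" .
    have "(\<one> \<ominus> x) \<ominus> (\<one> \<ominus> d) = \<ominus> \<one> \<otimes> (x \<ominus> d)"
      using x d by Ring.algebra
    then have "((\<one> \<ominus> x) \<ominus> (\<one> \<ominus> d)) [^] m = \<zero>"
      using x d m by (simp add: nat_pow_distrib)
    then obtain c' where "c' \<in> carrier R" "(\<one> \<ominus> x) \<otimes> c' = \<one> \<ominus> e"
      using key[of "\<one> \<ominus> x" "\<one> \<ominus> d" "\<one> \<ominus> e" c m] e1 c x d e'
      by auto
    then show "\<exists>e\<in>idempotents R. \<exists>b\<in>carrier R. \<exists>c\<in>carrier R. x \<otimes> b = e \<and> (\<one> \<ominus> x) \<otimes> c = \<one> \<ominus> e"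
      using e b' by blast
  qed
qed

text \<open>Both \<open>p - q p\<close> and \<open>q - q p\<close> are multiples of
  \<open>p - q\<close>, hence nilpotent, and both are idempotent. An idempotent equals all its
  positive powers, so they are zero.\<close>

lemma idempotents_eq_if_nilpotent:
  assumes p: "p \<in> idempotents R" and q: "q \<in> idempotents R" and nil: "(p \<ominus> q) [^] (m::nat) = \<zero>"
  shows "p = q"
proof -
  have c: "p \<in> carrier R" "q \<in> carrier R" and pp: "p \<otimes> p = p" "q \<otimes> q = q"
    using p q by (auto simp: idempotents_def)
  have nz: "z = \<zero>" if "z \<in> carrier R" "z \<otimes> z = z" "z [^] m = \<zero>" for z
  proof -
    have "z [^] Suc k = z" for k using that(1,2) by (induction k) simp_all
    from this[of m] show ?thesis using that by simp
  qed
  have "p \<ominus> q \<otimes> p = \<zero>"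
  proof (rule nz)
    have "(p \<ominus> q \<otimes> p) \<otimes> (p \<ominus> q \<otimes> p) = p \<otimes> p \<ominus> q \<otimes> (p \<otimes> p) \<ominus> q \<otimes> (p \<otimes> p) \<oplus> (q \<otimes> q) \<otimes> (p \<otimes> p)"
      using c by Ring.algebra
    also have "\<dots> = p \<ominus> q \<otimes> p \<ominus> q \<otimes> p \<oplus> q \<otimes> p"
      unfolding pp ..
    also have "\<dots> = p \<ominus> q \<otimes> p" using c by Ring.algebra
    finally show "(p \<ominus> q \<otimes> p) \<otimes> (p \<ominus> q \<otimes> p) = p \<ominus> q \<otimes> p" .
    have "(p \<ominus> q) \<otimes> p = p \<otimes> p \<ominus> q \<otimes> p" using c by Ring.algebra
    then have "p \<ominus> q \<otimes> p = (p \<ominus> q) \<otimes> p" unfolding pp by simp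
    then show "(p \<ominus> q \<otimes> p) [^] m = \<zero>" using c nil by (simp add: nat_pow_distrib)
  qed (use c in simp)
  moreover have "q \<ominus> q \<otimes> p = \<zero>"
  proof (rule nz)
    have "(q \<ominus> q \<otimes> p) \<otimes> (q \<ominus> q \<otimes> p) = q \<otimes> q \<ominus> (q \<otimes> q) \<otimes> p \<ominus> (q \<otimes> q) \<otimes> p \<oplus> (q \<otimes> q) \<otimes> (p \<otimes> p)"
      using c by Ring.algebra
    also have "\<dots> = q \<ominus> q \<otimes> p \<ominus> q \<otimes> p \<oplus> q \<otimes> p"
      unfolding pp ..
    also have "\<dots> = q \<ominus> q \<otimes> p" using c by Ring.algebra
    finally show "(q \<ominus> q \<otimes> p) \<otimes> (q \<ominus> q \<otimes> p) = q \<ominus> q \<otimes> p" .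
    have "(p \<ominus> q) \<otimes> (\<ominus> q) = q \<otimes> q \<ominus> q \<otimes> p"
      using c by Ring.algebra
    then have "q \<ominus> q \<otimes> p = (p \<ominus> q) \<otimes> (\<ominus> q)" unfolding pp by simp
    then show "(q \<ominus> q \<otimes> p) [^] m = \<zero>" using c nil by (simp add: nat_pow_distrib)
  qed (use c in simp)
  ultimately have "p = q \<otimes> p" "q = q \<otimes> p" using c by (auto intro: eq_if_minus_zero)
  then show ?thesis by simp
qed

end

context ring
begin

section \<open>Entries of square matrices\<close>

lemma matrix_ring_mult_index:
  "\<lbrakk>A \<in> carrier (matrix_ring R n); B \<in> carrier (matrix_ring R n); i < n; j < n\<rbrakk> \<Longrightarrow>
    (A \<otimes>\<^bsub>matrix_ring R n\<^esub> B) $$ (i, j) = (\<Oplus>t\<in>{..<n}. A $$ (i, t) \<otimes> B $$ (t, j))"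
  by (simp add: matrix_ring_mult) (simp add: mem_carrier_matrix_ring rmul_index)

lemma matrix_ring_index_closed [simp]:
  "A \<in> carrier (matrix_ring R n) \<Longrightarrow> i < n \<Longrightarrow> j < n \<Longrightarrow> A $$ (i, j) \<in> carrier R"
  by (simp add: mem_carrier_matrix_ring mat_overD)

lemma matrix_ring_add_index [simp]:
  "\<lbrakk>A \<in> carrier (matrix_ring R n); i < n; j < n\<rbrakk> \<Longrightarrow>
    (A \<oplus>\<^bsub>matrix_ring R n\<^esub> B) $$ (i, j) = A $$ (i, j) \<oplus> B $$ (i, j)"
  by (simp add: matrix_ring_add) (simp add: mem_carrier_matrix_ring)

lemma matrix_ring_zero_index [simp]: "i < n \<Longrightarrow> j < n \<Longrightarrow> \<zero>\<^bsub>matrix_ring R n\<^esub> $$ (i, j) = \<zero>"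
  by (simp add: matrix_ring_zero)

lemma matrix_ring_eqI:
  "\<lbrakk>A \<in> carrier (matrix_ring R n); B \<in> carrier (matrix_ring R n); \<And>i j. i < n \<Longrightarrow> j < n \<Longrightarrow> A $$ (i, j) = B $$ (i, j)\<rbrakk> \<Longrightarrow> A = B"
  by (rule eq_matI) (auto simp: mem_carrier_matrix_ring)

lemma matrix_ring_minus_index [simp]:
  assumes "A \<in> carrier (matrix_ring R n)" "B \<in> carrier (matrix_ring R n)" "i < n" "j < n"
  shows "(A \<ominus>\<^bsub>matrix_ring R n\<^esub> B) $$ (i, j) = A $$ (i, j) \<ominus> B $$ (i, j)"
proof -
  interpret M: ring "matrix_ring R n" by (rule ring_matrix_ring)
  let ?D = "A \<ominus>\<^bsub>matrix_ring R n\<^esub> B"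
  have D: "?D \<in> carrier (matrix_ring R n)" using assms by simp
  have "?D \<oplus>\<^bsub>matrix_ring R n\<^esub> B = A"
    using assms by (simp add: M.minus_eq M.a_assoc M.l_neg)
  then have "?D $$ (i, j) \<oplus> B $$ (i, j) = A $$ (i, j)"
    using D assms matrix_ring_add_index[of ?D n i j B] by simp
  then show ?thesis using D assms by (metis add.inv_solve_right minus_eq matrix_ring_index_closed)
qed

lemma rdiag_closed [simp]: "d \<in> carrier R \<Longrightarrow> rdiag R n d \<in> carrier (matrix_ring R n)"
  by (simp add: mem_carrier_matrix_ring)

lemma rdiag_mult_index [simp]:
  "\<lbrakk>d \<in> carrier R; B \<in> carrier (matrix_ring R n); i < n; j < n\<rbrakk> \<Longrightarrow>
    (rdiag R n d \<otimes>\<^bsub>matrix_ring R n\<^esub> B) $$ (i, j) = d \<otimes> B $$ (i, j)"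
  by (simp add: matrix_ring_mult) (simp add: mem_carrier_matrix_ring rmul_rdiag_left)

lemma rdiag_mult [simp]:
  "c \<in> carrier R \<Longrightarrow> d \<in> carrier R \<Longrightarrow> rdiag R n c \<otimes>\<^bsub>matrix_ring R n\<^esub> rdiag R n d = rdiag R n (c \<otimes> d)"
  by (simp add: matrix_ring_mult rmul_rdiag_left) (auto intro!: eq_matI)

lemma rdiag_add [simp]:
  "c \<in> carrier R \<Longrightarrow> d \<in> carrier R \<Longrightarrow> rdiag R n c \<oplus>\<^bsub>matrix_ring R n\<^esub> rdiag R n d = rdiag R n (c \<oplus> d)"
  by (auto simp: matrix_ring_add intro!: eq_matI)

text \<open>Every factor pushes the nonzero entries at least one diagonal further up. For
  \<open>k = n\<close> nothing is left.\<close>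

lemma upper_triangular_pow_zero:
  assumes N: "N \<in> carrier (matrix_ring R n)" and up: "\<And>i j. i < n \<Longrightarrow> j \<le> i \<Longrightarrow> N $$ (i, j) = \<zero>"
  shows "\<lbrakk>i < n; j < n; j < i + k\<rbrakk> \<Longrightarrow> (N [^]\<^bsub>matrix_ring R n\<^esub> (k::nat)) $$ (i, j) = \<zero>"
proof (induction k arbitrary: i j)
  case 0
  then show ?case by (simp add: matrix_ring_one)
next
  case (Suc k)
  interpret M: ring "matrix_ring R n" by (rule ring_matrix_ring)
  have "(\<Oplus>t\<in>{..<n}. (N [^]\<^bsub>matrix_ring R n\<^esub> k) $$ (i, t) \<otimes> N $$ (t, j)) = \<zero>"
  proof (rule finsum_lessThan_zero)
    fix t assume t: "t < n"
    have c: "(N [^]\<^bsub>matrix_ring R n\<^esub> k) $$ (i, t) \<in> carrier R"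
      using Suc.prems t M.nat_pow_closed[OF N, of k] by simp
    show "(N [^]\<^bsub>matrix_ring R n\<^esub> k) $$ (i, t) \<otimes> N $$ (t, j) = \<zero>"
    proof (cases "t < i + k")
      case True
      then show ?thesis using Suc t N by simp
    next
      case False
      then show ?thesis using Suc.prems t N up[of t j] c by simp
    qed
  qed
  then show ?case using Suc.prems N by (simp add: matrix_ring_mult_index)
qed

end

locale cyclic_nilpotent = cring R for R (structure) +
  fixes n :: nat and N
  assumes N: "N \<in> carrier (matrix_ring R n)" and n_pos: "0 < n"
    and upper: "\<And>i j. i < n \<Longrightarrow> j \<le> i \<Longrightarrow> N $$ (i, j) = \<zero>"
    and superdiag: "\<And>i. i + 1 < n \<Longrightarrow> non_zero_divisor R (N $$ (i, i + 1))"
begin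

abbreviation M where "M \<equiv> matrix_ring R n"

sublocale M: ring M by (rule ring_matrix_ring)

definition centralizer where "centralizer = {B \<in> carrier M. N \<otimes>\<^bsub>M\<^esub> B = B \<otimes>\<^bsub>M\<^esub> N}"

lemma centralizerD: "B \<in> centralizer \<Longrightarrow> B \<in> carrier M" "B \<in> centralizer \<Longrightarrow> N \<otimes>\<^bsub>M\<^esub> B = B \<otimes>\<^bsub>M\<^esub> N"
  by (auto simp: centralizer_def)

lemma pow_commute: "B \<in> centralizer \<Longrightarrow> N [^]\<^bsub>M\<^esub> (k::nat) \<otimes>\<^bsub>M\<^esub> B = B \<otimes>\<^bsub>M\<^esub> N [^]\<^bsub>M\<^esub> k"
proof (induction k)
  case 0
  then show ?case by (simp add: centralizerD)
next
  case (Suc k)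
  have B: "B \<in> carrier M" using Suc.prems by (rule centralizerD)
  have "N [^]\<^bsub>M\<^esub> Suc k \<otimes>\<^bsub>M\<^esub> B = N [^]\<^bsub>M\<^esub> k \<otimes>\<^bsub>M\<^esub> (B \<otimes>\<^bsub>M\<^esub> N)"
    using Suc.prems N B by (simp add: M.m_assoc centralizerD)
  also have "\<dots> = (N [^]\<^bsub>M\<^esub> k \<otimes>\<^bsub>M\<^esub> B) \<otimes>\<^bsub>M\<^esub> N"
    using N B by (simp add: M.m_assoc)
  also have "\<dots> = B \<otimes>\<^bsub>M\<^esub> N [^]\<^bsub>M\<^esub> Suc k"
    using N B Suc by (simp add: M.m_assoc)
  finally show ?case .
qed

lemma pow_index_closed [simp]: "i < n \<Longrightarrow> j < n \<Longrightarrow> (N [^]\<^bsub>M\<^esub> (k::nat)) $$ (i, j) \<in> carrier R"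
  by (rule matrix_ring_index_closed[OF M.nat_pow_closed[OF N]])

text \<open>The entry is the product of the first \<open>k\<close> superdiagonal entries: in the
  inner sum the terms before the critical index vanish through the power of \<open>N\<close>, those
  after it through \<open>N\<close> itself.\<close>

lemma pow_superdiag: "k < n \<Longrightarrow> non_zero_divisor R ((N [^]\<^bsub>M\<^esub> k) $$ (0, k))"
proof (induction k)
  case 0
  then show ?case by (simp add: matrix_ring_one non_zero_divisor_def)
next
  case (Suc k)
  have "(N [^]\<^bsub>M\<^esub> Suc k) $$ (0, Suc k) = (\<Oplus>t\<in>{..<n}. (N [^]\<^bsub>M\<^esub> k) $$ (0, t) \<otimes> N $$ (t, Suc k))"
    using Suc.prems N by (simp add: matrix_ring_mult_index)
  also have "\<dots> = (N [^]\<^bsub>M\<^esub> k) $$ (0, k) \<otimes> N $$ (k, Suc k)"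
  proof (rule finsum_lessThan_single)
    fix t assume t: "t < n" "t \<noteq> k"
    have c: "(N [^]\<^bsub>M\<^esub> k) $$ (0, t) \<in> carrier R" using n_pos t by simp
    show "(N [^]\<^bsub>M\<^esub> k) $$ (0, t) \<otimes> N $$ (t, Suc k) = \<zero>"
    proof (cases "t < k")
      case True
      then show ?thesis using Suc.prems t N upper_triangular_pow_zero[OF N upper, of 0 t k] by simp
    next
      case False
      then show ?thesis using Suc.prems t N upper[of t "Suc k"] c by simp
    qed
  qed (use Suc.prems N in simp_all)
  finally show ?case
    using Suc superdiag[of k] by (simp add: non_zero_divisor_mult)
qed

text \<open>The first basis row vector is cyclic for \<^term>\<open>N\<close> over the total fraction ring.\<close>

lemma centralizer_eq_zero:
  assumes X: "X \<in> centralizer" and row: "\<And>j. j < n \<Longrightarrow> X $$ (0, j) = \<zero>"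
  shows "X = \<zero>\<^bsub>M\<^esub>"
proof -
  have XM: "X \<in> carrier M" using X by (rule centralizerD)
  \<comment> \<open>Rows are cleared from the last one upwards. Row 0 of \<open>N^k\<close> is zero
    before column \<open>k\<close>, and its later columns meet rows of \<open>X\<close> already
    known to vanish. So row 0 of \<open>N^k X = X N^k\<close> reads \<open>a X_(k,j) = 0\<close>
    with a non-zero-divisor \<open>a\<close>.\<close>
  have rows: "\<forall>j<n. X $$ (k, j) = \<zero>" if "k < n" for k
    using that
  proof (induction "n - k" arbitrary: k rule: less_induct)
    case less
    have later: "X $$ (t, j) = \<zero>" if "k < t" "t < n" "j < n" for t j
      using less.hyps[of t] that less.prems by auto
    show ?case
    proof (intro allI impI)
      fix j assume j: "j < n"
      let ?a = "(N [^]\<^bsub>M\<^esub> k) $$ (0, k)"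
      have "(\<Oplus>t\<in>{..<n}. (N [^]\<^bsub>M\<^esub> k) $$ (0, t) \<otimes> X $$ (t, j)) = ?a \<otimes> X $$ (k, j)"
      proof (rule finsum_lessThan_single)
        fix t assume t: "t < n" "t \<noteq> k"
        have c: "(N [^]\<^bsub>M\<^esub> k) $$ (0, t) \<in> carrier R" using n_pos t by simp
        show "(N [^]\<^bsub>M\<^esub> k) $$ (0, t) \<otimes> X $$ (t, j) = \<zero>"
        proof (cases "t < k")
          case True
          then show ?thesis
            using j t N XM upper_triangular_pow_zero[OF N upper, of 0 t k] n_pos by simp
        next
          case False
          then show ?thesis using j t N XM later[of t j] n_pos c by simp
        qed
      qed (use less.prems j N XM n_pos in simp_all)
      moreover have "(N [^]\<^bsub>M\<^esub> k \<otimes>\<^bsub>M\<^esub> X) $$ (0, j) = (\<Oplus>t\<in>{..<n}. X $$ (0, t) \<otimes> (N [^]\<^bsub>M\<^esub> k) $$ (t, j))"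
        unfolding pow_commute[OF X] using N XM j n_pos by (simp add: matrix_ring_mult_index)
      moreover have "\<dots> = \<zero>"
        using N XM j n_pos row by (intro finsum_lessThan_zero) simp
      moreover have "(N [^]\<^bsub>M\<^esub> k \<otimes>\<^bsub>M\<^esub> X) $$ (0, j) = (\<Oplus>t\<in>{..<n}. (N [^]\<^bsub>M\<^esub> k) $$ (0, t) \<otimes> X $$ (t, j))"
        using N XM j n_pos by (simp add: matrix_ring_mult_index)
      ultimately have az: "?a \<otimes> X $$ (k, j) = \<zero>" by simp
      show "X $$ (k, j) = \<zero>"
        by (rule non_zero_divisorD(2)[OF pow_superdiag[OF less.prems] _ az]) (use XM less.prems j in simp)
    qed
  qed
  show ?thesis by (rule matrix_ring_eqI) (use XM rows in auto)
qed

lemma rdiag_commute: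
  assumes "d \<in> carrier R" "B \<in> carrier M"
  shows "rdiag R n d \<otimes>\<^bsub>M\<^esub> B = B \<otimes>\<^bsub>M\<^esub> rdiag R n d"
proof -
  have "B \<otimes>\<^bsub>M\<^esub> rdiag R n d = rmul R B (rdiag R n d)"
    using assms by (simp add: matrix_ring_mult)
  also have "\<dots> = mat n n (\<lambda>(i, j). B $$ (i, j) \<otimes> d)"
    using assms by (simp add: mem_carrier_matrix_ring rmul_rdiag_right)
  finally have *: "B \<otimes>\<^bsub>M\<^esub> rdiag R n d = mat n n (\<lambda>(i, j). B $$ (i, j) \<otimes> d)" .
  show ?thesis
  proof (rule matrix_ring_eqI)
    fix i j assume ij: "i < n" "j < n"
    then have "B $$ (i, j) \<in> carrier R" using assms by simp
    then show "(rdiag R n d \<otimes>\<^bsub>M\<^esub> B) $$ (i, j) = (B \<otimes>\<^bsub>M\<^esub> rdiag R n d) $$ (i, j)"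
      unfolding * using ij assms by (simp add: m_comm)
  qed (use assms in simp_all)
qed

lemma rdiag_centralizer: "d \<in> carrier R \<Longrightarrow> rdiag R n d \<in> centralizer"
  using N by (simp add: centralizer_def rdiag_commute)

lemma centralizer_mult: "A \<in> centralizer \<Longrightarrow> B \<in> centralizer \<Longrightarrow> A \<otimes>\<^bsub>M\<^esub> B \<in> centralizer"
proof -
  assume A: "A \<in> centralizer" and B: "B \<in> centralizer"
  note c = N centralizerD(1)[OF A] centralizerD(1)[OF B]
  have "N \<otimes>\<^bsub>M\<^esub> (A \<otimes>\<^bsub>M\<^esub> B) = A \<otimes>\<^bsub>M\<^esub> (N \<otimes>\<^bsub>M\<^esub> B)"
    using c centralizerD(2)[OF A] by (simp flip: M.m_assoc)
  also have "\<dots> = (A \<otimes>\<^bsub>M\<^esub> B) \<otimes>\<^bsub>M\<^esub> N"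
    using c centralizerD(2)[OF B] by (simp add: M.m_assoc)
  finally show ?thesis using c by (simp add: centralizer_def)
qed

lemma centralizer_add: "A \<in> centralizer \<Longrightarrow> B \<in> centralizer \<Longrightarrow> A \<oplus>\<^bsub>M\<^esub> B \<in> centralizer"
  using N by (auto simp: centralizer_def M.l_distr M.r_distr)

lemma centralizer_neg: "A \<in> centralizer \<Longrightarrow> \<ominus>\<^bsub>M\<^esub> A \<in> centralizer"
  using N by (auto simp: centralizer_def M.l_minus M.r_minus)

lemma centralizer_minus: "A \<in> centralizer \<Longrightarrow> B \<in> centralizer \<Longrightarrow> A \<ominus>\<^bsub>M\<^esub> B \<in> centralizer"
  by (simp add: M.minus_eq centralizer_add centralizer_neg)

text \<open>The combinations of powers of \<^term>\<open>N\<close> lie in this set, and all its defining conditions survive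
  cancellation of a non-zero-divisor.\<close>

definition toeplitz_center where
  "toeplitz_center = {Q \<in> carrier M. (\<forall>B\<in>centralizer. Q \<otimes>\<^bsub>M\<^esub> B = B \<otimes>\<^bsub>M\<^esub> Q) \<and>
    (\<forall>i<n. \<forall>j<i. Q $$ (i, j) = \<zero>) \<and> (\<forall>i<n. Q $$ (i, i) = Q $$ (0, 0))}"

lemma toeplitz_centerI:
  assumes "Q \<in> carrier M" "\<And>B. B \<in> centralizer \<Longrightarrow> Q \<otimes>\<^bsub>M\<^esub> B = B \<otimes>\<^bsub>M\<^esub> Q"
    and "\<And>i j. i < n \<Longrightarrow> j < i \<Longrightarrow> Q $$ (i, j) = \<zero>" "\<And>i. i < n \<Longrightarrow> Q $$ (i, i) = Q $$ (0, 0)"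
  shows "Q \<in> toeplitz_center"
  unfolding toeplitz_center_def using assms by blast

lemma toeplitz_centerD:
  assumes "Q \<in> toeplitz_center"
  shows "Q \<in> carrier M" "\<And>B. B \<in> centralizer \<Longrightarrow> Q \<otimes>\<^bsub>M\<^esub> B = B \<otimes>\<^bsub>M\<^esub> Q"
    and "\<And>i j. i < n \<Longrightarrow> j < i \<Longrightarrow> Q $$ (i, j) = \<zero>" "\<And>i. i < n \<Longrightarrow> Q $$ (i, i) = Q $$ (0, 0)"
  using assms unfolding toeplitz_center_def by blast+

lemma N_centralizer: "N \<in> centralizer"
  using N by (simp add: centralizer_def)

lemma toeplitz_center_subset: "toeplitz_center \<subseteq> centralizer"
proof
  fix Q assume Q: "Q \<in> toeplitz_center"
  show "Q \<in> centralizer"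
    using toeplitz_centerD(1)[OF Q] toeplitz_centerD(2)[OF Q N_centralizer]
    by (simp add: centralizer_def)
qed

lemma toeplitz_center_add:
  "P \<in> toeplitz_center \<Longrightarrow> Q \<in> toeplitz_center \<Longrightarrow> P \<oplus>\<^bsub>M\<^esub> Q \<in> toeplitz_center"
proof (rule toeplitz_centerI)
  assume P: "P \<in> toeplitz_center" and Q: "Q \<in> toeplitz_center"
  note c = toeplitz_centerD(1)[OF P] toeplitz_centerD(1)[OF Q]
  show "P \<oplus>\<^bsub>M\<^esub> Q \<in> carrier M" using c by simp
  show "(P \<oplus>\<^bsub>M\<^esub> Q) \<otimes>\<^bsub>M\<^esub> B = B \<otimes>\<^bsub>M\<^esub> (P \<oplus>\<^bsub>M\<^esub> Q)" if "B \<in> centralizer" for B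
    using c that toeplitz_centerD(2)[OF P that] toeplitz_centerD(2)[OF Q that]
    by (simp add: M.l_distr M.r_distr centralizerD(1))
  show "(P \<oplus>\<^bsub>M\<^esub> Q) $$ (i, j) = \<zero>" if "i < n" "j < i" for i j
    using c that toeplitz_centerD(3)[OF P that] toeplitz_centerD(3)[OF Q that] by simp
  show "(P \<oplus>\<^bsub>M\<^esub> Q) $$ (i, i) = (P \<oplus>\<^bsub>M\<^esub> Q) $$ (0, 0)" if "i < n" for i
    using c n_pos that toeplitz_centerD(4)[OF P that] toeplitz_centerD(4)[OF Q that] by simp
qed

lemma toeplitz_center_scale:
  assumes d: "d \<in> carrier R" and Q: "Q \<in> toeplitz_center"
  shows "rdiag R n d \<otimes>\<^bsub>M\<^esub> Q \<in> toeplitz_center"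
proof -
  have QM: "Q \<in> carrier M" by (rule toeplitz_centerD[OF Q])
  have 1: "(rdiag R n d \<otimes>\<^bsub>M\<^esub> Q) \<otimes>\<^bsub>M\<^esub> B = B \<otimes>\<^bsub>M\<^esub> (rdiag R n d \<otimes>\<^bsub>M\<^esub> Q)" if B: "B \<in> centralizer" for B
  proof -
    have BM: "B \<in> carrier M" and QB: "Q \<otimes>\<^bsub>M\<^esub> B = B \<otimes>\<^bsub>M\<^esub> Q"
      using centralizerD(1)[OF B] toeplitz_centerD(2)[OF Q B] by auto
    have "(rdiag R n d \<otimes>\<^bsub>M\<^esub> Q) \<otimes>\<^bsub>M\<^esub> B = (rdiag R n d \<otimes>\<^bsub>M\<^esub> B) \<otimes>\<^bsub>M\<^esub> Q"
      using BM QM d QB by (simp add: M.m_assoc)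
    also have "\<dots> = B \<otimes>\<^bsub>M\<^esub> (rdiag R n d \<otimes>\<^bsub>M\<^esub> Q)"
      using BM QM d by (simp add: rdiag_commute M.m_assoc)
    finally show ?thesis .
  qed
  have 2: "(rdiag R n d \<otimes>\<^bsub>M\<^esub> Q) $$ (i, j) = \<zero>" if "i < n" "j < i" for i j
    using d QM that toeplitz_centerD(3)[OF Q that] by simp
  have 3: "(rdiag R n d \<otimes>\<^bsub>M\<^esub> Q) $$ (i, i) = (rdiag R n d \<otimes>\<^bsub>M\<^esub> Q) $$ (0, 0)" if "i < n" for i
    using d QM that n_pos toeplitz_centerD(4)[OF Q that] by simp
  show ?thesis by (rule toeplitz_centerI[OF _ 1 2 3]) (use d QM in simp)
qed

lemma pow_toeplitz_center: "N [^]\<^bsub>M\<^esub> (k::nat) \<in> toeplitz_center"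
proof -
  have 1: "(N [^]\<^bsub>M\<^esub> k) $$ (i, i) = (N [^]\<^bsub>M\<^esub> k) $$ (0, 0)" if "i < n" for i
    using that n_pos upper_triangular_pow_zero[OF N upper, of i i k] upper_triangular_pow_zero[OF N upper, of 0 0 k]
    by (cases "k = 0") (auto simp: matrix_ring_one)
  have 2: "(N [^]\<^bsub>M\<^esub> k) $$ (i, j) = \<zero>" if "i < n" "j < i" for i j
    using that upper_triangular_pow_zero[OF N upper, of i j k] by simp
  show ?thesis by (rule toeplitz_centerI[OF _ pow_commute 2 1]) (use N in simp)
qed

text \<open>Fraction-free elimination along row 0: a combination of powers of \<open>N\<close> is
  fitted to a multiple of \<open>B\<close> one column at a time. Once row 0 agrees everywhere,
  \<open>centralizer_eq_zero\<close> makes the matrices equal.\<close>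

lemma centralizer_scaled:
  assumes B: "B \<in> centralizer"
  shows "\<exists>d. non_zero_divisor R d \<and> rdiag R n d \<otimes>\<^bsub>M\<^esub> B \<in> toeplitz_center"
proof -
  have BM: "B \<in> carrier M" using B by (rule centralizerD)
  have "\<exists>d Q. non_zero_divisor R d \<and> Q \<in> toeplitz_center \<and> (\<forall>j<m. d \<otimes> B $$ (0, j) = Q $$ (0, j))" if "m \<le> n" for m
    using that
  proof (induction m)
    case 0
    have "\<zero>\<^bsub>M\<^esub> \<in> toeplitz_center"
      using n_pos by (intro toeplitz_centerI) (simp_all add: centralizerD(1))
    then show ?case
      by (intro exI[of _ \<one>] exI[of _ "\<zero>\<^bsub>M\<^esub>"]) (simp add: non_zero_divisor_def)
  next
    case (Suc m)
    then obtain d Q where d: "non_zero_divisor R d" and Q: "Q \<in> toeplitz_center"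
      and eq: "\<And>j. j < m \<Longrightarrow> d \<otimes> B $$ (0, j) = Q $$ (0, j)" by auto
    \<comment> \<open>\<open>N^m\<close> has zeros before column \<open>m\<close> of row 0, so
      adding it cannot spoil the columns already fitted. Its entry \<open>a\<close> cannot be
      divided by; everything is multiplied by \<open>a\<close> instead, and the discrepancy
      \<open>t\<close> becomes the coefficient.\<close>
    define a where "a = (N [^]\<^bsub>M\<^esub> m) $$ (0, m)"
    define t where "t = d \<otimes> B $$ (0, m) \<ominus> Q $$ (0, m)"
    define Q' where "Q' = rdiag R n a \<otimes>\<^bsub>M\<^esub> Q \<oplus>\<^bsub>M\<^esub> rdiag R n t \<otimes>\<^bsub>M\<^esub> N [^]\<^bsub>M\<^esub> m"
    have a: "non_zero_divisor R a" using pow_superdiag[of m] Suc.prems by (simp add: a_def)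
    have c: "a \<in> carrier R" "d \<in> carrier R" using a d by (auto intro: non_zero_divisorD)
    have QM: "Q \<in> carrier M" by (rule toeplitz_centerD[OF Q])
    have tc: "t \<in> carrier R" using c QM BM Suc.prems n_pos by (simp add: t_def)
    have "Q' \<in> toeplitz_center"
      unfolding Q'_def using Q c tc
      by (intro toeplitz_center_add toeplitz_center_scale pow_toeplitz_center)
    moreover have "a \<otimes> d \<otimes> B $$ (0, j) = Q' $$ (0, j)" if "j < Suc m" for j
    proof (cases "j = m")
      case True
      have *: "a \<otimes> d \<otimes> x = a \<otimes> y \<oplus> (d \<otimes> x \<ominus> y) \<otimes> a" if "x \<in> carrier R" "y \<in> carrier R" for x y
        using that c by Ring.algebra
      have "B $$ (0, m) \<in> carrier R" "Q $$ (0, m) \<in> carrier R"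
        using QM BM n_pos Suc.prems by simp_all
      from *[OF this] show ?thesis
        using True Suc.prems c tc QM BM N n_pos by (simp add: Q'_def a_def[symmetric] t_def)
    next
      case False
      then have "j < m" "j < n" using that Suc.prems by auto
      then show ?thesis
        using eq[of j] c tc QM BM N n_pos upper_triangular_pow_zero[OF N upper, of 0 j m]
        by (simp add: Q'_def m_assoc)
    qed
    ultimately show ?case using non_zero_divisor_mult[OF a d] by blast
  qed
  from this[of n] obtain d Q where d: "non_zero_divisor R d" and Q: "Q \<in> toeplitz_center"
    and eq: "\<And>j. j < n \<Longrightarrow> d \<otimes> B $$ (0, j) = Q $$ (0, j)" by auto
  have dc: "d \<in> carrier R" using d by (rule non_zero_divisorD)
  have QM: "Q \<in> carrier M" and QC: "Q \<in> centralizer"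
    using Q toeplitz_center_subset toeplitz_centerD(1) by auto
  let ?B = "rdiag R n d \<otimes>\<^bsub>M\<^esub> B"
  have BC: "?B \<in> centralizer" using dc B by (intro centralizer_mult rdiag_centralizer)
  have z: "?B \<ominus>\<^bsub>M\<^esub> Q = \<zero>\<^bsub>M\<^esub>"
  proof (rule centralizer_eq_zero)
    show "?B \<ominus>\<^bsub>M\<^esub> Q \<in> centralizer" using BC QC by (rule centralizer_minus)
    show "(?B \<ominus>\<^bsub>M\<^esub> Q) $$ (0, j) = \<zero>" if "j < n" for j
      using that n_pos eq[OF that] QM BM dc by (simp add: minus_eq r_neg)
  qed
  have "?B = Q" by (rule M.eq_if_minus_zero[OF z centralizerD(1)[OF BC] QM])
  then show ?thesis using d Q by blast
qed

text \<open>All three hold for a scaled copy of \<open>B\<close> by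
  \<open>centralizer_scaled\<close> and descend entry by entry, because \<open>d\<close>
  cancels.\<close>

lemma centralizer_properties:
  assumes B: "B \<in> centralizer"
  shows "\<And>X. X \<in> centralizer \<Longrightarrow> B \<otimes>\<^bsub>M\<^esub> X = X \<otimes>\<^bsub>M\<^esub> B"
    and "\<And>i j. i < n \<Longrightarrow> j < i \<Longrightarrow> B $$ (i, j) = \<zero>"
    and "\<And>i. i < n \<Longrightarrow> B $$ (i, i) = B $$ (0, 0)"
proof -
  obtain d where d: "non_zero_divisor R d" and Q: "rdiag R n d \<otimes>\<^bsub>M\<^esub> B \<in> toeplitz_center"
    using centralizer_scaled[OF B] by blast
  have dc: "d \<in> carrier R" using d by (rule non_zero_divisorD)
  have BM: "B \<in> carrier M" using B by (rule centralizerD)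
  have canc: "x = y" if "x \<in> carrier R" "y \<in> carrier R" "d \<otimes> x = d \<otimes> y" for x y
  proof (rule eq_if_minus_zero)
    have "d \<otimes> (x \<ominus> y) = d \<otimes> x \<ominus> d \<otimes> y"
      using that(1,2) dc by Ring.algebra
    also have "\<dots> = \<zero>" using that dc by (simp add: minus_eq r_neg)
    finally have dz: "d \<otimes> (x \<ominus> y) = \<zero>" .
    show "x \<ominus> y = \<zero>" by (rule non_zero_divisorD(2)[OF d _ dz]) (use that in simp)
  qed (use that in simp_all)
  show "B \<otimes>\<^bsub>M\<^esub> X = X \<otimes>\<^bsub>M\<^esub> B" if X: "X \<in> centralizer" for X
  proof (rule matrix_ring_eqI)
    have XM: "X \<in> carrier M" using X by (rule centralizerD)
    have eq: "rdiag R n d \<otimes>\<^bsub>M\<^esub> (B \<otimes>\<^bsub>M\<^esub> X) = rdiag R n d \<otimes>\<^bsub>M\<^esub> (X \<otimes>\<^bsub>M\<^esub> B)"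
    proof -
      have "rdiag R n d \<otimes>\<^bsub>M\<^esub> (B \<otimes>\<^bsub>M\<^esub> X) = X \<otimes>\<^bsub>M\<^esub> (rdiag R n d \<otimes>\<^bsub>M\<^esub> B)"
        using toeplitz_centerD(2)[OF Q X] BM XM dc by (simp add: M.m_assoc)
      also have "\<dots> = (rdiag R n d \<otimes>\<^bsub>M\<^esub> X) \<otimes>\<^bsub>M\<^esub> B"
        using BM XM dc by (simp add: rdiag_commute[OF dc XM] M.m_assoc)
      finally show ?thesis using BM XM dc by (simp add: M.m_assoc)
    qed
    show "(B \<otimes>\<^bsub>M\<^esub> X) $$ (i, j) = (X \<otimes>\<^bsub>M\<^esub> B) $$ (i, j)" if "i < n" "j < n" for i j
      using arg_cong[OF eq, of "\<lambda>A. A $$ (i, j)"] that BM XM dc matrix_ring_index_closed[OF M.m_closed[OF BM XM] that] matrix_ring_index_closed[OF M.m_closed[OF XM BM] that]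
      by - (rule canc, assumption+, simp)
  qed (use X BM centralizerD in auto)
  show "B $$ (i, j) = \<zero>" if "i < n" "j < i" for i j
    by (rule canc) (use toeplitz_centerD(3)[OF Q that] that dc BM in simp_all)
  show "B $$ (i, i) = B $$ (0, 0)" if "i < n" for i
    by (rule canc) (use toeplitz_centerD(4)[OF Q that] that dc BM n_pos in simp_all)
qed

section \<open>The commutant as a commutative exchange ring\<close>

abbreviation C where "C \<equiv> M\<lparr>carrier := centralizer\<rparr>"

lemma cring_centralizer: "cring C"
proof -
  have "subcring centralizer M"
  proof (rule M.subcringI)
    show "subring centralizer M"
    proof (rule M.subringI)
      show "\<one>\<^bsub>M\<^esub> \<in> centralizer"
        unfolding matrix_ring_one by (rule rdiag_centralizer) simp
    qed (auto simp: centralizerD centralizer_mult centralizer_add centralizer_neg)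
  qed (rule centralizer_properties)
  then show ?thesis using M.subcring_iff[of centralizer] by (auto simp: centralizer_def)
qed

sublocale C: cring C by (rule cring_centralizer)

text \<open>Inverses are described relative to the carrier, which is smaller in \<open>C\<close>, so
  agreement rests on their uniqueness; powers, in contrast, depend only on the operations shared
  with \<open>M\<close>.\<close>

lemma C_minus:
  assumes A: "A \<in> centralizer" and B: "B \<in> centralizer"
  shows "A \<ominus>\<^bsub>C\<^esub> B = A \<ominus>\<^bsub>M\<^esub> B"
proof -
  have "\<ominus>\<^bsub>C\<^esub> B = \<ominus>\<^bsub>M\<^esub> B"
    by (rule C.minus_equality) (use B in \<open>simp_all add: M.l_neg centralizerD(1) centralizer_neg\<close>)
  then show ?thesis by (simp add: C.minus_eq M.minus_eq)
qed

lemma C_pow: "A [^]\<^bsub>C\<^esub> (k::nat) = A [^]\<^bsub>M\<^esub> k"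
  by (simp add: nat_pow_def)

text \<open>The diagonal of \<open>B\<close> is constant, so removing the scalar matrix of its first
  entry leaves a strictly upper triangular matrix.\<close>

lemma centralizer_nilpotent:
  assumes B: "B \<in> centralizer"
  shows "(B \<ominus>\<^bsub>C\<^esub> rdiag R n (B $$ (0, 0))) [^]\<^bsub>C\<^esub> n = \<zero>\<^bsub>C\<^esub>"
proof -
  let ?D = "B \<ominus>\<^bsub>M\<^esub> rdiag R n (B $$ (0, 0))"
  have BM: "B \<in> carrier M" using B by (rule centralizerD)
  have b: "B $$ (0, 0) \<in> carrier R" using BM n_pos by simp
  have D: "?D \<in> carrier M" using BM b by simp
  have up: "?D $$ (i, j) = \<zero>" if "i < n" "j \<le> i" for i j
    using that BM b centralizer_properties(2)[OF B, of i j] centralizer_properties(3)[OF B, of i]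
    by (cases "i = j") (simp_all add: minus_eq r_neg)
  have "?D [^]\<^bsub>M\<^esub> n = \<zero>\<^bsub>M\<^esub>"
    by (rule matrix_ring_eqI) (use D upper_triangular_pow_zero[OF D up] in auto)
  then show ?thesis unfolding C_minus[OF B rdiag_centralizer[OF b]] C_pow by simp
qed

lemma rdiag_minus: "c \<in> carrier R \<Longrightarrow> d \<in> carrier R \<Longrightarrow> rdiag R n c \<ominus>\<^bsub>C\<^esub> rdiag R n d = rdiag R n (c \<ominus> d)"
  by (simp add: C_minus rdiag_centralizer) (rule matrix_ring_eqI, auto simp: minus_eq)

text \<open>The scalar matrix of the diagonal entry of \<open>B\<close> serves as the unperturbed
  element in \<open>exchange_ring_lift\<close>; its witnesses are scalar matrices over
  \<open>R\<close>.\<close>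

lemma exchange_ring_centralizer:
  assumes "exchange_ring R"
  shows "exchange_ring C"
proof (rule C.exchange_ring_lift)
  fix B assume "B \<in> carrier C"
  then have B: "B \<in> centralizer" by simp
  define b where "b = B $$ (0, 0)"
  have bc: "b \<in> carrier R"
    unfolding b_def by (rule matrix_ring_index_closed[OF centralizerD(1)[OF B] n_pos n_pos])
  obtain e x y where e: "e \<in> carrier R" "e \<otimes> e = e" and x: "x \<in> carrier R" "b \<otimes> x = e"
    and y: "y \<in> carrier R" "(\<one> \<ominus> b) \<otimes> y = \<one> \<ominus> e"
    using assms bc unfolding exchange_ring_def idempotents_def by blast
  have one: "\<one>\<^bsub>C\<^esub> = rdiag R n \<one>" by (simp add: matrix_ring_one)
  show "\<exists>d\<in>carrier C. \<exists>e\<in>idempotents C. \<exists>b\<in>carrier C. \<exists>c\<in>carrier C.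
      d \<otimes>\<^bsub>C\<^esub> b = e \<and> (\<one>\<^bsub>C\<^esub> \<ominus>\<^bsub>C\<^esub> d) \<otimes>\<^bsub>C\<^esub> c = \<one>\<^bsub>C\<^esub> \<ominus>\<^bsub>C\<^esub> e \<and> (\<exists>m::nat. (B \<ominus>\<^bsub>C\<^esub> d) [^]\<^bsub>C\<^esub> m = \<zero>\<^bsub>C\<^esub>)"
  proof (intro bexI conjI exI)
    show "(B \<ominus>\<^bsub>C\<^esub> rdiag R n b) [^]\<^bsub>C\<^esub> n = \<zero>\<^bsub>C\<^esub>"
      unfolding b_def by (rule centralizer_nilpotent[OF B])
    show "rdiag R n b \<otimes>\<^bsub>C\<^esub> rdiag R n x = rdiag R n e" using bc x by simp
    show "(\<one>\<^bsub>C\<^esub> \<ominus>\<^bsub>C\<^esub> rdiag R n b) \<otimes>\<^bsub>C\<^esub> rdiag R n y = \<one>\<^bsub>C\<^esub> \<ominus>\<^bsub>C\<^esub> rdiag R n e"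
      unfolding one using bc y e by (simp add: rdiag_minus)
  qed (use bc x y e rdiag_centralizer in \<open>simp_all add: idempotents_def\<close>)
qed

lemma add_torsion_free_centralizer:
  assumes "add_torsion_free R"
  shows "add_torsion_free C"
  unfolding add_torsion_free_def
proof (intro ballI allI impI)
  fix B and k :: nat assume "B \<in> carrier C" and k: "0 < k" and z: "[k] \<cdot>\<^bsub>C\<^esub> B = \<zero>\<^bsub>C\<^esub>"
  then have B: "B \<in> carrier M" by (simp add: centralizerD)
  have "[k] \<cdot>\<^bsub>C\<^esub> B = [k] \<cdot>\<^bsub>M\<^esub> B"
    by (simp add: add_pow_def nat_pow_def)
  then have z: "[k] \<cdot>\<^bsub>M\<^esub> B = \<zero>\<^bsub>M\<^esub>" using z by simp
  have "([k] \<cdot>\<^bsub>M\<^esub> B) $$ (i, j) = [k] \<cdot> (B $$ (i, j))" if "i < n" "j < n" for i j and k :: nat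
    using that B by (induction k) simp_all
  then have "[k] \<cdot> (B $$ (i, j)) = \<zero>" if "i < n" "j < n" for i j
    using that z by (metis matrix_ring_zero_index)
  then have "B $$ (i, j) = \<zero>" if "i < n" "j < n" for i j
    using that B k assms unfolding add_torsion_free_def by (meson matrix_ring_index_closed)
  then show "B = \<zero>\<^bsub>C\<^esub>" using B by (auto intro!: matrix_ring_eqI)
qed

text \<open>By triangularity the diagonal entry \<open>b\<close> of an idempotent \<open>p\<close>
  is idempotent. Then \<open>p\<close> and the scalar matrix of \<open>b\<close> are two idempotents
  with nilpotent difference.\<close>

lemma idempotents_centralizer: "idempotents C = rdiag R n ` idempotents R"
proof (intro equalityI subsetI)
  fix p assume p: "p \<in> idempotents C"
  then have pC: "p \<in> centralizer" and pp: "p \<otimes>\<^bsub>M\<^esub> p = p"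
    by (auto simp: idempotents_def)
  have pM: "p \<in> carrier M" using pC by (rule centralizerD)
  define b where "b = p $$ (0, 0)"
  have bc: "b \<in> carrier R" using pM n_pos by (simp add: b_def)
  have "b = (\<Oplus>t\<in>{..<n}. p $$ (0, t) \<otimes> p $$ (t, 0))"
    using matrix_ring_mult_index[OF pM pM n_pos n_pos] pp by (simp add: b_def)
  also have "\<dots> = b \<otimes> b"
    unfolding b_def
    by (rule finsum_lessThan_single) (use n_pos pM centralizer_properties(2)[OF pC] in auto)
  finally have b: "b \<in> idempotents R" using bc by (simp add: idempotents_def)
  have "rdiag R n b \<in> idempotents C"
    using b bc rdiag_centralizer by (simp add: idempotents_def)
  then have "p = rdiag R n b"
    by (rule C.idempotents_eq_if_nilpotent[OF p]) (unfold b_def, rule centralizer_nilpotent[OF pC])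
  then show "p \<in> rdiag R n ` idempotents R" using b by blast
next
  fix p assume "p \<in> rdiag R n ` idempotents R"
  then show "p \<in> idempotents C"
    using rdiag_centralizer by (auto simp: idempotents_def)
qed

end

section \<open>Essentially bounded functions\<close>

definition ae_class :: "'a measure \<Rightarrow> ('a \<Rightarrow> complex) \<Rightarrow> ('a \<Rightarrow> complex) set" where
  "ae_class M f = null_functions M +>\<^bsub>ess_bounded_ring M\<^esub> f"

definition ess_bounded :: "'a measure \<Rightarrow> ('a \<Rightarrow> complex) set" where
  "ess_bounded M = {f \<in> borel_measurable M. \<exists>c. AE x in M. cmod (f x) \<le> c}"

lemma carrier_ess_bounded_ring: "carrier (ess_bounded_ring M) = ess_bounded M"
  by (simp add: ess_bounded_ring_def ess_bounded_def)

lemma ess_boundedI: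
  "f \<in> borel_measurable M \<Longrightarrow> (\<And>x. x \<in> space M \<Longrightarrow> cmod (f x) \<le> c) \<Longrightarrow> f \<in> ess_bounded M"
  unfolding ess_bounded_def by (auto intro!: exI[of _ c] AE_I2)

lemma ess_bounded_closed:
  assumes "f \<in> ess_bounded M" "g \<in> ess_bounded M"
  shows "(\<lambda>x. f x + g x) \<in> ess_bounded M" "(\<lambda>x. f x * g x) \<in> ess_bounded M"
proof -
  interpret cring "ess_bounded_ring M" by (rule cring_ess_bounded_ring)
  show "(\<lambda>x. f x + g x) \<in> ess_bounded M" "(\<lambda>x. f x * g x) \<in> ess_bounded M"
    using a_closed[of f g] m_closed[of f g] assms
    by (simp_all add: carrier_ess_bounded_ring, simp_all add: ess_bounded_ring_def)
qed

lemma ess_bounded_const [simp]: "(\<lambda>x. c) \<in> ess_bounded M"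
  by (rule ess_boundedI) auto

lemma ess_bounded_scale: "f \<in> ess_bounded M \<Longrightarrow> (\<lambda>x. c * f x) \<in> ess_bounded M"
  using ess_bounded_closed(2)[OF ess_bounded_const] .

lemma ess_bounded_diff:
  assumes "f \<in> ess_bounded M" "g \<in> ess_bounded M"
  shows "(\<lambda>x. f x - g x) \<in> ess_bounded M"
  using ess_bounded_closed(1)[OF assms(1) ess_bounded_scale[OF assms(2), of "-1"]] by simp

lemma ae_class_mem: "f \<in> ess_bounded M \<Longrightarrow> f \<in> ae_class M f"
  unfolding ae_class_def
  by (rule abelian_subgroup.a_rcos_self)
    (auto simp: carrier_ess_bounded_ring intro!: abelian_subgroupI3 ideal.axioms(1)[OF ideal_null_functions]
      ring.is_abelian_group cring.axioms(1)[OF cring_ess_bounded_ring])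

lemma ae_class_hom:
  assumes "f \<in> ess_bounded M" "g \<in> ess_bounded M"
  shows ae_class_mult: "ae_class M f \<otimes>\<^bsub>L_infty M\<^esub> ae_class M g = ae_class M (\<lambda>x. f x * g x)"
    and ae_class_add: "ae_class M f \<oplus>\<^bsub>L_infty M\<^esub> ae_class M g = ae_class M (\<lambda>x. f x + g x)"
  using ring_hom_mult[OF ideal.rcos_ring_hom[OF ideal_null_functions], of f M g]
    ring_hom_add[OF ideal.rcos_ring_hom[OF ideal_null_functions], of f M g] assms
  by (simp_all add: carrier_ess_bounded_ring L_infty_def ae_class_def) (simp_all add: ess_bounded_ring_def)

lemma ae_class_one: "\<one>\<^bsub>L_infty M\<^esub> = ae_class M (\<lambda>x. 1)"
  by (simp add: L_infty_def ae_class_def FactRing_def ess_bounded_ring_def)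

lemma ae_class_closed: "f \<in> ess_bounded M \<Longrightarrow> ae_class M f \<in> carrier (L_infty M)"
  unfolding L_infty_def ae_class_def
  by (rule ring_hom_closed[OF ideal.rcos_ring_hom[OF ideal_null_functions]]) (simp add: carrier_ess_bounded_ring)

lemma ae_classE:
  assumes "F \<in> carrier (L_infty M)"
  obtains f where "f \<in> ess_bounded M" "F = ae_class M f"
  using assms unfolding L_infty_def ae_class_def FactRing_def A_RCOSETS_def'
  by (auto simp: carrier_ess_bounded_ring)

lemma ae_class_eq_iff:
  assumes f: "f \<in> ess_bounded M" and g: "g \<in> ess_bounded M"
  shows "ae_class M f = ae_class M g \<longleftrightarrow> (AE x in M. f x = g x)"
proof -
  interpret E: cring "ess_bounded_ring M" by (rule cring_ess_bounded_ring)
  have ng: "(\<lambda>x. - g x) \<in> ess_bounded M" using ess_bounded_scale[OF g, of "-1"] by simp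
  have "\<ominus>\<^bsub>ess_bounded_ring M\<^esub> g = (\<lambda>x. - g x)"
    by (rule E.minus_equality) (use g ng in \<open>simp_all add: carrier_ess_bounded_ring\<close>, simp add: ess_bounded_ring_def)
  then have "f \<ominus>\<^bsub>ess_bounded_ring M\<^esub> g = (\<lambda>x. f x - g x)"
    by (simp add: E.minus_eq) (simp add: ess_bounded_ring_def)
  then have "ae_class M f = ae_class M g \<longleftrightarrow> (\<lambda>x. f x - g x) \<in> null_functions M"
    using E.quotient_eq_iff_same_a_r_cos[OF ideal_null_functions, of f g] f g
    by (simp add: carrier_ess_bounded_ring ae_class_def)
  also have "\<dots> \<longleftrightarrow> (AE x in M. f x = g x)"
    using f g by (auto simp: null_functions_def ess_bounded_def)
  finally show ?thesis .
qed

lemma ae_class_zero: "\<zero>\<^bsub>L_infty M\<^esub> = ae_class M (\<lambda>x. 0)"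
proof -
  interpret L: cring "L_infty M" by (rule cring_L_infty)
  \<comment> \<open>In a group only the neutral element equals its own double.\<close>
  have "ae_class M (\<lambda>x. 0) \<oplus>\<^bsub>L_infty M\<^esub> ae_class M (\<lambda>x. 0) = ae_class M (\<lambda>x. 0)"
    by (simp add: ae_class_add)
  then show ?thesis using ae_class_closed[OF ess_bounded_const, of M 0] by (metis L.add.r_cancel_one')
qed

lemma ae_class_one_minus:
  assumes f: "f \<in> ess_bounded M"
  shows "\<one>\<^bsub>L_infty M\<^esub> \<ominus>\<^bsub>L_infty M\<^esub> ae_class M f = ae_class M (\<lambda>x. 1 - f x)"
proof -
  interpret L: cring "L_infty M" by (rule cring_L_infty)
  have nf: "(\<lambda>x. - f x) \<in> ess_bounded M" using ess_bounded_scale[OF f, of "-1"] by simp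
  have "\<ominus>\<^bsub>L_infty M\<^esub> ae_class M f = ae_class M (\<lambda>x. - f x)"
    by (rule L.minus_equality) (simp_all add: ae_class_add ae_class_zero ae_class_closed f nf)
  then show ?thesis by (simp add: L.minus_eq ae_class_one ae_class_add nf)
qed

lemma exchange_ring_L_infty: "exchange_ring (L_infty M)"
  unfolding exchange_ring_def
proof
  fix F assume "F \<in> carrier (L_infty M)"
  then obtain f where f: "f \<in> ess_bounded M" and F: "F = ae_class M f" by (rule ae_classE)
  have [measurable]: "f \<in> borel_measurable M" using f by (simp add: ess_bounded_def)
  \<comment> \<open>Any threshold strictly between 0 and 1 would do. With 1/2 both
    \<open>1 / f\<close> on the large part and \<open>1 / (1 - f)\<close> on the small part are
    bounded by 2, the latter since \<open>cmod (1 - y)\<close> is at least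
    \<open>1 - cmod y\<close>.\<close>
  define e b c where "e = (\<lambda>x. if cmod (f x) \<ge> 1 / 2 then 1 else 0 :: complex)"
    and "b = (\<lambda>x. if cmod (f x) \<ge> 1 / 2 then 1 / f x else 0)"
    and "c = (\<lambda>x. if cmod (f x) \<ge> 1 / 2 then 0 else 1 / (1 - f x))"
  have "cmod (1 / y) \<le> 2" if "cmod y \<ge> 1 / 2" for y :: complex
    using that by (simp add: norm_divide divide_simps split: if_splits)
  moreover have "cmod (1 - y) \<ge> 1 / 2" if "\<not> cmod y \<ge> 1 / 2" for y :: complex
    using that norm_triangle_ineq2[of 1 y] by simp
  ultimately have eb: "e \<in> ess_bounded M" "b \<in> ess_bounded M" "c \<in> ess_bounded M"
    unfolding e_def b_def c_def
    by (intro ess_boundedI[where c = 2]; simp)+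
  have nz: "f x \<noteq> 0" if "cmod (f x) \<ge> 1 / 2" for x using that by auto
  have nz1: "1 - f x \<noteq> 0" if small: "\<not> cmod (f x) \<ge> 1 / 2" for x
  proof
    assume "1 - f x = 0"
    then have "f x = 1" by simp
    with small show False by simp
  qed
  have "ae_class M e \<in> idempotents (L_infty M)"
    using eb
    by (simp add: idempotents_def ae_class_closed ae_class_mult) (simp add: e_def if_distrib cong: if_cong)
  moreover have "F \<otimes>\<^bsub>L_infty M\<^esub> ae_class M b = ae_class M e"
    unfolding F using f eb nz
    by (simp add: ae_class_mult) (intro arg_cong[where f = "ae_class M"] ext, auto simp: e_def b_def)
  moreover have "(\<one>\<^bsub>L_infty M\<^esub> \<ominus>\<^bsub>L_infty M\<^esub> F) \<otimes>\<^bsub>L_infty M\<^esub> ae_class M c = \<one>\<^bsub>L_infty M\<^esub> \<ominus>\<^bsub>L_infty M\<^esub> ae_class M e"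
    unfolding F using f eb nz1
    by (simp add: ae_class_one_minus ae_class_mult ess_bounded_diff)
      (intro arg_cong[where f = "ae_class M"] ext, auto simp: e_def c_def)
  ultimately show "\<exists>e\<in>idempotents (L_infty M). \<exists>b\<in>carrier (L_infty M). \<exists>c\<in>carrier (L_infty M).
      F \<otimes>\<^bsub>L_infty M\<^esub> b = e \<and> (\<one>\<^bsub>L_infty M\<^esub> \<ominus>\<^bsub>L_infty M\<^esub> F) \<otimes>\<^bsub>L_infty M\<^esub> c = \<one>\<^bsub>L_infty M\<^esub> \<ominus>\<^bsub>L_infty M\<^esub> e"
    using ae_class_closed eb by blast
qed

lemma add_torsion_free_L_infty: "add_torsion_free (L_infty M)"
  unfolding add_torsion_free_def
proof (intro ballI allI impI)
  fix F and k :: nat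
  assume "F \<in> carrier (L_infty M)" and k: "0 < k" and z: "[k] \<cdot>\<^bsub>L_infty M\<^esub> F = \<zero>\<^bsub>L_infty M\<^esub>"
  then obtain f where f: "f \<in> ess_bounded M" and F: "F = ae_class M f" by (auto elim: ae_classE)
  interpret L: cring "L_infty M" by (rule cring_L_infty)
  have "[k] \<cdot>\<^bsub>L_infty M\<^esub> F = ae_class M (\<lambda>x. of_nat k * f x)" for k :: nat
    unfolding F using f
    by (induction k) (simp_all add: ae_class_zero ae_class_add ess_bounded_scale algebra_simps)
  then have "AE x in M. of_nat k * f x = 0"
    using z f by (simp add: ae_class_zero ae_class_eq_iff ess_bounded_scale)
  then have "AE x in M. f x = 0" using k by simp
  then show "F = \<zero>\<^bsub>L_infty M\<^esub>"
    unfolding F using f by (simp add: ae_class_zero ae_class_eq_iff)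
qed

text \<open>Cancellation is pointwise and needs no bound, so it remains available where
  \<open>1 / f\<close> is essentially unbounded.\<close>

lemma non_zero_divisor_L_infty:
  assumes f: "f \<in> ess_bounded M" and nz: "AE x in M. f x \<noteq> 0"
  shows "non_zero_divisor (L_infty M) (ae_class M f)"
  unfolding non_zero_divisor_def
proof (intro conjI ballI impI)
  fix G assume "G \<in> carrier (L_infty M)" and z: "ae_class M f \<otimes>\<^bsub>L_infty M\<^esub> G = \<zero>\<^bsub>L_infty M\<^esub>"
  then obtain g where g: "g \<in> ess_bounded M" and G: "G = ae_class M g" by (auto elim: ae_classE)
  have "AE x in M. f x * g x = 0"
    using z f g by (simp add: G ae_class_mult ae_class_zero ae_class_eq_iff ess_bounded_closed)
  then have "AE x in M. g x = 0" using nz by eventually_elim simp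
  then show "G = \<zero>\<^bsub>L_infty M\<^esub>"
    unfolding G using g by (simp add: ae_class_zero ae_class_eq_iff)
qed (rule ae_class_closed[OF f])

section \<open>Integer-valued Borel functions as classes in L_infty\<close>

context
  fixes \<mu> :: "complex measure" and \<Lambda> :: "complex set"
  assumes compact: "compact \<Lambda>" and sets_\<mu>: "sets \<mu> = sets borel" and null: "emeasure \<mu> (- \<Lambda>) = 0"
begin

text \<open>Classes live on the whole plane, so \<open>\<phi>\<close> is extended by 0; the
  complement of \<open>\<Lambda>\<close> is null, and the choice of a value there does not affect
  the class.\<close>

definition int_fun_class :: "(complex \<Rightarrow> int) \<Rightarrow> (complex \<Rightarrow> complex) set" where
  "int_fun_class \<phi> = ae_class (completion \<mu>) (\<lambda>x. if x \<in> \<Lambda> then of_int (\<phi> x) else 0)"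

lemma AE_support: "AE x in completion \<mu>. x \<in> \<Lambda>"
proof (rule AE_completion, rule AE_I[of _ _ "- \<Lambda>"])
  show "- \<Lambda> \<in> sets \<mu>" using compact sets_\<mu> by (simp add: compact_imp_closed)
qed (use null in auto)

lemma int_fun_measurable:
  "\<phi> \<in> restrict_space borel \<Lambda> \<rightarrow>\<^sub>M count_space UNIV \<longleftrightarrow> (\<lambda>x. if x \<in> \<Lambda> then \<phi> x else 0) \<in> borel \<rightarrow>\<^sub>M count_space (UNIV :: int set)"
  using compact by (intro measurable_restrict_space_iff) (auto simp: compact_imp_closed)

lemma int_fun_ess_bounded:
  assumes "\<phi> \<in> carrier (bounded_borel_int_funs \<Lambda>)"
  shows "(\<lambda>x. if x \<in> \<Lambda> then of_int (\<phi> x) else 0) \<in> ess_bounded (completion \<mu>)"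
proof -
  obtain c where c: "\<forall>x\<in>\<Lambda>. \<bar>\<phi> x\<bar> \<le> c" and "\<phi> \<in> restrict_space borel \<Lambda> \<rightarrow>\<^sub>M count_space UNIV"
    using assms by (auto simp: bounded_borel_int_funs_def)
  then have m: "(\<lambda>x. if x \<in> \<Lambda> then \<phi> x else 0) \<in> borel \<rightarrow>\<^sub>M count_space UNIV"
    by (simp add: int_fun_measurable)
  have "(\<lambda>x. of_int (if x \<in> \<Lambda> then \<phi> x else 0) :: complex) \<in> borel_measurable borel"
    by (rule measurable_compose[OF m]) simp
  also have "(\<lambda>x. of_int (if x \<in> \<Lambda> then \<phi> x else 0) :: complex) = (\<lambda>x. if x \<in> \<Lambda> then of_int (\<phi> x) else 0)"
    by auto
  finally have "(\<lambda>x. if x \<in> \<Lambda> then of_int (\<phi> x) else 0 :: complex) \<in> borel_measurable \<mu>"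
    using sets_\<mu> by (simp cong: measurable_cong_sets)
  then have "(\<lambda>x. if x \<in> \<Lambda> then of_int (\<phi> x) else 0 :: complex) \<in> borel_measurable (completion \<mu>)"
    by (rule measurable_completion)
  then show ?thesis
  proof (rule ess_boundedI)
    fix x
    have "cmod (of_int k :: complex) \<le> of_int \<bar>c\<bar>" if "\<bar>k\<bar> \<le> c" for k
      using that by (simp flip: of_int_abs)
    then show "cmod (if x \<in> \<Lambda> then of_int (\<phi> x) else 0 :: complex) \<le> of_int \<bar>c\<bar>"
      using c by auto
  qed
qed

lemma int_fun_class_closed:
  "\<phi> \<in> carrier (bounded_borel_int_funs \<Lambda>) \<Longrightarrow> int_fun_class \<phi> \<in> carrier (L_infty (completion \<mu>))"
  unfolding int_fun_class_def by (intro ae_class_closed int_fun_ess_bounded)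

lemma int_fun_class_mult:
  assumes "\<phi> \<in> carrier (bounded_borel_int_funs \<Lambda>)" "\<psi> \<in> carrier (bounded_borel_int_funs \<Lambda>)"
  shows "int_fun_class (\<phi> \<otimes>\<^bsub>bounded_borel_int_funs \<Lambda>\<^esub> \<psi>) =
    int_fun_class \<phi> \<oplus>\<^bsub>L_infty (completion \<mu>)\<^esub> int_fun_class \<psi>"
  unfolding int_fun_class_def using int_fun_ess_bounded[OF assms(1)] int_fun_ess_bounded[OF assms(2)]
  by (simp add: ae_class_add) (intro arg_cong[where f = "ae_class _"] ext, simp add: bounded_borel_int_funs_def)

lemma int_fun_class_eq_zero_iff:
  assumes "\<phi> \<in> carrier (bounded_borel_int_funs \<Lambda>)"
  shows "int_fun_class \<phi> = \<zero>\<^bsub>L_infty (completion \<mu>)\<^esub> \<longleftrightarrow> \<phi> \<in> null_int_funs (completion \<mu>) \<Lambda>"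
proof -
  have "int_fun_class \<phi> = \<zero>\<^bsub>L_infty (completion \<mu>)\<^esub> \<longleftrightarrow>
      (AE x in completion \<mu>. (if x \<in> \<Lambda> then of_int (\<phi> x) else 0) = (0 :: complex))"
    unfolding int_fun_class_def ae_class_zero
    by (rule ae_class_eq_iff) (use int_fun_ess_bounded[OF assms] in simp_all)
  also have "\<dots> \<longleftrightarrow> (AE x in completion \<mu>. x \<in> \<Lambda> \<longrightarrow> \<phi> x = 0)"
    by (rule AE_cong) auto
  finally show ?thesis using assms by (simp add: null_int_funs_def)
qed

text \<open>Supplies the indicators of level sets and the truncations into which a bounded function
  is later decomposed.\<close>

lemma int_fun_compose:
  assumes "\<phi> \<in> carrier (bounded_borel_int_funs \<Lambda>)" and "\<And>x. x \<in> \<Lambda> \<Longrightarrow> \<bar>h (\<phi> x)\<bar> \<le> c"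
  shows "(\<lambda>x\<in>\<Lambda>. h (\<phi> x)) \<in> carrier (bounded_borel_int_funs \<Lambda>)"
proof -
  have "\<phi> \<in> restrict_space borel \<Lambda> \<rightarrow>\<^sub>M count_space UNIV"
    using assms by (simp add: bounded_borel_int_funs_def)
  then have "(\<lambda>x. h (\<phi> x)) \<in> restrict_space borel \<Lambda> \<rightarrow>\<^sub>M count_space UNIV"
    by (rule measurable_compose) simp
  then have "(\<lambda>x\<in>\<Lambda>. h (\<phi> x)) \<in> restrict_space borel \<Lambda> \<rightarrow>\<^sub>M count_space UNIV"
    by (subst measurable_cong[where g = "\<lambda>x. h (\<phi> x)"]) (auto simp: space_restrict_space)
  then show ?thesis using assms(2) by (auto simp: bounded_borel_int_funs_def)
qed

lemma int_fun_class_idempotent: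
  assumes "\<phi> \<in> carrier (bounded_borel_int_funs \<Lambda>)" "\<And>x. x \<in> \<Lambda> \<Longrightarrow> \<phi> x = 0 \<or> \<phi> x = 1"
  shows "int_fun_class \<phi> \<in> idempotents (L_infty (completion \<mu>))"
proof -
  let ?f = "\<lambda>x. if x \<in> \<Lambda> then of_int (\<phi> x) else 0 :: complex"
  have "(\<lambda>x. ?f x * ?f x) = ?f" using assms(2) by fastforce
  then show ?thesis
    unfolding idempotents_def using int_fun_ess_bounded[OF assms(1)] int_fun_class_closed[OF assms(1)]
    by (simp add: int_fun_class_def ae_class_mult)
qed

text \<open>A representative \<open>f\<close> takes the values 0 and 1 almost everywhere, but it is
  measurable only for the completed measure, whereas \<open>\<phi>\<close> must be Borel. So
  \<open>Re (f x)\<close> is first replaced by a Borel function \<open>g\<close> equal to it almost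
  everywhere, and \<open>\<phi>\<close> is the indicator of \<open>g x = 1\<close> on
  \<open>\<Lambda>\<close>.\<close>

lemma idempotent_L_infty_int_fun:
  assumes "E \<in> idempotents (L_infty (completion \<mu>))"
  obtains \<phi> where "\<phi> \<in> carrier (bounded_borel_int_funs \<Lambda>)" "E = int_fun_class \<phi>"
proof -
  have "E \<in> carrier (L_infty (completion \<mu>))" and EE: "E \<otimes>\<^bsub>L_infty (completion \<mu>)\<^esub> E = E"
    using assms by (auto simp: idempotents_def)
  then obtain f where f: "f \<in> ess_bounded (completion \<mu>)" and E: "E = ae_class (completion \<mu>) f"
    by (auto elim: ae_classE)
  have "AE x in completion \<mu>. f x * f x = f x"
    using EE f by (simp add: E ae_class_mult ae_class_eq_iff ess_bounded_closed)
  then have f01: "AE x in completion \<mu>. f x = 0 \<or> f x = 1" by eventually_elim auto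
  have "f \<in> borel_measurable (completion \<mu>)" using f by (simp add: ess_bounded_def)
  then have "(\<lambda>x. Re (f x)) \<in> borel_measurable (completion \<mu>)"
    by (rule measurable_compose) (intro borel_measurable_continuous_onI continuous_intros)
  then obtain g where g: "g \<in> borel_measurable \<mu>" "AE x in \<mu>. Re (f x) = g x"
    using completion_ex_borel_measurable_real by blast
  have gb [measurable]: "g \<in> borel_measurable borel"
    using g(1) sets_\<mu> by (simp cong: measurable_cong_sets)
  have L [measurable]: "\<Lambda> \<in> sets borel" using compact by (simp add: compact_imp_closed)
  define \<phi> where "\<phi> = (\<lambda>x\<in>\<Lambda>. if g x = 1 then 1 else 0 :: int)"
  have "(\<lambda>x. if x \<in> \<Lambda> then \<phi> x else 0) = (\<lambda>x. if x \<in> \<Lambda> \<and> g x = 1 then 1 else 0)"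
    by (auto simp: \<phi>_def)
  also have "\<dots> \<in> borel \<rightarrow>\<^sub>M count_space UNIV" by measurable
  finally have m: "\<phi> \<in> restrict_space borel \<Lambda> \<rightarrow>\<^sub>M count_space UNIV"
    by (simp only: int_fun_measurable)
  have "\<phi> \<in> extensional \<Lambda>" "\<forall>x\<in>\<Lambda>. \<bar>\<phi> x\<bar> \<le> 1"
    by (auto simp: \<phi>_def)
  with m have \<phi>: "\<phi> \<in> carrier (bounded_borel_int_funs \<Lambda>)"
    by (auto simp: bounded_borel_int_funs_def)
  have "AE x in completion \<mu>. f x = (if x \<in> \<Lambda> then of_int (\<phi> x) else 0)"
    using f01 AE_completion[OF g(2)] AE_support by eventually_elim (auto simp: \<phi>_def)
  then have "E = int_fun_class \<phi>"
    unfolding E int_fun_class_def using f int_fun_ess_bounded[OF \<phi>] by (simp add: ae_class_eq_iff)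
  with \<phi> show ?thesis by (rule that)
qed

end

section \<open>The group of the commutant\<close>

theorem lemma4p4:
  fixes \<mu> :: "complex measure" and \<Lambda> :: "complex set" and n :: nat
    and f :: "(complex \<Rightarrow> complex) set" and A :: "(complex \<Rightarrow> complex) set mat"
  assumes "compact \<Lambda>"
    and "finite_measure \<mu>" and "sets \<mu> = sets borel" and "emeasure \<mu> (- \<Lambda>) = 0"
    and "1 \<le> n"
    and "A \<in> carrier (matrix_ring (L_infty (completion \<mu>)) n)"
    and "f \<in> carrier (L_infty (completion \<mu>))"
    and "\<And>i. i < n \<Longrightarrow> A $$ (i, i) = f"
    and "\<And>i j. j < i \<Longrightarrow> i < n \<Longrightarrow> A $$ (i, j) = \<zero>\<^bsub>L_infty (completion \<mu>)\<^esub>"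
    and "\<And>i. i + 1 < n \<Longrightarrow> supported_on (completion \<mu>) \<Lambda> (A $$ (i, i + 1))"
  shows "K0 (commutant (matrix_ring (L_infty (completion \<mu>)) n) A)
       \<cong> bounded_borel_int (completion \<mu>) \<Lambda>"
proof -
  let ?R = "L_infty (completion \<mu>)" and ?B = "bounded_borel_int_funs \<Lambda>"
  let ?M = "matrix_ring ?R n"
  note support = assms(1,3,4)
  note A = assms(6) and f = assms(7)
  interpret R: cring ?R by (rule cring_L_infty)
  interpret M: ring ?M by (rule R.ring_matrix_ring)
  define D where "D = rdiag ?R n f"
  define N where "N = A \<ominus>\<^bsub>?M\<^esub> D"
  have D: "D \<in> carrier ?M" using f by (simp add: D_def)
  have N: "N \<in> carrier ?M" using A D by (simp add: N_def)
  have N_index: "N $$ (i, j) = A $$ (i, j) \<ominus>\<^bsub>?R\<^esub> (if i = j then f else \<zero>\<^bsub>?R\<^esub>)" if "i < n" "j < n" for i j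
    using that R.matrix_ring_minus_index[OF A D that] by (simp add: N_def D_def)
  have A_closed: "A $$ (i, j) \<in> carrier ?R" if "i < n" "j < n" for i j
    using A that by (rule R.matrix_ring_index_closed)
  interpret J: cyclic_nilpotent ?R n N
  proof unfold_locales
    show "0 < n" using assms(5) by simp
    show "N $$ (i, j) = \<zero>\<^bsub>?R\<^esub>" if "i < n" "j \<le> i" for i j
      using that assms(8)[of i] assms(9)[of j i] f
      by (cases "i = j") (simp_all add: N_index R.minus_eq R.r_neg)
    show "non_zero_divisor ?R (N $$ (i, i + 1))" if i: "i + 1 < n" for i
    proof -
      have "A $$ (i, i + 1) \<in> carrier ?R" using i by (intro A_closed) auto
      then obtain g where g: "g \<in> ess_bounded (completion \<mu>)" "A $$ (i, i + 1) = ae_class (completion \<mu>) g"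
        by (rule ae_classE)
      have "AE x in completion \<mu>. x \<in> \<Lambda> \<longrightarrow> g x \<noteq> 0"
        using assms(10)[OF i] ae_class_mem[OF g(1)] unfolding supported_on_def g(2) by blast
      then have "AE x in completion \<mu>. g x \<noteq> 0"
        using AE_support[OF support] by eventually_elim blast
      then have "non_zero_divisor ?R (A $$ (i, i + 1))"
        unfolding g(2) by (rule non_zero_divisor_L_infty[OF g(1)])
      then show ?thesis using i A_closed[of i "i + 1"] by (simp add: N_index R.minus_eq)
    qed
  qed (rule N)
  let ?C = "J.C"
  \<comment> \<open>The diagonal part \<open>D\<close> is a scalar matrix, hence central, and drops
    out of the commutation relation.\<close>
  have "A \<otimes>\<^bsub>?M\<^esub> b = b \<otimes>\<^bsub>?M\<^esub> A \<longleftrightarrow> N \<otimes>\<^bsub>?M\<^esub> b = b \<otimes>\<^bsub>?M\<^esub> N" if b: "b \<in> carrier ?M" for b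
  proof -
    have "A = N \<oplus>\<^bsub>?M\<^esub> D" using A D by (simp add: N_def M.minus_eq M.a_assoc M.l_neg)
    then have "A \<otimes>\<^bsub>?M\<^esub> b = N \<otimes>\<^bsub>?M\<^esub> b \<oplus>\<^bsub>?M\<^esub> D \<otimes>\<^bsub>?M\<^esub> b" "b \<otimes>\<^bsub>?M\<^esub> A = b \<otimes>\<^bsub>?M\<^esub> N \<oplus>\<^bsub>?M\<^esub> b \<otimes>\<^bsub>?M\<^esub> D"
      using b N D by (simp_all add: M.l_distr M.r_distr)
    moreover have "D \<otimes>\<^bsub>?M\<^esub> b = b \<otimes>\<^bsub>?M\<^esub> D"
      unfolding D_def by (rule J.rdiag_commute[OF f b])
    ultimately show ?thesis using b N D by simp
  qed
  then have C: "commutant ?M A = ?C"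
    unfolding commutant_def J.centralizer_def
    by (intro arg_cong[where f = "\<lambda>X. ?M\<lparr>carrier := X\<rparr>"]) blast
  define G where "G = generate (add_monoid ?C) (idempotents ?C)"
  let ?H = "subgroup_generated (add_monoid ?C) (idempotents ?C)"
  \<comment> \<open>The candidate for the isomorphism, read backwards: functions go to scalar
    matrices in the group generated by the idempotents.\<close>
  define \<beta> where "\<beta> \<phi> = rdiag ?R n (int_fun_class \<mu> \<Lambda> \<phi>)" for \<phi>
  interpret B: comm_group ?B by (rule comm_group_bounded_borel_int_funs)
  note closed = int_fun_class_closed[OF support]
  have \<beta>_idem: "\<beta> \<phi> \<in> idempotents ?C" if "\<phi> \<in> carrier ?B" "\<And>x. x \<in> \<Lambda> \<Longrightarrow> \<phi> x = 0 \<or> \<phi> x = 1" for \<phi>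
    using int_fun_class_idempotent[OF support that] unfolding \<beta>_def J.idempotents_centralizer
    by blast
  have \<beta>_mult: "\<beta> (\<phi> \<otimes>\<^bsub>?B\<^esub> \<psi>) = \<beta> \<phi> \<oplus>\<^bsub>?C\<^esub> \<beta> \<psi>" if "\<phi> \<in> carrier ?B" "\<psi> \<in> carrier ?B" for \<phi> \<psi>
    using that closed by (simp add: \<beta>_def int_fun_class_mult[OF support])
  have \<beta>_closed: "\<beta> \<phi> \<in> carrier ?C" if "\<phi> \<in> carrier ?B" for \<phi>
    using closed[OF that] by (simp add: \<beta>_def J.rdiag_centralizer)
  interpret \<beta>: group_hom ?B "add_monoid ?C" \<beta>
    by unfold_locales (rule homI, auto simp: \<beta>_mult \<beta>_closed[simplified])
  have G_sub: "subgroup G (add_monoid ?C)"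
    unfolding G_def using J.C.idempotents_carrier by (intro J.C.add.generate_is_subgroup) simp
  have carrier_H: "carrier ?H = G"
    unfolding G_def carrier_subgroup_generated using J.C.idempotents_carrier by (simp add: Int_absorb1)
  \<comment> \<open>Induction on a bound of \<open>\<phi>\<close>: the extreme level sets, where
    \<open>\<phi>\<close> is \<open>m + 1\<close> or \<open>- (m + 1)\<close>, are shaved off by
    their indicators \<open>p\<close> and \<open>q\<close>, which leaves a function \<open>h\<close>
    bounded by \<open>m\<close>.\<close>
  have in_G: "\<beta> \<phi> \<in> G" if "\<phi> \<in> carrier ?B" "\<And>x. x \<in> \<Lambda> \<Longrightarrow> \<bar>\<phi> x\<bar> \<le> int m" for m \<phi>
    using that
  proof (induction m arbitrary: \<phi>)
    case 0
    then have "\<phi> = \<one>\<^bsub>?B\<^esub>"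
      by (auto simp: bounded_borel_int_funs_def extensional_def fun_eq_iff)
    then show ?case using \<beta>.hom_one subgroup.one_closed[OF G_sub] by simp
  next
    case (Suc m)
    define h p q where "h = (\<lambda>x\<in>\<Lambda>. \<phi> x - (if \<phi> x = int (Suc m) then 1 else 0) + (if \<phi> x = - int (Suc m) then 1 else 0))"
      and "p = (\<lambda>x\<in>\<Lambda>. if \<phi> x = int (Suc m) then 1 else 0 :: int)"
      and "q = (\<lambda>x\<in>\<Lambda>. if \<phi> x = - int (Suc m) then 1 else 0 :: int)"
    have h_le: "\<bar>h x\<bar> \<le> int m" if "x \<in> \<Lambda>" for x
      using Suc.prems(2)[OF that] that by (auto simp: h_def)
    have h: "h \<in> carrier ?B"
      unfolding h_def
      by (rule int_fun_compose[OF support Suc.prems(1), of "\<lambda>y. y - (if y = int (Suc m) then 1 else 0) + (if y = - int (Suc m) then 1 else 0)" "int m"])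
        (use h_le in \<open>simp add: h_def\<close>)
    have p: "p \<in> carrier ?B"
      unfolding p_def
      by (rule int_fun_compose[OF support Suc.prems(1), of "\<lambda>y. if y = int (Suc m) then 1 else 0" 1]) simp
    have q: "q \<in> carrier ?B"
      unfolding q_def
      by (rule int_fun_compose[OF support Suc.prems(1), of "\<lambda>y. if y = - int (Suc m) then 1 else 0" 1]) simp
    \<comment> \<open>The relation \<open>h = \<phi> - p + q\<close> is written without differences,
      so that only additivity of \<open>\<beta>\<close> is needed to carry it over.\<close>
    have "\<phi> \<otimes>\<^bsub>?B\<^esub> q = h \<otimes>\<^bsub>?B\<^esub> p"
      by (auto simp: bounded_borel_int_funs_def h_def p_def q_def fun_eq_iff)
    then have eq: "\<beta> \<phi> \<oplus>\<^bsub>?C\<^esub> \<beta> q = \<beta> h \<oplus>\<^bsub>?C\<^esub> \<beta> p"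
      using \<beta>_mult Suc.prems(1) h p q by metis
    have "\<beta> h \<in> G" by (rule Suc.IH[OF h h_le])
    moreover have "\<beta> p \<in> G" "\<beta> q \<in> G"
      unfolding G_def using p q by (auto intro!: generate.incl \<beta>_idem simp: p_def q_def)
    ultimately have "(\<beta> h \<oplus>\<^bsub>?C\<^esub> \<beta> p) \<otimes>\<^bsub>add_monoid ?C\<^esub> inv\<^bsub>add_monoid ?C\<^esub> \<beta> q \<in> G"
      using subgroup.m_closed[OF G_sub] subgroup.m_inv_closed[OF G_sub] by simp
    also have "(\<beta> h \<oplus>\<^bsub>?C\<^esub> \<beta> p) \<otimes>\<^bsub>add_monoid ?C\<^esub> inv\<^bsub>add_monoid ?C\<^esub> \<beta> q = \<beta> \<phi>"
      using J.C.add.inv_solve_right'[of "\<beta> \<phi>" "\<beta> h \<oplus>\<^bsub>?C\<^esub> \<beta> p" "\<beta> q"] eq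
        J.C.a_closed \<beta>_closed[OF h] \<beta>_closed[OF p] \<beta>_closed[OF q] \<beta>_closed[OF Suc.prems(1)]
      by (simp add: a_inv_def)
    finally show ?case .
  qed
  have image: "\<beta> ` carrier ?B = G"
  proof (intro equalityI subsetI)
    fix y assume "y \<in> \<beta> ` carrier ?B"
    then obtain \<phi> where \<phi>: "\<phi> \<in> carrier ?B" "y = \<beta> \<phi>" by blast
    then obtain c where c: "\<forall>x\<in>\<Lambda>. \<bar>\<phi> x\<bar> \<le> c"
      by (auto simp: bounded_borel_int_funs_def)
    have "\<bar>\<phi> x\<bar> \<le> int (nat c)" if "x \<in> \<Lambda>" for x using c that by force
    then show "y \<in> G" unfolding \<phi>(2) by (rule in_G[OF \<phi>(1)])
  next
    \<comment> \<open>The image of a homomorphism is a subgroup; it contains the generators of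
      \<open>G\<close>, hence \<open>G\<close>.\<close>
    have "idempotents ?C \<subseteq> \<beta> ` carrier ?B"
      unfolding J.idempotents_centralizer \<beta>_def
      by (auto elim!: idempotent_L_infty_int_fun[OF support])
    then show "y \<in> \<beta> ` carrier ?B" if "y \<in> G" for y
      using that J.C.add.generate_subgroup_incl[OF _ \<beta>.img_is_subgroup] unfolding G_def by blast
  qed
  interpret H: group ?H by (rule J.C.add.group_subgroup_generated)
  \<comment> \<open>With the generated subgroup as its target, \<open>\<beta>\<close> is surjective,
    and the first isomorphism theorem turns its kernel into the quotient that defines
    \<open>bounded_borel_int\<close>.\<close>
  interpret \<beta>H: group_hom ?B ?H \<beta>
    by unfold_locales (rule homI, use image carrier_H \<beta>_mult in auto)
  \<comment> \<open>A scalar matrix of positive size is zero exactly when its corner entry is, which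
    reduces the kernel to functions vanishing almost everywhere on \<open>\<Lambda>\<close>.\<close>
  have "\<beta> \<phi> = \<zero>\<^bsub>?C\<^esub> \<longleftrightarrow> \<phi> \<in> null_int_funs (completion \<mu>) \<Lambda>" if "\<phi> \<in> carrier ?B" for \<phi>
  proof -
    have "\<beta> \<phi> = \<zero>\<^bsub>?C\<^esub> \<longleftrightarrow> int_fun_class \<mu> \<Lambda> \<phi> = \<zero>\<^bsub>?R\<^esub>"
    proof
      assume "\<beta> \<phi> = \<zero>\<^bsub>?C\<^esub>"
      then have "\<beta> \<phi> $$ (0, 0) = \<zero>\<^bsub>?M\<^esub> $$ (0, 0)" by simp
      then show "int_fun_class \<mu> \<Lambda> \<phi> = \<zero>\<^bsub>?R\<^esub>"
        using J.n_pos by (simp add: \<beta>_def)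
    qed (auto simp: \<beta>_def R.matrix_ring_zero intro!: eq_matI)
    then show ?thesis using int_fun_class_eq_zero_iff[OF support that] by simp
  qed
  then have "kernel ?B ?H \<beta> = null_int_funs (completion \<mu>) \<Lambda>"
    unfolding kernel_def by (auto simp: null_int_funs_def)
  then have iso: "bounded_borel_int (completion \<mu>) \<Lambda> \<cong> ?H"
    and group: "group (bounded_borel_int (completion \<mu>) \<Lambda>)"
    using \<beta>H.FactGroup_iso normal.factorgroup_is_group[OF \<beta>H.normal_kernel] image carrier_H
    unfolding bounded_borel_int_def by auto
  have "K0 ?C \<cong> ?H"
    by (rule J.C.K0_iso_idempotents[OF J.exchange_ring_centralizer[OF exchange_ring_L_infty]
          J.add_torsion_free_centralizer[OF add_torsion_free_L_infty]])
  then show ?thesis unfolding C using group.iso_sym[OF group iso] by (rule iso_trans)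
qed

end
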